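(* Let $M, M' \subset \mathbb{C}^N$ be smooth generic submanifolds of the same dimension through $p$ and $p'$ respectively, and let $H: (\mathbb{C}^N, p) \to (\mathbb{C}^N,p')$ be a germ of a holomorphic mapping such that $H(M) \subset M'$ (as germs at $p$ and $p'$). Assume that $M$ is holomorphically nondegenerate and of finite type at $p$. Then $H$ is CR transversal to $M'$ at $p$ if and only if $\operatorname{Jac} H\not\equiv 0$.
   Context: A smooth real submanifold $M\subset\mathbb{C}^N$ of real codimension $d$ is generic if near every point of $M$ it is defined by an equation $\rho(Z,\bar Z)=0$, where $\rho=(\rho_1,\dots,\rho_d)$ is a smooth $\mathbb{R}^d$-valued function with $\partial\rho_1\wedge\cdots\wedge\partial\rho_d\neq 0$. Its CR bundle is $T^{0,1}M=\mathbb{C}TM\cap T^{0,1}\mathbb{C}^N$, and $T^{1,0}M=\overline{T^{0,1}M}$; sections of $T^{0,1}M$ are called CR (or $(0,1)$) vector fields. $M$ is of finite type at $p\in M$ (in the sense of Kohn and Bloom--Graham) if the complex Lie algebra $\mathfrak{g}_M$ generated by all smooth CR vector fields on $M$ (near $p$) and their conjugates satisfies $\mathfrak{g}_M(p)=\mathbb{C}T_pM$. $M$ is holomorphically nondegenerate at $p$ if there is no nontrivial germ at $p$ of a holomorphic vector field tangent to $M$ near $p$, where a germ at $p$ of a holomorphic vector field means $L=\sum_{j=1}^N\varphi_j(Z)\frac{\partial}{\partial Z_j}$ with $\varphi_j$ germs at $p$ of holomorphic functions, and tangency to $M$ means $L\rho=0$ on $M$ near $p$ for a local defining function $\rho$.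 $\operatorname{Jac}H$ denotes the (holomorphic) Jacobian determinant of $H$, and $\not\equiv 0$ means not identically zero near $p$. $H$ is CR transversal to $M'$ at $p$ (where $p'=H(p)\in M'$) if $T^{1,0}_{p'}M'+dH(T^{1,0}_p\mathbb{C}^N)=T^{1,0}_{p'}\mathbb{C}^N$. *)

theory Defs
  imports "HOL-Analysis.Analysis"
begin

section \<open>Smooth functions and Wirtinger derivatives\<close>

text \<open>For open sets in finite-dimensional spaces, membership in the class of order \<open>Suc k\<close> amounts
  to differentiability together with all directional derivatives being of order \<open>k\<close>.\<close>

fun Ck_on :: "nat \<Rightarrow> ('a::euclidean_space \<Rightarrow> 'b::real_normed_vector) \<Rightarrow> 'a set \<Rightarrow> bool" where
  "Ck_on 0 f U \<longleftrightarrow> continuous_on U f"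
| "Ck_on (Suc k) f U \<longleftrightarrow>
     (\<forall>z\<in>U. f differentiable (at z)) \<and> (\<forall>v. Ck_on k (\<lambda>z. frechet_derivative f (at z) v) U)"

definition smooth_on :: "('a::euclidean_space \<Rightarrow> 'b::real_normed_vector) \<Rightarrow> 'a set \<Rightarrow> bool" where
  "smooth_on f U \<longleftrightarrow> (\<forall>k. Ck_on k f U)"

text \<open>The derivatives with respect to \<open>Z_k\<close> and \<open>conj Z_k\<close> of a (real-differentiable)
  complex function; the direction \<open>axis k 1\<close> is \<open>x_k\<close> and \<open>axis k \<i>\<close> is \<open>y_k\<close>.\<close>

definition dZ :: "(complex^'n \<Rightarrow> complex) \<Rightarrow> complex^'n \<Rightarrow> 'n::finite \<Rightarrow> complex" where
  "dZ f z k = (frechet_derivative f (at z) (axis k 1)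
             - \<i> * frechet_derivative f (at z) (axis k \<i>)) / 2"

definition dZbar :: "(complex^'n \<Rightarrow> complex) \<Rightarrow> complex^'n \<Rightarrow> 'n::finite \<Rightarrow> complex" where
  "dZbar f z k = (frechet_derivative f (at z) (axis k 1)
                + \<i> * frechet_derivative f (at z) (axis k \<i>)) / 2"

text \<open>Holomorphic functions and mappings of several variables, on open sets.\<close>

definition holo_fun_on :: "(complex^'n::finite \<Rightarrow> complex) \<Rightarrow> (complex^'n) set \<Rightarrow> bool" where
  "holo_fun_on f U \<longleftrightarrow>
     (\<forall>z\<in>U. \<exists>f'. (f has_derivative f') (at z) \<and> (\<forall>c v. f' (c *s v) = c * f' v))"

definition holo_map_on :: "(complex^'n::finite \<Rightarrow> complex^'m) \<Rightarrow> (complex^'n) set \<Rightarrow> bool" where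
  "holo_map_on F U \<longleftrightarrow> (\<forall>i. holo_fun_on (\<lambda>z. F z $ i) U)"

definition Jac :: "(complex^'n::finite \<Rightarrow> complex^'n) \<Rightarrow> complex^'n \<Rightarrow> complex" where
  "Jac F z = det (\<chi> i k. dZ (\<lambda>w. F w $ i) z k)"


section \<open>Complexified tangent vectors of \<open>\<complex>\<^sup>N\<close>\<close>

text \<open>The pair \<open>(a, b)\<close> stands for the complexified tangent vector
  \<open>\<Sum>k. a_k \<partial>/\<partial>Z_k + b_k \<partial>/\<partial>(conj Z_k)\<close>.\<close>

type_synonym 'n ctv = "(complex^'n) \<times> (complex^'n)"

definition ctv_apply :: "'n::finite ctv \<Rightarrow> (complex^'n \<Rightarrow> complex) \<Rightarrow> complex^'n \<Rightarrow> complex" where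
  "ctv_apply X f z = (\<Sum>k\<in>UNIV. fst X $ k * dZ f z k + snd X $ k * dZbar f z k)"

definition ctv_scale :: "complex \<Rightarrow> 'n::finite ctv \<Rightarrow> 'n ctv" where
  "ctv_scale c X = (c *s fst X, c *s snd X)"

definition ctv_cnj :: "'n::finite ctv \<Rightarrow> 'n ctv" where
  "ctv_cnj X = (\<chi> k. cnj (snd X $ k), \<chi> k. cnj (fst X $ k))"

definition T01_space :: "'n::finite ctv set" where
  "T01_space = {X. fst X = 0}"

definition T10_space :: "'n::finite ctv set" where
  "T10_space = {X. snd X = 0}"

text \<open>The complexified differential at \<open>z\<close> of a mapping \<open>F\<close>: the coefficients of the image vector
  are obtained by applying \<open>X\<close> to the components of \<open>F\<close> and to their conjugates.\<close>

definition ctv_push :: "(complex^'n::finite \<Rightarrow> complex^'m::finite) \<Rightarrow> complex^'n \<Rightarrow> 'n ctv \<Rightarrow> 'm ctv" where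
  "ctv_push F z X = (\<chi> i. ctv_apply X (\<lambda>w. F w $ i) z, \<chi> i. ctv_apply X (\<lambda>w. cnj (F w $ i)) z)"

definition lie_bracket ::
  "(complex^'n::finite \<Rightarrow> 'n ctv) \<Rightarrow> (complex^'n \<Rightarrow> 'n ctv) \<Rightarrow> complex^'n \<Rightarrow> 'n ctv" where
  "lie_bracket X Y z =
     (\<chi> j. ctv_apply (X z) (\<lambda>w. fst (Y w) $ j) z - ctv_apply (Y z) (\<lambda>w. fst (X w) $ j) z,
      \<chi> j. ctv_apply (X z) (\<lambda>w. snd (Y w) $ j) z - ctv_apply (Y z) (\<lambda>w. snd (X w) $ j) z)"


section \<open>Generic submanifolds\<close>

text \<open>The \<open>(1,0)\<close>-form \<open>\<partial>r\<close> at \<open>z\<close>, evaluated on the \<open>(1,0)\<close>-vector with coefficients \<open>v\<close>.\<close>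

definition del_form :: "(complex^'n \<Rightarrow> real) \<Rightarrow> complex^'n \<Rightarrow> complex^'n::finite \<Rightarrow> complex" where
  "del_form r z v = (\<Sum>k\<in>UNIV. dZ (\<lambda>w. complex_of_real (r w)) z k * v $ k)"

text \<open>The wedge product of the one-forms \<open>\<alpha> 0, \<dots>, \<alpha> (d - 1)\<close>, as an alternating form
  evaluated on \<open>v 0, \<dots>, v (d - 1)\<close>.\<close>

definition wedge :: "nat \<Rightarrow> (nat \<Rightarrow> 'v \<Rightarrow> complex) \<Rightarrow> (nat \<Rightarrow> 'v) \<Rightarrow> complex" where
  "wedge d \<alpha> v = (\<Sum>\<sigma> | \<sigma> permutes {..<d}. of_int (sign \<sigma>) * (\<Prod>j<d. \<alpha> j (v (\<sigma> j))))"

text \<open>\<open>\<rho>\<close> is an \<open>\<real>\<^sup>d\<close>-valued function with components \<open>\<rho> 0, \<dots>, \<rho> (d - 1)\<close>.\<close>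

definition local_defining_function ::
  "nat \<Rightarrow> (complex^'n::finite) set \<Rightarrow> complex^'n \<Rightarrow> (complex^'n) set \<Rightarrow> (nat \<Rightarrow> complex^'n \<Rightarrow> real) \<Rightarrow> bool"
  where
  "local_defining_function d M p U \<rho> \<longleftrightarrow>
     open U \<and> p \<in> U \<and> (\<forall>j<d. smooth_on (\<rho> j) U) \<and>
     M \<inter> U = {z \<in> U. \<forall>j<d. \<rho> j z = 0} \<and>
     (\<forall>z\<in>U. wedge d (\<lambda>j. del_form (\<rho> j) z) \<noteq> (\<lambda>v. 0))"

text \<open>\<open>d\<close> is the real codimension.\<close>

definition generic_submanifold :: "nat \<Rightarrow> (complex^'n::finite) set \<Rightarrow> bool" where
  "generic_submanifold d M \<longleftrightarrow> (\<forall>p\<in>M. \<exists>U \<rho>. local_defining_function d M p U \<rho>)"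

text \<open>The complexified tangent space at \<open>z \<in> M\<close> is the kernel of the complexified differential of
  a local defining function; it does not depend on the choice of that function.\<close>

definition ctangent_space :: "nat \<Rightarrow> (complex^'n::finite) set \<Rightarrow> complex^'n \<Rightarrow> 'n ctv set" where
  "ctangent_space d M z =
     {X. \<exists>U \<rho>. local_defining_function d M z U \<rho> \<and>
           (\<forall>j<d. ctv_apply X (\<lambda>w. complex_of_real (\<rho> j w)) z = 0)}"

definition T01 :: "nat \<Rightarrow> (complex^'n::finite) set \<Rightarrow> complex^'n \<Rightarrow> 'n ctv set" where
  "T01 d M z = ctangent_space d M z \<inter> T01_space"

definition T10 :: "nat \<Rightarrow> (complex^'n::finite) set \<Rightarrow> complex^'n \<Rightarrow> 'n ctv set" where
  "T10 d M z = ctv_cnj ` T01 d M z"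


section \<open>Finite type, holomorphic nondegeneracy, CR transversality\<close>

text \<open>A CR vector field on \<open>M\<close> near \<open>p\<close> is represented by a smooth extension to a neighbourhood of \<open>p\<close>
  in \<open>\<complex>\<^sup>N\<close>. All fields in the Lie algebra below are tangent to \<open>M\<close>, so that the values of brackets on
  \<open>M\<close> near \<open>p\<close> do not depend on the extensions.\<close>

definition CR_vector_field ::
  "nat \<Rightarrow> (complex^'n::finite) set \<Rightarrow> complex^'n \<Rightarrow> (complex^'n \<Rightarrow> 'n ctv) \<Rightarrow> bool" where
  "CR_vector_field d M p X \<longleftrightarrow>
     (\<exists>U. open U \<and> p \<in> U \<and> smooth_on X U \<and> (\<forall>z\<in>M \<inter> U. X z \<in> T01 d M z))"

inductive_set CR_lie_algebra ::
  "nat \<Rightarrow> (complex^'n::finite) set \<Rightarrow> complex^'n \<Rightarrow> (complex^'n \<Rightarrow> 'n ctv) set"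
  for d M p where
  CR: "CR_vector_field d M p X \<Longrightarrow> X \<in> CR_lie_algebra d M p"
| CR_cnj: "CR_vector_field d M p X \<Longrightarrow> (\<lambda>z. ctv_cnj (X z)) \<in> CR_lie_algebra d M p"
| add: "X \<in> CR_lie_algebra d M p \<Longrightarrow> Y \<in> CR_lie_algebra d M p \<Longrightarrow>
    (\<lambda>z. X z + Y z) \<in> CR_lie_algebra d M p"
| scale: "X \<in> CR_lie_algebra d M p \<Longrightarrow> (\<lambda>z. ctv_scale c (X z)) \<in> CR_lie_algebra d M p"
| bracket: "X \<in> CR_lie_algebra d M p \<Longrightarrow> Y \<in> CR_lie_algebra d M p \<Longrightarrow>
    lie_bracket X Y \<in> CR_lie_algebra d M p"

definition finite_type :: "nat \<Rightarrow> (complex^'n::finite) set \<Rightarrow> complex^'n \<Rightarrow> bool" where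
  "finite_type d M p \<longleftrightarrow> (\<lambda>X. X p) ` CR_lie_algebra d M p = ctangent_space d M p"

text \<open>\<open>\<phi>\<close> is the coefficient vector of the holomorphic vector field \<open>L = \<Sum>k. \<phi>_k \<partial>/\<partial>Z_k\<close>.\<close>

definition tangent_holo_field ::
  "nat \<Rightarrow> (complex^'n::finite) set \<Rightarrow> complex^'n \<Rightarrow> (complex^'n \<Rightarrow> complex^'n) \<Rightarrow> bool" where
  "tangent_holo_field d M p \<phi> \<longleftrightarrow>
     (\<exists>V. open V \<and> p \<in> V \<and> holo_map_on \<phi> V) \<and>
     (\<exists>U \<rho>. local_defining_function d M p U \<rho> \<and>
        (\<forall>\<^sub>F z in nhds p. z \<in> M \<longrightarrow>
           (\<forall>j<d. ctv_apply (\<phi> z, 0) (\<lambda>w. complex_of_real (\<rho> j w)) z = 0)))"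

definition holo_nondegenerate :: "nat \<Rightarrow> (complex^'n::finite) set \<Rightarrow> complex^'n \<Rightarrow> bool" where
  "holo_nondegenerate d M p \<longleftrightarrow>
     \<not> (\<exists>\<phi>. tangent_holo_field d M p \<phi> \<and> \<not> (\<forall>\<^sub>F z in nhds p. \<phi> z = 0))"

definition CR_transversal ::
  "nat \<Rightarrow> (complex^'n::finite) set \<Rightarrow> (complex^'n \<Rightarrow> complex^'n) \<Rightarrow> complex^'n \<Rightarrow> bool" where
  "CR_transversal d M' H p \<longleftrightarrow>
     {X + Y | X Y. X \<in> T10 d M' (H p) \<and> Y \<in> ctv_push H p ` T10_space} = T10_space"

end

theory Submission
  imports Defs "HOL-Library.Extended_Nat" "HOL-Complex_Analysis.Cauchy_Integral_Formula"
    "Jordan_Normal_Form.Determinant"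
begin

text \<open>Write \<open>g = \<rho>' \<circ> H\<close>. Since \<open>g\<close> vanishes on \<open>M\<close>, there \<open>\<partial>g = A \<partial>\<rho>\<close> with a real
  \<open>d \<times> d\<close> matrix \<open>A\<close>, and \<open>H\<close> is transversal at \<open>p\<close> iff \<open>\<delta> = det A\<close> does not vanish at \<open>p\<close>.

  If \<open>H\<close> is transversal but \<open>J = Jac H\<close> vanishes identically, the kernel of \<open>H_Z\<close> contains a nontrivial
  holomorphic field. It is annihilated by \<open>\<partial>g\<close>, hence by \<open>\<partial>\<rho>\<close>, so \<open>M\<close> is holomorphically
  degenerate.

  Conversely, by \<open>\<partial>\<rho>'(H) H_Z = A \<partial>\<rho>\<close> and Cramer's rule \<open>\<delta>\<close> divides a power of \<open>J\<close> in the ring of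
  germs of smooth functions on \<open>M\<close>; as \<open>\<delta>\<close> is real, it also divides a power of \<open>conj J\<close>. CR
  fields annihilate \<open>J\<close>, their conjugates annihilate \<open>conj J\<close>. Let \<open>v\<close> be a discrete valuation on germs
  that is finite at \<open>J\<close> and \<open>conj J\<close>. If \<open>X c = 0\<close> and \<open>\<delta>\<close> divides \<open>c\<close>, then
  \<open>exp (t X) \<delta>\<close> divides the constant series \<open>c\<close>, and Gauss' lemma gives \<open>v (X\<^sup>i \<delta>) \<ge> v \<delta>\<close>.
  Applying this to valuations pulled back along such flows as well, one gets \<open>v (X h) \<ge> v \<delta>\<close> whenever
  \<open>v h \<ge> v \<delta>\<close> for all \<open>v\<close>, and therefore for all words in the fields of the CR Lie algebra applied to \<open>\<delta>\<close>. By
  finite type, admissible valuations that measure the vanishing at \<open>p\<close> along such words exist, and for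
  these \<open>v \<delta> = 0\<close>, that is, \<open>\<delta> p \<noteq> 0\<close>.\<close>

text \<open>Smooth germs on M form neither a domain nor a Noetherian ring, so the divisors of a
  power of \<open>J\<close> cannot be found by factoring; valuations into \<open>enat\<close>, where
  \<infinity> marks a prime ideal, take the place of factorization. Divisibility alone only bounds v
  \<delta> by the value of a power of J. The proof plays two facts against each other:
  differentiation never leads below v \<delta>, yet some word turns \<delta> into a germ that is
  nonzero at p and so has value 0. A bound at one fixed valuation would not survive a second field,
  whose constants are different: a CR field kills J but need not kill conj J. Hence the bound is
  claimed for all valuations finite at both, a class closed under Gauss extension. Two weights of
  the time variable occur. Weight 0 (\<open>gauss 1 0\<close>) loses nothing and serves the
  comparison with a constant of the flow. Weight 1/2, scaled to integers as
  \<open>gauss 2 1\<close>, keeps the valuation centred at p; the 1/2 lost per derivative disappears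
  because values are integers.\<close>

no_notation Matrix.vec_index (infixl \<open>$\<close> 100)
no_notation Matrix.scalar_prod (infix \<open>\<bullet>\<close> 70)
hide_const (open) Determinant.det Matrix.mat Matrix.vec Matrix.row Matrix.rows Matrix.col
hide_type (open) Matrix.vec Matrix.mat
hide_fact (open) Determinant.det_def Matrix.vec_eq_iff Matrix.mat_def

section \<open>Valuations on germs\<close>

text \<open>Pascal's rule with the index shifted, in exactly the shape that differentiating the
  Leibniz sum produces.\<close>

lemma leibniz_sum_step:
  fixes F G :: "nat \<Rightarrow> 'a::comm_semiring_1"
  shows "(\<Sum>i\<le>n. of_nat (n choose i) * (F (Suc i) * G (n - i) + F i * G (Suc (n - i))))
    = (\<Sum>i\<le>Suc n. of_nat (Suc n choose i) * (F i * G (Suc n - i)))"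
proof -
  have "(\<Sum>i\<le>Suc n. of_nat (Suc n choose i) * (F i * G (Suc n - i)))
      = F 0 * G (Suc n) + (\<Sum>i\<le>n. of_nat (Suc n choose Suc i) * (F (Suc i) * G (n - i)))"
    by (subst sum.atMost_Suc_shift) simp
  also have "(\<Sum>i\<le>n. of_nat (Suc n choose Suc i) * (F (Suc i) * G (n - i)))
      = (\<Sum>i\<le>n. of_nat (n choose i) * (F (Suc i) * G (n - i)))
        + (\<Sum>i\<le>n. of_nat (n choose Suc i) * (F (Suc i) * G (n - i)))"
    by (simp add: algebra_simps sum.distrib)
  also have "(\<Sum>i\<le>n. of_nat (n choose Suc i) * (F (Suc i) * G (n - i)))
      = (\<Sum>i<n. of_nat (n choose Suc i) * (F (Suc i) * G (Suc (n - Suc i))))"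
    by (simp add: lessThan_Suc_atMost[symmetric] Suc_diff_Suc binomial_eq_0)
  finally have "(\<Sum>i\<le>Suc n. of_nat (Suc n choose i) * (F i * G (Suc n - i)))
      = (\<Sum>i\<le>n. of_nat (n choose i) * (F (Suc i) * G (n - i)))
        + (F 0 * G (Suc n) + (\<Sum>i<n. of_nat (n choose Suc i) * (F (Suc i) * G (Suc (n - Suc i)))))"
    by (simp add: add_ac)
  also have "F 0 * G (Suc n) + (\<Sum>i<n. of_nat (n choose Suc i) * (F (Suc i) * G (Suc (n - Suc i))))
      = (\<Sum>i\<le>n. of_nat (n choose i) * (F i * G (Suc (n - i))))"
    by (cases n) (simp_all add: sum.atMost_Suc_shift lessThan_Suc_atMost del: sum.atMost_Suc)
  finally show ?thesis
    by (simp add: algebra_simps sum.distrib)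
qed

text \<open>Germs are kept as plain functions modulo \<open>eqg\<close>, so no quotient is formed
  and the laws of derivations hold only up to \<open>eqg\<close>. In the application
  \<open>F\<close> is the filter of neighbourhoods of p within M, while \<open>S\<close> consists of
  functions smooth in the ambient space.\<close>

locale germ_algebra =
  fixes F :: "'z filter" and S :: "('z \<Rightarrow> complex) set"
  assumes const_in: "(\<lambda>_. c) \<in> S"
    and add_in: "f \<in> S \<Longrightarrow> g \<in> S \<Longrightarrow> (\<lambda>z. f z + g z) \<in> S"
    and mult_in: "f \<in> S \<Longrightarrow> g \<in> S \<Longrightarrow> (\<lambda>z. f z * g z) \<in> S"
begin

definition eqg :: "('z \<Rightarrow> complex) \<Rightarrow> ('z \<Rightarrow> complex) \<Rightarrow> bool" (infix "\<simeq>" 50) where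
  "f \<simeq> g \<longleftrightarrow> (\<forall>\<^sub>F z in F. f z = g z)"

lemma eqg_refl [simp]: "f \<simeq> f"
  by (simp add: eqg_def)

lemma eqg_trans [trans]: "f \<simeq> g \<Longrightarrow> g \<simeq> h \<Longrightarrow> f \<simeq> h"
  unfolding eqg_def by (auto elim: eventually_elim2)

lemma eqg_add: "f \<simeq> f' \<Longrightarrow> g \<simeq> g' \<Longrightarrow> (\<lambda>z. f z + g z) \<simeq> (\<lambda>z. f' z + g' z)"
  unfolding eqg_def by (auto elim: eventually_elim2)

lemma eqg_mult: "f \<simeq> f' \<Longrightarrow> g \<simeq> g' \<Longrightarrow> (\<lambda>z. f z * g z) \<simeq> (\<lambda>z. f' z * g' z)"
  unfolding eqg_def by (auto elim: eventually_elim2)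

lemma sum_in: "finite A \<Longrightarrow> (\<And>i. i \<in> A \<Longrightarrow> f i \<in> S) \<Longrightarrow> (\<lambda>z. \<Sum>i\<in>A. f i z) \<in> S"
  by (induction A rule: finite_induct) (auto intro: const_in add_in)

lemma eqg_sum:
  "finite A \<Longrightarrow> (\<And>i. i \<in> A \<Longrightarrow> f i \<simeq> g i) \<Longrightarrow> (\<lambda>z. \<Sum>i\<in>A. f i z) \<simeq> (\<lambda>z. \<Sum>i\<in>A. g i z)"
  by (induction A rule: finite_induct) (auto intro: eqg_add)

lemma cmult_in: "f \<in> S \<Longrightarrow> (\<lambda>z. c * f z) \<in> S"
  by (rule mult_in[OF const_in])

text \<open>The substantial clause is compatibility with \<open>eqg\<close>: for a vector field on
  the ambient space it expresses tangency to M.\<close>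

definition derivation :: "(('z \<Rightarrow> complex) \<Rightarrow> 'z \<Rightarrow> complex) \<Rightarrow> bool" where
  "derivation D \<longleftrightarrow>
     (\<forall>f\<in>S. D f \<in> S) \<and> (\<forall>f\<in>S. \<forall>g\<in>S. f \<simeq> g \<longrightarrow> D f \<simeq> D g) \<and>
     (\<forall>f\<in>S. \<forall>g\<in>S. D (\<lambda>z. f z + g z) \<simeq> (\<lambda>z. D f z + D g z)) \<and>
     (\<forall>f\<in>S. \<forall>g\<in>S. D (\<lambda>z. f z * g z) \<simeq> (\<lambda>z. D f z * g z + f z * D g z)) \<and>
     (\<forall>c. D (\<lambda>_. c) \<simeq> (\<lambda>_. 0))"

context
  fixes D assumes D: "derivation D"
begin

lemma der_in: "f \<in> S \<Longrightarrow> D f \<in> S"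
  and der_cong: "f \<in> S \<Longrightarrow> g \<in> S \<Longrightarrow> f \<simeq> g \<Longrightarrow> D f \<simeq> D g"
  and der_add: "f \<in> S \<Longrightarrow> g \<in> S \<Longrightarrow> D (\<lambda>z. f z + g z) \<simeq> (\<lambda>z. D f z + D g z)"
  and der_mult: "f \<in> S \<Longrightarrow> g \<in> S \<Longrightarrow> D (\<lambda>z. f z * g z) \<simeq> (\<lambda>z. D f z * g z + f z * D g z)"
  and der_const: "D (\<lambda>_. c) \<simeq> (\<lambda>_. 0)"
  using D unfolding derivation_def by blast+

lemma der_cmult: "f \<in> S \<Longrightarrow> D (\<lambda>z. c * f z) \<simeq> (\<lambda>z. c * D f z)"
proof -
  assume f: "f \<in> S"
  have "D (\<lambda>z. c * f z) \<simeq> (\<lambda>z. D (\<lambda>_. c) z * f z + c * D f z)"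
    by (rule der_mult[OF const_in f])
  also have "\<dots> \<simeq> (\<lambda>z. 0 * f z + c * D f z)"
    by (intro eqg_add eqg_mult der_const eqg_refl)
  finally show ?thesis by simp
qed

lemma der_sum:
  "finite A \<Longrightarrow> (\<And>i. i \<in> A \<Longrightarrow> f i \<in> S) \<Longrightarrow> D (\<lambda>z. \<Sum>i\<in>A. f i z) \<simeq> (\<lambda>z. \<Sum>i\<in>A. D (f i) z)"
proof (induction A rule: finite_induct)
  case empty
  then show ?case using der_const[of 0] by simp
next
  case (insert a A)
  have "D (\<lambda>z. f a z + (\<Sum>i\<in>A. f i z)) \<simeq> (\<lambda>z. D (f a) z + D (\<lambda>z. \<Sum>i\<in>A. f i z) z)"
    using insert by (intro der_add sum_in) auto
  also have "\<dots> \<simeq> (\<lambda>z. D (f a) z + (\<Sum>i\<in>A. D (f i) z))"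
    using insert by (intro eqg_add) auto
  finally show ?case using insert by simp
qed

lemma pow_in: "f \<in> S \<Longrightarrow> (D ^^ i) f \<in> S"
  by (induction i) (auto intro: der_in)

lemma pow_cong: "f \<in> S \<Longrightarrow> g \<in> S \<Longrightarrow> f \<simeq> g \<Longrightarrow> (D ^^ i) f \<simeq> (D ^^ i) g"
  by (induction i) (auto intro: der_cong pow_in)

lemma pow_add: "f \<in> S \<Longrightarrow> g \<in> S \<Longrightarrow> (D ^^ i) (\<lambda>z. f z + g z) \<simeq> (\<lambda>z. (D ^^ i) f z + (D ^^ i) g z)"
proof (induction i)
  case (Suc i)
  have "D ((D ^^ i) (\<lambda>z. f z + g z)) \<simeq> D (\<lambda>z. (D ^^ i) f z + (D ^^ i) g z)"
    using Suc by (intro der_cong pow_in add_in) auto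
  also have "\<dots> \<simeq> (\<lambda>z. D ((D ^^ i) f) z + D ((D ^^ i) g) z)"
    using Suc by (intro der_add pow_in) auto
  finally show ?case by simp
qed simp

lemma pow_zero: "(D ^^ i) (\<lambda>_. 0) \<simeq> (\<lambda>_. 0)"
proof (induction i)
  case (Suc i)
  have "D ((D ^^ i) (\<lambda>_. 0)) \<simeq> D (\<lambda>_. 0)"
    using Suc by (intro der_cong pow_in const_in)
  also have "\<dots> \<simeq> (\<lambda>_. 0)" by (rule der_const)
  finally show ?case by simp
qed simp

lemma leibniz:
  assumes f: "f \<in> S" and g: "g \<in> S"
  shows "(D ^^ n) (\<lambda>z. f z * g z)
    \<simeq> (\<lambda>z. \<Sum>i\<le>n. of_nat (n choose i) * ((D ^^ i) f z * (D ^^ (n - i)) g z))"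
proof (induction n)
  case (Suc n)
  let ?f = "\<lambda>i. (D ^^ i) f" and ?g = "\<lambda>i. (D ^^ i) g"
  have inS: "(\<lambda>z. ?f i z * ?g j z) \<in> S" for i j
    using f g by (intro mult_in pow_in)
  have "D ((D ^^ n) (\<lambda>z. f z * g z))
      \<simeq> D (\<lambda>z. \<Sum>i\<le>n. of_nat (n choose i) * (?f i z * ?g (n - i) z))"
    using Suc f g by (intro der_cong pow_in sum_in cmult_in mult_in) auto
  also have "\<dots> \<simeq> (\<lambda>z. \<Sum>i\<le>n. D (\<lambda>z. of_nat (n choose i) * (?f i z * ?g (n - i) z)) z)"
    by (intro der_sum cmult_in inS) auto
  also have "\<dots> \<simeq> (\<lambda>z. \<Sum>i\<le>n. of_nat (n choose i)
      * (?f (Suc i) z * ?g (n - i) z + ?f i z * ?g (Suc (n - i)) z))"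
  proof (rule eqg_sum)
    fix i
    have "D (\<lambda>z. of_nat (n choose i) * (?f i z * ?g (n - i) z))
        \<simeq> (\<lambda>z. of_nat (n choose i) * D (\<lambda>z. ?f i z * ?g (n - i) z) z)"
      by (intro der_cmult inS)
    also have "\<dots> \<simeq> (\<lambda>z. of_nat (n choose i) * (D (?f i) z * ?g (n - i) z + ?f i z * D (?g (n - i)) z))"
      using f g by (intro eqg_mult der_mult pow_in) auto
    finally show "D (\<lambda>z. of_nat (n choose i) * (?f i z * ?g (n - i) z))
        \<simeq> (\<lambda>z. of_nat (n choose i) * (?f (Suc i) z * ?g (n - i) z + ?f i z * ?g (Suc (n - i)) z))"
      by simp
  qed simp
  also have "\<dots> = (\<lambda>z. \<Sum>i\<le>Suc n. of_nat (Suc n choose i) * (?f i z * ?g (Suc n - i) z))"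
    by (rule ext) (rule leibniz_sum_step)
  finally show ?case by simp
qed simp

end

text \<open>The value \<infinity> is not reserved for the zero germ: the germs of value \<infinity>
  form a prime ideal, modulo which this is an ordinary, possibly trivial, valuation. This makes
  valuations available although smooth germs have zero divisors.\<close>

definition valuation :: "(('z \<Rightarrow> complex) \<Rightarrow> enat) \<Rightarrow> bool" where
  "valuation v \<longleftrightarrow>
     (\<forall>f\<in>S. \<forall>g\<in>S. f \<simeq> g \<longrightarrow> v f = v g) \<and>
     (\<forall>f\<in>S. \<forall>g\<in>S. v (\<lambda>z. f z * g z) = v f + v g) \<and>
     (\<forall>f\<in>S. \<forall>g\<in>S. min (v f) (v g) \<le> v (\<lambda>z. f z + g z)) \<and>
     (\<forall>c. v (\<lambda>_. c) = (if c = 0 then \<infinity> else 0))"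

context
  fixes v assumes v: "valuation v"
begin

lemma val_cong: "f \<in> S \<Longrightarrow> g \<in> S \<Longrightarrow> f \<simeq> g \<Longrightarrow> v f = v g"
  and val_mult: "f \<in> S \<Longrightarrow> g \<in> S \<Longrightarrow> v (\<lambda>z. f z * g z) = v f + v g"
  and val_add: "f \<in> S \<Longrightarrow> g \<in> S \<Longrightarrow> min (v f) (v g) \<le> v (\<lambda>z. f z + g z)"
  and val_const: "v (\<lambda>_. c) = (if c = 0 then \<infinity> else 0)"
  using v unfolding valuation_def by blast+

lemma val_cmult: "f \<in> S \<Longrightarrow> c \<noteq> 0 \<Longrightarrow> v (\<lambda>z. c * f z) = v f"
  by (subst val_mult) (auto simp: const_in val_const)

lemma val_cmult_le: "f \<in> S \<Longrightarrow> v f \<le> v (\<lambda>z. c * f z)"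
  by (subst val_mult) (auto simp: const_in val_const)

lemma val_sum:
  "finite A \<Longrightarrow> (\<And>i. i \<in> A \<Longrightarrow> f i \<in> S) \<Longrightarrow> (\<And>i. i \<in> A \<Longrightarrow> k \<le> v (f i))
    \<Longrightarrow> k \<le> v (\<lambda>z. \<Sum>i\<in>A. f i z)"
proof (induction A rule: finite_induct)
  case empty
  then show ?case by (simp add: val_const)
next
  case (insert a A)
  have "k \<le> min (v (f a)) (v (\<lambda>z. \<Sum>i\<in>A. f i z))" using insert by auto
  also have "\<dots> \<le> v (\<lambda>z. f a z + (\<Sum>i\<in>A. f i z))"
    using insert by (intro val_add sum_in) auto
  finally show ?case using insert by simp
qed

lemma val_power: "f \<in> S \<Longrightarrow> v f \<noteq> \<infinity> \<Longrightarrow> v (\<lambda>z. f z ^ n) \<noteq> \<infinity>"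
proof (induction n)
  case (Suc n)
  have "(\<lambda>z. f z ^ n) \<in> S"
    by (induction n) (auto intro: const_in mult_in Suc.prems)
  then show ?case using Suc by (simp add: val_mult) force
qed (simp add: val_const)

end

text \<open>The Gauss extension of \<open>v\<close> to power series in an indeterminate of weight \<open>w / a\<close>, pulled back
  along the flow \<open>f \<mapsto> exp (t D) f\<close>. The factors \<open>1 / i!\<close> do not matter, as they have value \<open>0\<close>.\<close>

definition gauss :: "nat \<Rightarrow> nat \<Rightarrow> (('z \<Rightarrow> complex) \<Rightarrow> 'z \<Rightarrow> complex) \<Rightarrow> (('z \<Rightarrow> complex) \<Rightarrow> enat)
    \<Rightarrow> ('z \<Rightarrow> complex) \<Rightarrow> enat" where
  "gauss a w D v f = (INF i. of_nat a * v ((D ^^ i) f) + of_nat (w * i))"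

lemma gauss_le: "gauss a w D v f \<le> of_nat a * v ((D ^^ i) f) + of_nat (w * i)"
  unfolding gauss_def by (rule INF_lower) simp

lemma gauss_attained: "\<exists>i. gauss a w D v f = of_nat a * v ((D ^^ i) f) + of_nat (w * i)"
proof -
  let ?h = "\<lambda>i. of_nat a * v ((D ^^ i) f) + of_nat (w * i) :: enat"
  \<comment> \<open>\<open>enat\<close> is well-ordered, so the infimum is a minimum; the
    leading-term argument for products relies on it.\<close>
  have "Inf (range ?h) \<in> range ?h"
    by (rule wellorder_InfI[of "?h 0"]) blast
  then show ?thesis unfolding gauss_def by auto
qed

lemma le_gaussI: "(\<And>i. k \<le> of_nat a * v ((D ^^ i) f) + of_nat (w * i)) \<Longrightarrow> k \<le> gauss a w D v f"
  unfolding gauss_def by (rule INF_greatest)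

text \<open>Gauss' lemma. Sums and constants are checked coefficientwise. The coefficients of a
  product are convolutions by the Leibniz rule, with binomial factors of value 0: the smallest term
  of each convolution gives one inequality, the coefficient where the leading terms of f and g meet
  gives the other.\<close>

lemma gauss_valuation:
  assumes D: "derivation D" and v: "valuation v" and a: "a > 0"
  shows "valuation (gauss a w D v)"
proof -
  let ?m = "gauss a w D v"
  let ?t = "\<lambda>i f. of_nat a * v ((D ^^ i) f) + of_nat (w * i) :: enat"
  have ainf: "of_nat a * (\<infinity>::enat) = \<infinity>" using a by (simp add: of_nat_eq_enat)
  have mono: "x \<le> y \<Longrightarrow> of_nat a * x + k \<le> of_nat a * y + k" for x y k :: enat
    by (intro add_mono mult_left_mono) auto
  have cong: "?m f = ?m g" if "f \<in> S" "g \<in> S" "f \<simeq> g" for f g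
  proof -
    have "v ((D ^^ i) f) = v ((D ^^ i) g)" for i
      using that by (intro val_cong[OF v] pow_in[OF D] pow_cong[OF D])
    then show ?thesis unfolding gauss_def by simp
  qed
  have add: "min (?m f) (?m g) \<le> ?m (\<lambda>z. f z + g z)" if f: "f \<in> S" and g: "g \<in> S" for f g
  proof (rule le_gaussI)
    fix i
    have "v ((D ^^ i) (\<lambda>z. f z + g z)) = v (\<lambda>z. (D ^^ i) f z + (D ^^ i) g z)"
      using f g by (intro val_cong[OF v] pow_in[OF D] add_in pow_add[OF D])
    then have "min (v ((D ^^ i) f)) (v ((D ^^ i) g)) \<le> v ((D ^^ i) (\<lambda>z. f z + g z))"
      using val_add[OF v pow_in[OF D f] pow_in[OF D g]] by simp
    then have "v ((D ^^ i) f) \<le> v ((D ^^ i) (\<lambda>z. f z + g z)) \<or> v ((D ^^ i) g) \<le> v ((D ^^ i) (\<lambda>z. f z + g z))"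
      by (auto simp: min_le_iff_disj)
    then show "min (?m f) (?m g) \<le> ?t i (\<lambda>z. f z + g z)"
    proof
      assume "v ((D ^^ i) f) \<le> v ((D ^^ i) (\<lambda>z. f z + g z))"
      from order_trans[OF gauss_le[of a w D v f i] mono[OF this]] show ?thesis by (rule min.coboundedI1)
    next
      assume "v ((D ^^ i) g) \<le> v ((D ^^ i) (\<lambda>z. f z + g z))"
      from order_trans[OF gauss_le[of a w D v g i] mono[OF this]] show ?thesis by (rule min.coboundedI2)
    qed
  qed
  have const: "?m (\<lambda>_. c) = (if c = 0 then \<infinity> else 0)" for c
  proof (cases "c = 0")
    case True
    have "v ((D ^^ i) (\<lambda>_. 0)) = \<infinity>" for i
      using val_cong[OF v pow_in[OF D const_in] const_in pow_zero[OF D]] val_const[OF v, of 0] by simp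
    then show ?thesis using True unfolding gauss_def by (simp add: ainf)
  next
    case False
    have "?m (\<lambda>_. c) \<le> of_nat a * v ((D ^^ 0) (\<lambda>_. c)) + of_nat (w * 0)" by (rule gauss_le)
    then show ?thesis using False by (simp add: val_const[OF v])
  qed
  have mult: "?m (\<lambda>z. f z * g z) = ?m f + ?m g" if f: "f \<in> S" and g: "g \<in> S" for f g
  proof -
    let ?f = "\<lambda>i. (D ^^ i) f" and ?g = "\<lambda>i. (D ^^ i) g"
    have fin: "?f i \<in> S" and gin: "?g i \<in> S" for i using pow_in[OF D] f g by auto
    define T where "T n i = (\<lambda>z. of_nat (n choose i) * (?f i z * ?g (n - i) z))" for n i
    have Tin: "T n i \<in> S" for n i unfolding T_def by (intro cmult_in mult_in fin gin)
    have vT: "of_nat a * v (T n i) + of_nat (w * n) = ?t i f + ?t (n - i) g" if "i \<le> n" for n i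
    proof -
      have "w * n = w * i + w * (n - i)" using that by (metis add_mult_distrib2 le_add_diff_inverse)
      moreover have "v (T n i) = v (?f i) + v (?g (n - i))"
        unfolding T_def using that val_mult[OF v fin gin]
          val_cmult[OF v mult_in[OF fin gin], of "of_nat (n choose i)"] by simp
      ultimately show ?thesis by (simp add: distrib_left add_ac)
    qed
    have vD: "v ((D ^^ n) (\<lambda>z. f z * g z)) = v (\<lambda>z. \<Sum>i\<le>n. T n i z)" for n
    proof (rule val_cong[OF v pow_in[OF D mult_in[OF f g]]])
      show "(\<lambda>z. \<Sum>i\<le>n. T n i z) \<in> S" by (rule sum_in) (auto intro: Tin)
      show "(D ^^ n) (\<lambda>z. f z * g z) \<simeq> (\<lambda>z. \<Sum>i\<le>n. T n i z)"
        using leibniz[OF D f g, of n] unfolding T_def .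
    qed
    have ge: "?m f + ?m g \<le> ?m (\<lambda>z. f z * g z)"
    proof (rule le_gaussI)
      fix n
      define k where "k = arg_min_on (\<lambda>i. v (T n i)) {..n}"
      have k: "k \<le> n" "\<forall>i\<le>n. v (T n k) \<le> v (T n i)"
        using arg_min_if_finite(1)[of "{..n}" "\<lambda>i. v (T n i)"]
          arg_min_least[of "{..n}" _ "\<lambda>i. v (T n i)"] unfolding k_def by auto
      then have "v (T n k) \<le> v (\<lambda>z. \<Sum>i\<le>n. T n i z)"
        by (intro val_sum[OF v] Tin) auto
      then have A: "of_nat a * v (T n k) + of_nat (w * n) \<le> ?t n (\<lambda>z. f z * g z)"
        unfolding vD by (rule mono)
      have B: "?m f + ?m g \<le> ?t k f + ?t (n - k) g"
        by (rule add_mono[OF gauss_le[of a w D v f k] gauss_le[of a w D v g "n - k"]])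
      show "?m f + ?m g \<le> ?t n (\<lambda>z. f z * g z)"
        by (rule order_trans[OF B A[unfolded vT[OF k(1)]]])
    qed
    have le: "?m (\<lambda>z. f z * g z) \<le> ?m f + ?m g" if fin': "?m f \<noteq> \<infinity>" "?m g \<noteq> \<infinity>"
    proof (rule ccontr)
      assume nle: "\<not> ?m (\<lambda>z. f z * g z) \<le> ?m f + ?m g"
      \<comment> \<open>The first indices at which the two minima are attained. Every other term of
        coefficient I + J has its index for f before \<open>I\<close> or its index for g before
        \<open>J\<close>, so its weighted value is strictly larger.\<close>
      define I where "I = (LEAST i. ?m f = ?t i f)"
      define J where "J = (LEAST i. ?m g = ?t i g)"
      have I: "?m f = ?t I f" unfolding I_def by (rule LeastI_ex[OF gauss_attained])
      have J: "?m g = ?t J g" unfolding J_def by (rule LeastI_ex[OF gauss_attained])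
      have I': "?m f < ?t i f" if "i < I" for i
        using not_less_Least[of i "\<lambda>i. ?m f = ?t i f"] that gauss_le[of a w D v f i]
        unfolding I_def by (auto simp: less_le)
      have J': "?m g < ?t i g" if "i < J" for i
        using not_less_Least[of i "\<lambda>i. ?m g = ?t i g"] that gauss_le[of a w D v g i]
        unfolding J_def by (auto simp: less_le)
      let ?n = "I + J"
      define R where "R = (\<lambda>z. \<Sum>i\<in>{..?n} - {I}. T ?n i z)"
      have Rin: "R \<in> S" unfolding R_def by (intro sum_in Tin) auto
      have tot: "(\<lambda>z. \<Sum>i\<le>?n. T ?n i z) \<in> S" by (intro sum_in Tin) auto
      have small: "of_nat a * v (T ?n I) + of_nat (w * ?n) = ?m f + ?m g"
        using vT[of I ?n] I J by simp
      have "v (T ?n I) < v (T ?n i)" if i: "i \<in> {..?n} - {I}" for i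
      proof -
        have "?m f + ?m g < ?t i f + ?t (?n - i) g"
        proof (cases "i < I")
          case True
          show ?thesis
            using I'[OF True] gauss_le[of a w D v g "?n - i"] fin'
            by (cases "?m f"; cases "?m g"; cases "?t i f"; cases "?t (?n - i) g") auto
        next
          case False
          then have "?n - i < J" using i by auto
          from J'[OF this] show ?thesis
            using gauss_le[of a w D v f i] fin'
            by (cases "?m f"; cases "?m g"; cases "?t i f"; cases "?t (?n - i) g") auto
        qed
        then have "of_nat a * v (T ?n I) + of_nat (w * ?n) < of_nat a * v (T ?n i) + of_nat (w * ?n)"
          using vT[of i ?n] small i by simp
        then show ?thesis
          using mono[of "v (T ?n i)" "v (T ?n I)" "of_nat (w * ?n)"] by (metis leD leI)
      qed
      then have vR: "v (T ?n I) < v R"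
      proof -
        have fne: "v (T ?n I) \<noteq> \<infinity>"
          using small fin' ainf by (metis enat.simps(3) plus_enat_simps(2) plus_eq_infty_iff_enat)
        then obtain q where q: "v (T ?n I) = enat q" by auto
        have "enat (Suc q) \<le> v R"
          unfolding R_def
          using \<open>\<And>i. i \<in> {..?n} - {I} \<Longrightarrow> v (T ?n I) < v (T ?n i)\<close> q
          by (intro val_sum[OF v] Tin) (auto simp: eSuc_enat[symmetric] ileI1)
        then show ?thesis using q by (metis enat_ord_simps(2) lessI less_le_trans)
      qed
      have "v (\<lambda>z. \<Sum>i\<le>?n. T ?n i z) > v (T ?n I)"
      proof -
        have "of_nat a * v (T ?n I) + of_nat (w * ?n) < ?t ?n (\<lambda>z. f z * g z)"
          using nle small gauss_le[of a w D v "\<lambda>z. f z * g z" ?n] by auto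
        then show ?thesis
          unfolding vD using mono[of "v (\<lambda>z. \<Sum>i\<le>?n. T ?n i z)" "v (T ?n I)" "of_nat (w * ?n)"]
          by (metis leD leI)
      qed
      \<comment> \<open>The term at (I, J) is the whole coefficient minus the rest \<open>R\<close>;
        both have larger value, so the term would exceed its own value.\<close>
      moreover have "T ?n I = (\<lambda>z. (\<Sum>i\<le>?n. T ?n i z) + (-1) * R z)"
      proof
        fix z
        have "(\<Sum>i\<le>?n. T ?n i z) = T ?n I z + R z"
          unfolding R_def by (subst sum.remove[of _ I]) auto
        then show "T ?n I z = (\<Sum>i\<le>?n. T ?n i z) + (-1) * R z" by simp
      qed
      moreover have "v (\<lambda>z. (-1) * R z) = v R" by (rule val_cmult[OF v Rin]) simp
      moreover have "min (v (\<lambda>z. \<Sum>i\<le>?n. T ?n i z)) (v (\<lambda>z. (-1) * R z))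
          \<le> v (\<lambda>z. (\<Sum>i\<le>?n. T ?n i z) + (-1) * R z)"
        by (rule val_add[OF v tot cmult_in[OF Rin]])
      ultimately show False using vR by (metis leD min_less_iff_conj)
    qed
    \<comment> \<open>If one of the two values is \<infinity>, the bound \<open>ge\<close> already
      decides.\<close>
    show ?thesis
      using ge le by (metis antisym enat_ord_simps(3) plus_eq_infty_iff_enat)
  qed
  show ?thesis unfolding valuation_def using cong add const mult by blast
qed

text \<open>With weight 0 the Gauss extension never exceeds \<open>v\<close>, by index 0, and it
  agrees with \<open>v\<close> at c because the higher terms of c vanish. Passing to it can only
  lower the values of \<delta> and b, yet their finite sum stays the same; so neither drops.\<close>

lemma val_pow_divisor_ge:
  assumes D: "derivation D" and v: "valuation v"
    and in_S: "\<delta> \<in> S" "b \<in> S" "c \<in> S"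
    and c: "c \<simeq> (\<lambda>z. \<delta> z * b z)" and Dc: "D c \<simeq> (\<lambda>_. 0)" and fin: "v c \<noteq> \<infinity>"
  shows "v \<delta> \<le> v ((D ^^ i) \<delta>)"
proof -
  let ?m = "gauss 1 0 D v"
  have m: "valuation ?m" by (rule gauss_valuation[OF D v]) simp
  have le: "?m f \<le> v f" for f using gauss_le[of 1 0 D v f 0] by simp
  have "v ((D ^^ j) c) \<ge> v c" for j
  proof (cases j)
    case (Suc k)
    have "(D ^^ j) c = (D ^^ k) (D c)" unfolding Suc by (simp only: funpow_Suc_right o_apply)
    moreover have "v ((D ^^ k) (D c)) = v ((D ^^ k) (\<lambda>_. 0))"
      by (intro val_cong[OF v] pow_in[OF D] der_in[OF D] in_S const_in pow_cong[OF D] Dc)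
    moreover have "v ((D ^^ k) (\<lambda>_. 0)) = v (\<lambda>_. 0)"
      by (intro val_cong[OF v] pow_in[OF D] const_in pow_zero[OF D])
    ultimately show ?thesis by (simp add: val_const[OF v])
  qed simp
  then have "v c \<le> ?m c" by (intro le_gaussI) simp
  also have "?m c = ?m \<delta> + ?m b"
    using val_cong[OF m in_S(3) mult_in c] val_mult[OF m] in_S by simp
  finally have "v \<delta> + v b \<le> ?m \<delta> + ?m b"
    using val_cong[OF v in_S(3) mult_in c] val_mult[OF v] in_S by simp
  moreover have "v \<delta> + v b \<noteq> \<infinity>"
    using fin val_cong[OF v in_S(3) mult_in c] val_mult[OF v] in_S by simp
  ultimately have "v \<delta> \<le> ?m \<delta>"
    using le[of \<delta>] le[of b]
    by (cases "v \<delta>"; cases "v b"; cases "?m \<delta>"; cases "?m b") auto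
  also have "\<dots> \<le> v ((D ^^ i) \<delta>)" using gauss_le[of 1 0 D v \<delta> i] by simp
  finally show ?thesis .
qed

end

section \<open>Valuations centred at a point, and domination\<close>

locale pointed_germ_algebra = germ_algebra +
  fixes p assumes at_p: "\<And>P. eventually P F \<Longrightarrow> P p"
begin

text \<open>The trivial valuation whose prime ideal consists of the germs vanishing at p: the seed
  of the iterated Gauss extensions.\<close>

definition pointval :: "('a \<Rightarrow> complex) \<Rightarrow> enat" where
  "pointval f = (if f p = 0 then \<infinity> else 0)"

lemma pointval: "valuation pointval"
proof -
  have "f p = g p" if "f \<simeq> g" for f g
    using at_p[of "\<lambda>z. f z = g z"] that by (simp add: eqg_def)
  then show ?thesis
    unfolding valuation_def pointval_def by (auto simp: min_def split: if_splits) metis+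
qed

text \<open>For a list D_1, ..., D_k this is the least i_1 + 2 i_2 + ... + 2^(k-1) i_k for which
  D_k^(i_k) ... D_1^(i_1) f does not vanish at p, a weighted order of vanishing along the composed
  flows.\<close>

definition wordval :: "(('a \<Rightarrow> complex) \<Rightarrow> 'a \<Rightarrow> complex) list \<Rightarrow> ('a \<Rightarrow> complex) \<Rightarrow> enat" where
  "wordval Ds = foldr (gauss 2 1) Ds pointval"

lemma wordval_valuation: "(\<And>D. D \<in> set Ds \<Longrightarrow> derivation D) \<Longrightarrow> valuation (wordval Ds)"
  unfolding wordval_def by (induction Ds) (auto intro: pointval gauss_valuation)

lemma wordval_append_finite:
  "wordval Ds f \<noteq> \<infinity> \<Longrightarrow> wordval (Es @ Ds) f \<noteq> \<infinity>"
proof (induction Es)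
  case (Cons E Es)
  have "wordval ((E # Es) @ Ds) f \<le> 2 * wordval (Es @ Ds) f"
    using gauss_le[of 2 1 E "wordval (Es @ Ds)" f 0] by (simp add: wordval_def)
  then show ?case
    using Cons by (cases "wordval (Es @ Ds) f") (auto simp: numeral_eq_enat dest: enat_ile)
qed simp

text \<open>Index 1 at every letter of \<open>Ds\<close> and index 0 at every letter of
  \<open>Es\<close> bounds the value. The tail \<open>Es\<close> allows one list to be finite at
  both J and conj J.\<close>

lemma wordval_finiteI:
  "fold (\<lambda>D. D) Ds f p \<noteq> 0 \<Longrightarrow> wordval (Ds @ Es) f \<noteq> \<infinity>"
proof (induction Ds arbitrary: f)
  case Nil
  then have "wordval [] f \<noteq> \<infinity>" by (simp add: wordval_def pointval_def)
  then show ?case using wordval_append_finite[of "[]" f Es] by simp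
next
  case (Cons D Ds)
  have "wordval ((D # Ds) @ Es) f \<le> 2 * wordval (Ds @ Es) (D f) + 1"
    using gauss_le[of 2 1 D "wordval (Ds @ Es)" f 1] by (simp add: wordval_def one_enat_def)
  moreover have "wordval (Ds @ Es) (D f) \<noteq> \<infinity>" using Cons by simp
  ultimately show ?case
    by (cases "wordval (Ds @ Es) (D f)") (auto simp: numeral_eq_enat one_enat_def dest: enat_ile)
qed

text \<open>A positive index costs at least 1, so value 0 comes from index 0 at every letter. Thus
  these valuations are centred at p.\<close>

lemma wordval_eq_0_iff: "wordval Ds f = 0 \<longleftrightarrow> f p \<noteq> 0"
proof (induction Ds arbitrary: f)
  case Nil
  then show ?case by (simp add: wordval_def pointval_def)
next
  case (Cons D Ds)
  obtain i where i: "wordval (D # Ds) f = of_nat 2 * wordval Ds ((D ^^ i) f) + of_nat (1 * i)"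
    using gauss_attained[of 2 1 D "wordval Ds" f] by (auto simp: wordval_def)
  have "wordval (D # Ds) f \<le> 2 * wordval Ds f"
    using gauss_le[of 2 1 D "wordval Ds" f 0] by (simp add: wordval_def)
  moreover have "wordval Ds f = 0" if "wordval (D # Ds) f = 0"
  proof -
    have "of_nat 2 * wordval Ds ((D ^^ i) f) = 0" "(of_nat (1 * i) :: enat) = 0"
      using i that by (metis add_eq_0_iff_both_eq_0 zero_le)+
    then show ?thesis by simp
  qed
  ultimately have "wordval (D # Ds) f = 0 \<longleftrightarrow> wordval Ds f = 0" by auto
  then show ?case using Cons.IH by simp
qed

text \<open>A finite value is attained along some word, and that word applied to f is nonzero at p.
  The invariant \<open>P\<close> is carried along; later it is domination.\<close>

lemma wordval_finiteE:
  assumes "wordval Ds f \<noteq> \<infinity>" and "P f" and "\<And>D g. D \<in> set Ds \<Longrightarrow> P g \<Longrightarrow> P (D g)"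
  shows "\<exists>h. P h \<and> h p \<noteq> 0"
  using assms
proof (induction Ds arbitrary: f)
  case Nil
  then show ?case by (auto simp: wordval_def pointval_def split: if_splits)
next
  case (Cons D Ds)
  obtain i where i: "wordval (D # Ds) f = of_nat 2 * wordval Ds ((D ^^ i) f) + of_nat (1 * i)"
    using gauss_attained[of 2 1 D "wordval Ds" f] by (auto simp: wordval_def)
  then have "wordval Ds ((D ^^ i) f) \<noteq> \<infinity>" using Cons.prems(1) by (cases "wordval Ds ((D ^^ i) f)") (auto simp: of_nat_eq_enat)
  moreover have "P ((D ^^ i) f)"
    using Cons.prems by (induction i) auto
  ultimately show ?case using Cons by auto
qed

text \<open>Modelled on the valuative description of the integral closure of the ideal (\<delta>).
  The quantifier over all admissible valuations is what absorbs a derivation: the bound for D h at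
  \<open>v\<close> is read off from the bound for h at a Gauss extension of
  \<open>v\<close>.\<close>

definition dominated :: "('a \<Rightarrow> complex) set \<Rightarrow> ('a \<Rightarrow> complex) \<Rightarrow> ('a \<Rightarrow> complex) \<Rightarrow> bool" where
  "dominated C \<delta> h \<longleftrightarrow> h \<in> S \<and> (\<forall>v. valuation v \<and> (\<forall>c\<in>C. v c \<noteq> \<infinity>) \<longrightarrow> v \<delta> \<le> v h)"

text \<open>If \<open>v\<close> is admissible, then so is \<open>v' = gauss 2 1 D v\<close>, and
  \<open>2 v (D h) + 1 \<ge> v' h \<ge> v' \<delta> \<ge> 2 v \<delta>\<close>; the last step holds as \<open>\<delta>\<close> divides a constant of \<open>D\<close>.\<close>

lemma dominated_derivation:
  assumes D: "derivation D" and h: "dominated C \<delta> h"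
    and C: "C \<subseteq> S" "c \<in> C" and in_S: "\<delta> \<in> S" "b \<in> S"
    and c: "c \<simeq> (\<lambda>z. \<delta> z * b z)" and Dc: "D c \<simeq> (\<lambda>_. 0)"
  shows "dominated C \<delta> (D h)"
  unfolding dominated_def
proof (intro conjI allI impI)
  show "D h \<in> S" using h by (auto simp: dominated_def intro: der_in[OF D])
  fix v assume v: "valuation v \<and> (\<forall>c\<in>C. v c \<noteq> \<infinity>)"
  let ?v' = "gauss 2 1 D v"
  have "?v' c \<noteq> \<infinity>" if "c \<in> C" for c
    using v that gauss_le[of 2 1 D v c 0]
    by (cases "v c") (auto simp: numeral_eq_enat of_nat_eq_enat dest: enat_ile)
  then have "?v' \<delta> \<le> ?v' h"
    using h v gauss_valuation[OF D] by (auto simp: dominated_def)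
  also have "?v' h \<le> 2 * v (D h) + 1"
    using gauss_le[of 2 1 D v h 1] by (simp add: one_enat_def)
  finally have "?v' \<delta> \<le> 2 * v (D h) + 1" .
  moreover have "2 * v \<delta> \<le> ?v' \<delta>"
  proof (rule le_gaussI)
    fix i
    have "v \<delta> \<le> v ((D ^^ i) \<delta>)"
      using v C in_S c Dc by (intro val_pow_divisor_ge[OF D, of v]) auto
    then have "2 * v \<delta> \<le> 2 * v ((D ^^ i) \<delta>)" by (rule mult_left_mono) simp
    then show "2 * v \<delta> \<le> of_nat 2 * v ((D ^^ i) \<delta>) + of_nat (1 * i)"
      by (simp add: add_increasing2)
  qed
  ultimately have "2 * v \<delta> \<le> 2 * v (D h) + 1" by (rule order_trans[rotated])
  then show "v \<delta> \<le> v (D h)"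
    by (cases "v \<delta>"; cases "v (D h)") (auto simp: numeral_eq_enat one_enat_def)
qed

lemma dominated_add: "dominated C \<delta> g \<Longrightarrow> dominated C \<delta> h \<Longrightarrow> dominated C \<delta> (\<lambda>z. g z + h z)"
  unfolding dominated_def
proof (intro conjI allI impI; elim conjE)
  fix v assume g: "g \<in> S" and h: "h \<in> S" and v: "valuation v" "\<forall>c\<in>C. v c \<noteq> \<infinity>"
    and *: "\<forall>v. valuation v \<and> (\<forall>c\<in>C. v c \<noteq> \<infinity>) \<longrightarrow> v \<delta> \<le> v g"
      "\<forall>v. valuation v \<and> (\<forall>c\<in>C. v c \<noteq> \<infinity>) \<longrightarrow> v \<delta> \<le> v h"
  have "v \<delta> \<le> min (v g) (v h)" using * v by simp
  also have "\<dots> \<le> v (\<lambda>z. g z + h z)" by (rule val_add[OF v(1) g h])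
  finally show "v \<delta> \<le> v (\<lambda>z. g z + h z)" .
qed (rule add_in)

lemma dominated_cmult: "dominated C \<delta> h \<Longrightarrow> dominated C \<delta> (\<lambda>z. c * h z)"
  unfolding dominated_def
proof (intro conjI allI impI; elim conjE)
  fix v assume h: "h \<in> S" and v: "valuation v" "\<forall>c\<in>C. v c \<noteq> \<infinity>"
    and *: "\<forall>v. valuation v \<and> (\<forall>c\<in>C. v c \<noteq> \<infinity>) \<longrightarrow> v \<delta> \<le> v h"
  have "v \<delta> \<le> v h" using * v by simp
  also have "\<dots> \<le> v (\<lambda>z. c * h z)" by (rule val_cmult_le[OF v(1) h])
  finally show "v \<delta> \<le> v (\<lambda>z. c * h z)" .
qed (rule cmult_in)

lemma dominated_cong: "dominated C \<delta> h \<Longrightarrow> h \<simeq> g \<Longrightarrow> g \<in> S \<Longrightarrow> dominated C \<delta> g"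
  unfolding dominated_def
proof (intro conjI allI impI; elim conjE)
  fix v assume g: "h \<simeq> g" "g \<in> S" and h: "h \<in> S" and v: "valuation v" "\<forall>c\<in>C. v c \<noteq> \<infinity>"
    and *: "\<forall>v. valuation v \<and> (\<forall>c\<in>C. v c \<noteq> \<infinity>) \<longrightarrow> v \<delta> \<le> v h"
  have "v \<delta> \<le> v h" using * v by simp
  then show "v \<delta> \<le> v g" using val_cong[OF v(1) h g(2,1)] by simp
qed

text \<open>The list yields one valuation that is finite on \<open>C\<close>, hence at \<delta>, and
  centred at p. Finiteness produces a word in \<delta> that is nonzero at p, and domination squeezes
  the value of \<delta> down to the value 0 of that word.\<close>

theorem divisor_nonzero:
  assumes Ds: "\<And>D. D \<in> set Ds \<Longrightarrow> derivation D"
    and dom: "\<And>D h. D \<in> set Ds \<Longrightarrow> dominated C \<delta> h \<Longrightarrow> dominated C \<delta> (D h)"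
    and fin: "\<And>c. c \<in> C \<Longrightarrow> wordval Ds c \<noteq> \<infinity>"
    and in_S: "\<delta> \<in> S" "b \<in> S" and C: "c \<in> C" "C \<subseteq> S" and c: "c \<simeq> (\<lambda>z. \<delta> z * b z)"
  shows "\<delta> p \<noteq> 0"
proof -
  let ?v = "wordval Ds"
  have v: "valuation ?v" by (rule wordval_valuation[OF Ds])
  have "?v c = ?v \<delta> + ?v b"
    using val_cong[OF v _ mult_in c] val_mult[OF v] in_S C by auto
  then have "?v \<delta> \<noteq> \<infinity>" using fin[OF C(1)] by (metis plus_enat_simps(2))
  then obtain h where h: "dominated C \<delta> h" "h p \<noteq> 0"
    using wordval_finiteE[of Ds \<delta> "dominated C \<delta>"] dom in_S by (auto simp: dominated_def)
  then have "?v \<delta> \<le> ?v h" using v fin by (auto simp: dominated_def)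
  also have "?v h = 0" using h(2) by (simp only: wordval_eq_0_iff not_False_eq_True)
  finally have "?v \<delta> = 0" by simp
  then show ?thesis by (simp only: wordval_eq_0_iff not_False_eq_True)
qed

end

section \<open>Smooth functions\<close>

lemma frechet_derivative_eq: "(f has_derivative f') (at z) \<Longrightarrow> frechet_derivative f (at z) = f'"
  using frechet_derivative_at by metis

lemma Ck_on_subset: "Ck_on k f U \<Longrightarrow> V \<subseteq> U \<Longrightarrow> Ck_on k f V"
  by (induction k arbitrary: f) (auto intro: continuous_on_subset)

lemma Ck_on_imp_continuous_on: "Ck_on k f U \<Longrightarrow> continuous_on U f"
  by (cases k) (auto intro!: continuous_at_imp_continuous_on differentiable_imp_continuous_within)

lemma Ck_on_SucD: "Ck_on (Suc k) f U \<Longrightarrow> Ck_on k f U"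
proof (induction k arbitrary: f)
  case 0
  then show ?case using Ck_on_imp_continuous_on[OF 0] by simp
qed auto

lemma Ck_on_cong:
  assumes "open U" and "\<And>z. z \<in> U \<Longrightarrow> f z = g z" and "Ck_on k f U"
  shows "Ck_on k g U"
  using assms(2,3)
proof (induction k arbitrary: f g)
  case 0
  then show ?case using continuous_on_cong[OF refl, of U f g] by simp
next
  case (Suc k)
  have *: "(g has_derivative frechet_derivative f (at z)) (at z)" if "z \<in> U" for z
  proof -
    have "(f has_derivative frechet_derivative f (at z)) (at z)"
      using that Suc.prems(2) frechet_derivative_works by auto
    from has_derivative_transform_within_open[OF this \<open>open U\<close> that] Suc.prems(1)
    show ?thesis by blast
  qed
  have eq: "frechet_derivative g (at z) = frechet_derivative f (at z)" if "z \<in> U" for z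
    by (rule frechet_derivative_eq[OF *[OF that]])
  have "Ck_on k (\<lambda>z. frechet_derivative g (at z) v) U" for v
  proof (rule Suc.IH)
    show "frechet_derivative f (at z) v = frechet_derivative g (at z) v" if "z \<in> U" for z
      by (simp only: eq[OF that])
    show "Ck_on k (\<lambda>z. frechet_derivative f (at z) v) U"
      using Suc.prems(2) unfolding Ck_on.simps by blast
  qed
  then show ?case using * by (auto simp: differentiable_def)
qed

lemma Ck_on_SucI:
  assumes "open U" and "\<And>z. z \<in> U \<Longrightarrow> (f has_derivative f' z) (at z)"
    and "\<And>v. Ck_on k (\<lambda>z. f' z v) U"
  shows "Ck_on (Suc k) f U"
proof -
  have "Ck_on k (\<lambda>z. frechet_derivative f (at z) v) U" for v
    by (rule Ck_on_cong[OF \<open>open U\<close> _ assms(3)[of v]]) (simp add: frechet_derivative_eq[OF assms(2)])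
  then show ?thesis using assms(2) by (auto simp: differentiable_def)
qed

lemma Ck_on_Suc_has_derivative:
  "Ck_on (Suc k) f U \<Longrightarrow> z \<in> U \<Longrightarrow> (f has_derivative frechet_derivative f (at z)) (at z)"
  by (simp add: frechet_derivative_works[symmetric])

lemma Ck_on_const: "open U \<Longrightarrow> Ck_on k (\<lambda>_. c) U"
proof (induction k arbitrary: c)
  case (Suc k)
  then show ?case by (intro Ck_on_SucI[where f' = "\<lambda>_ _. 0"]) auto
qed auto

lemma Ck_on_linear:
  assumes "bounded_linear h" "open U" "Ck_on k f U"
  shows "Ck_on k (\<lambda>z. h (f z)) U"
  using assms(3)
proof (induction k arbitrary: f)
  case 0
  then show ?case
    using bounded_linear.continuous_on[OF assms(1)] by simp
next
  case (Suc k)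
  show ?case
  proof (rule Ck_on_SucI[OF \<open>open U\<close>])
    show "((\<lambda>z. h (f z)) has_derivative (\<lambda>v. h (frechet_derivative f (at z) v))) (at z)"
      if "z \<in> U" for z
      using bounded_linear.has_derivative[OF assms(1) Ck_on_Suc_has_derivative[OF Suc.prems that]] .
  qed (use Suc in auto)
qed

lemma Ck_on_add:
  assumes "open U" "Ck_on k f U" "Ck_on k g U"
  shows "Ck_on k (\<lambda>z. f z + g z) U"
  using assms(2,3)
proof (induction k arbitrary: f g)
  case 0
  then show ?case by (auto intro: continuous_intros)
next
  case (Suc k)
  show ?case
    by (rule Ck_on_SucI[OF \<open>open U\<close>, where f' = "\<lambda>z v. frechet_derivative f (at z) v + frechet_derivative g (at z) v"])
      (use Suc in \<open>auto intro!: has_derivative_add Ck_on_Suc_has_derivative\<close>)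
qed

lemma Ck_on_bilinear:
  assumes "bounded_bilinear h" "open U" "Ck_on k f U" "Ck_on k g U"
  shows "Ck_on k (\<lambda>z. h (f z) (g z)) U"
  using assms(3,4)
proof (induction k arbitrary: f g)
  case 0
  then show ?case using bounded_bilinear.continuous_on[OF assms(1)] by simp
next
  case (Suc k)
  show ?case
  proof (rule Ck_on_SucI[OF \<open>open U\<close>])
    show "((\<lambda>z. h (f z) (g z)) has_derivative
        (\<lambda>v. h (f z) (frechet_derivative g (at z) v) + h (frechet_derivative f (at z) v) (g z))) (at z)"
      if "z \<in> U" for z
      using that Suc.prems by (intro bounded_bilinear.FDERIV[OF assms(1)] Ck_on_Suc_has_derivative)
    show "Ck_on k (\<lambda>z. h (f z) (frechet_derivative g (at z) v) + h (frechet_derivative f (at z) v) (g z)) U" for v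
      using Suc.prems Ck_on_SucD[OF Suc.prems(1)] Ck_on_SucD[OF Suc.prems(2)]
      by (intro Ck_on_add[OF \<open>open U\<close>] Suc.IH) simp_all
  qed
qed

lemma Ck_on_sum:
  "finite A \<Longrightarrow> open U \<Longrightarrow> (\<And>i. i \<in> A \<Longrightarrow> Ck_on k (f i) U) \<Longrightarrow> Ck_on k (\<lambda>z. \<Sum>i\<in>A. f i z) U"
  by (induction A rule: finite_induct) (auto intro: Ck_on_const Ck_on_add)

lemma Ck_on_inverse:
  fixes f :: "'a::euclidean_space \<Rightarrow> complex"
  assumes "open U" "\<And>z. z \<in> U \<Longrightarrow> f z \<noteq> 0" "Ck_on k f U"
  shows "Ck_on k (\<lambda>z. inverse (f z)) U"
  using assms(3)
proof (induction k)
  case 0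
  then show ?case using assms(2) by (auto intro: continuous_on_inverse)
next
  case (Suc k)
  have *: "Ck_on k (\<lambda>z. inverse (f z)) U" using Suc by (blast intro: Ck_on_SucD)
  show ?case
  proof (rule Ck_on_SucI[OF \<open>open U\<close>])
    show "((\<lambda>z. inverse (f z)) has_derivative
        (\<lambda>v. - (inverse (f z) * frechet_derivative f (at z) v * inverse (f z)))) (at z)"
      if "z \<in> U" for z
      using that assms(2) Suc.prems by (intro Deriv.has_derivative_inverse Ck_on_Suc_has_derivative)
    show "Ck_on k (\<lambda>z. - (inverse (f z) * frechet_derivative f (at z) v * inverse (f z))) U" for v
      using Suc.prems * 
      by (intro Ck_on_linear[OF bounded_linear_minus[OF bounded_linear_ident] \<open>open U\<close>]
          Ck_on_bilinear[OF bounded_bilinear_mult \<open>open U\<close>]) auto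
  qed
qed

lemma Ck_on_compose:
  fixes f :: "'b::euclidean_space \<Rightarrow> 'c::real_normed_vector" and g :: "'a::euclidean_space \<Rightarrow> 'b"
  assumes "open U" "open V" "g ` U \<subseteq> V" "Ck_on k f V" "Ck_on k g U"
  shows "Ck_on k (\<lambda>z. f (g z)) U"
  using assms(4,5)
proof (induction k arbitrary: f)
  case 0
  then show ?case using assms(3) by (auto intro: continuous_on_compose2)
next
  case (Suc k)
  let ?f = "\<lambda>w. frechet_derivative f (at w)" and ?g = "\<lambda>z. frechet_derivative g (at z)"
  show ?case
  proof (rule Ck_on_SucI[OF \<open>open U\<close>])
    \<comment> \<open>The chain rule is expanded in a basis because \<open>Ck_on\<close> speaks of
      fixed directions only: \<open>?f (g z) b\<close> is again a composite, to which the induction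
      hypothesis applies.\<close>
    show "((\<lambda>z. f (g z)) has_derivative (\<lambda>v. \<Sum>b\<in>Basis. (?g z v \<bullet> b) *\<^sub>R ?f (g z) b)) (at z)"
      if z: "z \<in> U" for z
    proof -
      have f: "(f has_derivative ?f (g z)) (at (g z))"
        using z Suc.prems assms(3) by (intro Ck_on_Suc_has_derivative) auto
      have "((\<lambda>z. f (g z)) has_derivative (\<lambda>v. ?f (g z) (?g z v))) (at z)"
        by (rule has_derivative_compose[of g "?g z" z UNIV f "?f (g z)", OF Ck_on_Suc_has_derivative[OF Suc.prems(2) z] f])
      moreover have rep: "?f (g z) x = (\<Sum>b\<in>Basis. (x \<bullet> b) *\<^sub>R ?f (g z) b)" for x
      proof -
        have "linear (?f (g z))" using f has_derivative_linear by blast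
        then have "?f (g z) (\<Sum>b\<in>Basis. (x \<bullet> b) *\<^sub>R b) = (\<Sum>b\<in>Basis. (x \<bullet> b) *\<^sub>R ?f (g z) b)"
          by (simp add: linear_sum linear_cmul)
        then show ?thesis by (simp only: euclidean_representation)
      qed
      moreover have "(\<lambda>v. ?f (g z) (?g z v)) = (\<lambda>v. \<Sum>b\<in>Basis. (?g z v \<bullet> b) *\<^sub>R ?f (g z) b)"
        by (rule ext) (rule rep)
      ultimately show ?thesis by metis
    qed
    show "Ck_on k (\<lambda>z. \<Sum>b\<in>Basis. (?g z v \<bullet> b) *\<^sub>R ?f (g z) b) U" for v
    proof (intro Ck_on_sum Ck_on_bilinear[OF bounded_bilinear_scaleR] \<open>open U\<close>)
      fix b :: 'b
      show "Ck_on k (\<lambda>z. ?g z v \<bullet> b) U"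
        using Suc.prems by (intro Ck_on_linear[OF bounded_linear_inner_left \<open>open U\<close>]) auto
      show "Ck_on k (\<lambda>z. ?f (g z) b) U"
        using Suc.prems by (intro Suc.IH Ck_on_SucD[of k g]) auto
    qed simp
  qed
qed

section \<open>Germs of smooth functions at a point\<close>

definition smooth_at :: "'a::euclidean_space \<Rightarrow> ('a \<Rightarrow> 'b::real_normed_vector) \<Rightarrow> bool" where
  "smooth_at p f \<longleftrightarrow> (\<exists>U. open U \<and> p \<in> U \<and> smooth_on f U)"

lemma smooth_atI: "open U \<Longrightarrow> p \<in> U \<Longrightarrow> smooth_on f U \<Longrightarrow> smooth_at p f"
  unfolding smooth_at_def by blast

lemma smooth_atE:
  assumes "smooth_at p f" obtains U where "open U" "p \<in> U" "smooth_on f U"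
  using assms unfolding smooth_at_def by blast

lemma smooth_on_subset: "smooth_on f U \<Longrightarrow> V \<subseteq> U \<Longrightarrow> smooth_on f V"
  unfolding smooth_on_def using Ck_on_subset by blast

lemma smooth_at_eventually: "smooth_at p f \<Longrightarrow> \<forall>\<^sub>F z in nhds p. smooth_at z f"
  unfolding smooth_at_def eventually_nhds by blast

lemma smooth_on_has_derivative:
  assumes "smooth_on f U" "z \<in> U"
  shows "(f has_derivative frechet_derivative f (at z)) (at z)"
  using assms Ck_on_Suc_has_derivative unfolding smooth_on_def by blast

lemma smooth_at_has_derivative:
  "smooth_at p f \<Longrightarrow> (f has_derivative frechet_derivative f (at p)) (at p)"
  unfolding smooth_at_def using smooth_on_has_derivative by blast

lemma smooth_at_differentiable: "smooth_at p f \<Longrightarrow> f differentiable (at p)"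
  using smooth_at_has_derivative frechet_derivative_works by blast

lemma smooth_at_isCont: "smooth_at p f \<Longrightarrow> isCont f p"
  using smooth_at_differentiable differentiable_imp_continuous_within by blast

lemma smooth_at_frechet: "smooth_at p f \<Longrightarrow> smooth_at p (\<lambda>z. frechet_derivative f (at z) v)"
  unfolding smooth_at_def smooth_on_def using Ck_on.simps(2) by blast

lemma smooth_at_cong:
  assumes "smooth_at p f" "\<forall>\<^sub>F z in nhds p. f z = g z"
  shows "smooth_at p g"
proof -
  obtain U where U: "open U" "p \<in> U" "smooth_on f U" using assms(1) by (rule smooth_atE)
  obtain V where V: "open V" "p \<in> V" "\<forall>z\<in>V. f z = g z" using assms(2) by (auto simp: eventually_nhds)
  have "smooth_on g (U \<inter> V)"
    unfolding smooth_on_def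
  proof
    fix k
    have "Ck_on k f (U \<inter> V)"
      using U(3) Ck_on_subset[of k f U "U \<inter> V"] by (simp add: smooth_on_def)
    then show "Ck_on k g (U \<inter> V)"
      using U V by (intro Ck_on_cong[of "U \<inter> V" f g]) auto
  qed
  then show ?thesis using U V by (intro smooth_atI[of "U \<inter> V"]) auto
qed

lemma smooth_at_const: "smooth_at p (\<lambda>_. c)"
  by (rule smooth_atI[of UNIV]) (auto simp: smooth_on_def intro: Ck_on_const)

lemma smooth_at_linear: "bounded_linear h \<Longrightarrow> smooth_at p f \<Longrightarrow> smooth_at p (\<lambda>z. h (f z))"
  unfolding smooth_at_def smooth_on_def by (blast intro: Ck_on_linear)

lemma smooth_at_Int:
  assumes "smooth_at p f" "smooth_at p g"
  obtains U where "open U" "p \<in> U" "smooth_on f U" "smooth_on g U"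
proof -
  obtain U V where "open U" "p \<in> U" "smooth_on f U" "open V" "p \<in> V" "smooth_on g V"
    using assms unfolding smooth_at_def by blast
  then show ?thesis by (intro that[of "U \<inter> V"]) (auto intro: smooth_on_subset)
qed

lemma smooth_at_add:
  assumes "smooth_at p f" "smooth_at p g" shows "smooth_at p (\<lambda>z. f z + g z)"
proof (rule smooth_at_Int[OF assms])
  fix U assume U: "open U" "p \<in> U" "smooth_on f U" "smooth_on g U"
  then have "smooth_on (\<lambda>z. f z + g z) U" unfolding smooth_on_def by (blast intro: Ck_on_add)
  then show ?thesis using U smooth_atI by blast
qed

lemma smooth_at_bilinear:
  assumes "bounded_bilinear h" "smooth_at p f" "smooth_at p g"
  shows "smooth_at p (\<lambda>z. h (f z) (g z))"
proof (rule smooth_at_Int[OF assms(2,3)])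
  fix U assume U: "open U" "p \<in> U" "smooth_on f U" "smooth_on g U"
  then have "smooth_on (\<lambda>z. h (f z) (g z)) U"
    unfolding smooth_on_def using Ck_on_bilinear[OF assms(1)] by blast
  then show ?thesis using U smooth_atI by blast
qed

lemma smooth_at_mult:
  fixes f g :: "'a::euclidean_space \<Rightarrow> 'b::real_normed_algebra"
  shows "smooth_at p f \<Longrightarrow> smooth_at p g \<Longrightarrow> smooth_at p (\<lambda>z. f z * g z)"
  by (rule smooth_at_bilinear[OF bounded_bilinear_mult])

lemma smooth_at_sum:
  "finite A \<Longrightarrow> (\<And>i. i \<in> A \<Longrightarrow> smooth_at p (f i)) \<Longrightarrow> smooth_at p (\<lambda>z. \<Sum>i\<in>A. f i z)"
  by (induction A rule: finite_induct) (auto intro: smooth_at_const smooth_at_add)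

lemma smooth_at_prod:
  fixes f :: "'i \<Rightarrow> 'a::euclidean_space \<Rightarrow> 'b::{real_normed_algebra_1,comm_ring_1}"
  shows "finite A \<Longrightarrow> (\<And>i. i \<in> A \<Longrightarrow> smooth_at p (f i)) \<Longrightarrow> smooth_at p (\<lambda>z. \<Prod>i\<in>A. f i z)"
  by (induction A rule: finite_induct) (auto intro: smooth_at_const smooth_at_mult)

lemma smooth_at_minus: "smooth_at p f \<Longrightarrow> smooth_at p (\<lambda>z. - f z)"
  by (rule smooth_at_linear[OF bounded_linear_minus[OF bounded_linear_ident]])

lemma smooth_at_diff: "smooth_at p f \<Longrightarrow> smooth_at p g \<Longrightarrow> smooth_at p (\<lambda>z. f z - g z)"
  using smooth_at_add[OF _ smooth_at_minus, of p f g] by simp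

lemma smooth_at_power:
  fixes f :: "'a::euclidean_space \<Rightarrow> 'b::real_normed_algebra_1"
  shows "smooth_at p f \<Longrightarrow> smooth_at p (\<lambda>z. f z ^ n)"
  by (induction n) (auto intro: smooth_at_const smooth_at_mult)

lemma smooth_at_nonzero_eventually:
  fixes f :: "'a::euclidean_space \<Rightarrow> 'b::real_normed_vector"
  assumes "smooth_at p f" "f p \<noteq> 0"
  shows "\<forall>\<^sub>F z in nhds p. f z \<noteq> 0"
proof -
  have "(f \<longlongrightarrow> f p) (nhds p)"
    using smooth_at_isCont[OF assms(1)] by (simp add: isCont_def tendsto_at_iff_tendsto_nhds)
  then show ?thesis using assms(2) by (rule tendsto_imp_eventually_ne)
qed

lemma smooth_at_inverse:
  fixes f :: "'a::euclidean_space \<Rightarrow> complex"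
  assumes "smooth_at p f" "f p \<noteq> 0" shows "smooth_at p (\<lambda>z. inverse (f z))"
proof -
  obtain U where U: "open U" "p \<in> U" "smooth_on f U" using assms(1) by (rule smooth_atE)
  obtain V where V: "open V" "p \<in> V" "\<forall>z\<in>V. f z \<noteq> 0"
    using smooth_at_nonzero_eventually[OF assms] by (auto simp: eventually_nhds)
  have "smooth_on f (U \<inter> V)" using U(3) by (rule smooth_on_subset) auto
  then have "smooth_on (\<lambda>z. inverse (f z)) (U \<inter> V)"
    using U V by (auto simp: smooth_on_def intro!: Ck_on_inverse)
  then show ?thesis using U V by (intro smooth_atI[of "U \<inter> V"]) auto
qed

lemma smooth_at_divide:
  fixes f g :: "'a::euclidean_space \<Rightarrow> complex"
  shows "smooth_at p f \<Longrightarrow> smooth_at p g \<Longrightarrow> g p \<noteq> 0 \<Longrightarrow> smooth_at p (\<lambda>z. f z / g z)"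
  unfolding divide_inverse by (intro smooth_at_mult smooth_at_inverse)

lemma smooth_at_compose:
  assumes f: "smooth_at (g p) f" and g: "smooth_at p g"
  shows "smooth_at p (\<lambda>z. f (g z))"
proof -
  obtain V where V: "open V" "g p \<in> V" "smooth_on f V" using f by (rule smooth_atE)
  obtain U where U: "open U" "p \<in> U" "smooth_on g U" using g by (rule smooth_atE)
  have "continuous_on U g" using U(3) Ck_on_imp_continuous_on unfolding smooth_on_def by blast
  then have op: "open (U \<inter> g -` V)" using continuous_open_preimage U V by blast
  have "smooth_on (\<lambda>z. f (g z)) (U \<inter> g -` V)"
    unfolding smooth_on_def
  proof
    fix k
    have g: "Ck_on k g (U \<inter> g -` V)"
      using U(3) Ck_on_subset[of k g U "U \<inter> g -` V"] by (simp add: smooth_on_def)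
    have f: "Ck_on k f V" using V(3) by (simp add: smooth_on_def)
    show "Ck_on k (\<lambda>z. f (g z)) (U \<inter> g -` V)"
      by (rule Ck_on_compose[OF op V(1) _ f g]) blast
  qed
  moreover have "p \<in> U \<inter> g -` V" using U V by simp
  ultimately show ?thesis using op smooth_atI by blast
qed

text \<open>The second difference is symmetric in v and w, so evaluating its limit in this one way
  yields the symmetry of second derivatives. The mean value theorem in direction v reduces it to a
  difference of values of g' in direction v, and differentiability at z evaluates that
  difference.\<close>

lemma second_difference_limit:
  fixes g :: "'a::euclidean_space \<Rightarrow> real"
  assumes "open U" "z \<in> U" and dg: "\<And>x. x \<in> U \<Longrightarrow> (g has_derivative g' x) (at x)"
    and dv: "((\<lambda>x. g' x v) has_derivative L) (at z)"
  shows "((\<lambda>h. (g (z + h *\<^sub>R v + h *\<^sub>R w) - g (z + h *\<^sub>R v) - g (z + h *\<^sub>R w) + g z) / h\<^sup>2)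
    \<longlongrightarrow> L w) (at_right 0)"
proof (rule tendstoI)
  fix e :: real assume e: "e > 0"
  \<comment> \<open>The two error terms below involve norms at most h (|v| + |w|) and h |v|;
    \<open>C\<close> is their sum divided by h, plus 1 to make it positive.\<close>
  define C where "C = 2 * norm v + norm w + 1"
  have C: "C > 0" unfolding C_def by (simp add: add_nonneg_pos)
  interpret L: bounded_linear L using dv by (rule has_derivative_bounded_linear)
  obtain r where r: "r > 0" "ball z r \<subseteq> U" using assms(1,2) openE by blast
  have "e / (2 * C) > 0" using e C by simp
  then obtain d where d: "d > 0"
    "\<And>y. norm (y - z) < d \<Longrightarrow> \<bar>g' y v - g' z v - L (y - z)\<bar> \<le> e / (2 * C) * norm (y - z)"
    using dv unfolding has_derivative_at_alt by (metis real_norm_def)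
  define \<eta> where "\<eta> = min r d / C"
  have \<eta>: "\<eta> > 0" using r d C by (simp add: \<eta>_def)
  have "dist ((g (z + h *\<^sub>R v + h *\<^sub>R w) - g (z + h *\<^sub>R v) - g (z + h *\<^sub>R w) + g z) / h\<^sup>2) (L w) < e"
    if h: "0 < h" "h < \<eta>" for h
  proof -
    have hC: "h * C < min r d" using h C by (simp add: \<eta>_def pos_less_divide_eq)
    have bound: "norm (s *\<^sub>R v + t *\<^sub>R w) < h * C" "norm (s *\<^sub>R v + t *\<^sub>R w) \<le> h * (norm v + norm w)"
      if "0 \<le> s" "s \<le> h" "0 \<le> t" "t \<le> h" for s t
    proof -
      have "norm (s *\<^sub>R v + t *\<^sub>R w) \<le> s * norm v + t * norm w"
        using that by (metis abs_of_nonneg norm_scaleR norm_triangle_ineq)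
      also have "\<dots> \<le> h * norm v + h * norm w"
        using that by (intro add_mono mult_right_mono) auto
      finally show 1: "norm (s *\<^sub>R v + t *\<^sub>R w) \<le> h * (norm v + norm w)" by (simp add: algebra_simps)
      have "h * (norm v + norm w) < h * C"
        using h(1) by (intro mult_strict_left_mono) (simp_all add: C_def add_nonneg_pos)
      then show "norm (s *\<^sub>R v + t *\<^sub>R w) < h * C" using 1 by simp
    qed
    have inU: "z + s *\<^sub>R v + t *\<^sub>R w \<in> U" if "0 \<le> s" "s \<le> h" "0 \<le> t" "t \<le> h" for s t
    proof -
      have "dist z (z + s *\<^sub>R v + t *\<^sub>R w) = norm (s *\<^sub>R v + t *\<^sub>R w)"
        by (simp add: dist_norm norm_minus_commute algebra_simps)
      then show ?thesis using bound(1)[OF that] hC r by auto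
    qed
    define \<psi> where "\<psi> s = g (z + s *\<^sub>R v + h *\<^sub>R w) - g (z + s *\<^sub>R v)" for s
    have line: "((\<lambda>s. g (z + s *\<^sub>R v + t *\<^sub>R w)) has_real_derivative g' (z + s *\<^sub>R v + t *\<^sub>R w) v) (at s)"
      if "0 \<le> s" "s \<le> h" "0 \<le> t" "t \<le> h" for s t
    proof -
      have "(g has_derivative g' (z + s *\<^sub>R v + t *\<^sub>R w)) (at (z + s *\<^sub>R v + t *\<^sub>R w))"
        by (rule dg[OF inU[OF that]])
      moreover have "((\<lambda>s. z + s *\<^sub>R v + t *\<^sub>R w) has_derivative (\<lambda>x. x *\<^sub>R v)) (at s)"
        by (auto intro!: derivative_eq_intros)
      ultimately have "((\<lambda>s. g (z + s *\<^sub>R v + t *\<^sub>R w)) has_derivative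
          (\<lambda>x. g' (z + s *\<^sub>R v + t *\<^sub>R w) (x *\<^sub>R v))) (at s)"
        by (rule has_derivative_compose[rotated])
      moreover have "linear (g' (z + s *\<^sub>R v + t *\<^sub>R w))"
        using dg[OF inU[OF that]] has_derivative_linear by blast
      ultimately show ?thesis
        by (simp add: has_field_derivative_def linear_cmul mult_commute_abs)
    qed
    have "\<exists>\<xi>>0. \<xi> < h \<and> \<psi> h - \<psi> 0 = (h - 0) * (g' (z + \<xi> *\<^sub>R v + h *\<^sub>R w) v - g' (z + \<xi> *\<^sub>R v) v)"
    proof (rule MVT2[OF h(1)])
      fix s assume "0 \<le> s" "s \<le> h"
      then show "(\<psi> has_real_derivative g' (z + s *\<^sub>R v + h *\<^sub>R w) v - g' (z + s *\<^sub>R v) v) (at s)"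
        using line[of s h] line[of s 0] h unfolding \<psi>_def by (auto intro!: derivative_eq_intros)
    qed
    then obtain \<xi> where \<xi>: "0 < \<xi>" "\<xi> < h"
      and eq: "\<psi> h - \<psi> 0 = h * (g' (z + \<xi> *\<^sub>R v + h *\<^sub>R w) v - g' (z + \<xi> *\<^sub>R v) v)" by auto
    let ?a = "g' (z + \<xi> *\<^sub>R v + h *\<^sub>R w) v" and ?b = "g' (z + \<xi> *\<^sub>R v) v"
    have 1: "\<bar>?a - g' z v - L (\<xi> *\<^sub>R v + h *\<^sub>R w)\<bar> \<le> e / (2 * C) * (h * (norm v + norm w))"
    proof -
      have "\<bar>?a - g' z v - L (\<xi> *\<^sub>R v + h *\<^sub>R w)\<bar> \<le> e / (2 * C) * norm (\<xi> *\<^sub>R v + h *\<^sub>R w)"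
        using d(2)[of "z + \<xi> *\<^sub>R v + h *\<^sub>R w"] bound(1)[of \<xi> h] \<xi> h hC by (simp add: add.assoc)
      also have "\<dots> \<le> e / (2 * C) * (h * (norm v + norm w))"
        using bound(2)[of \<xi> h] \<xi> h e C by (intro mult_left_mono) auto
      finally show ?thesis .
    qed
    have 2: "\<bar>?b - g' z v - L (\<xi> *\<^sub>R v)\<bar> \<le> e / (2 * C) * (h * norm v)"
    proof -
      have "\<bar>?b - g' z v - L (\<xi> *\<^sub>R v)\<bar> \<le> e / (2 * C) * norm (\<xi> *\<^sub>R v)"
        using d(2)[of "z + \<xi> *\<^sub>R v"] bound(1)[of \<xi> 0] \<xi> h hC by simp
      also have "\<dots> \<le> e / (2 * C) * (h * norm v)"
        using \<xi> e C by (intro mult_left_mono) (auto intro: mult_right_mono)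
      finally show ?thesis .
    qed
    have "\<bar>?a - ?b - h * L w\<bar> \<le> e / (2 * C) * (h * (norm v + norm w)) + e / (2 * C) * (h * norm v)"
      using 1 2 by (simp add: L.add L.scaleR)
    also have "\<dots> = e / (2 * C) * h * (2 * norm v + norm w)" using C by (simp add: field_simps)
    also have "\<dots> \<le> e / (2 * C) * h * C"
      using e C h by (intro mult_left_mono) (simp_all add: C_def)
    also have "\<dots> = e * h / 2" using C by simp
    also have "\<dots> < e * h" using e h by simp
    finally have 3: "\<bar>?a - ?b - h * L w\<bar> < e * h" .
    have num: "g (z + h *\<^sub>R v + h *\<^sub>R w) - g (z + h *\<^sub>R v) - g (z + h *\<^sub>R w) + g z = h * (?a - ?b)"
      using eq unfolding \<psi>_def by simp
    have "(g (z + h *\<^sub>R v + h *\<^sub>R w) - g (z + h *\<^sub>R v) - g (z + h *\<^sub>R w) + g z) / h\<^sup>2 - L w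
        = (?a - ?b - h * L w) / h"
      unfolding num using h by (simp add: field_simps power2_eq_square)
    then show ?thesis using 3 h by (simp add: dist_norm pos_divide_less_eq)
  qed
  then show "\<forall>\<^sub>F h in at_right 0. dist ((g (z + h *\<^sub>R v + h *\<^sub>R w) - g (z + h *\<^sub>R v)
      - g (z + h *\<^sub>R w) + g z) / h\<^sup>2) (L w) < e"
    unfolding eventually_at_right_field using \<eta> by auto
qed

lemma second_derivative_symmetric_real:
  fixes g :: "'a::euclidean_space \<Rightarrow> real"
  assumes "open U" "z \<in> U" and "\<And>x. x \<in> U \<Longrightarrow> (g has_derivative g' x) (at x)"
    and "((\<lambda>x. g' x v) has_derivative Lv) (at z)" and "((\<lambda>x. g' x w) has_derivative Lw) (at z)"
  shows "Lv w = Lw v"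
proof -
  have "((\<lambda>h. (g (z + h *\<^sub>R v + h *\<^sub>R w) - g (z + h *\<^sub>R v) - g (z + h *\<^sub>R w) + g z) / h\<^sup>2)
      \<longlongrightarrow> Lw v) (at_right 0)"
    using second_difference_limit[OF assms(1-3,5), of v] by (simp add: algebra_simps)
  then show ?thesis
    using second_difference_limit[OF assms(1-4), of w] tendsto_unique trivial_limit_at_right_real by blast
qed

lemma frechet_derivative_symmetric:
  fixes f :: "'a::euclidean_space \<Rightarrow> 'b::euclidean_space"
  assumes f: "smooth_at z f"
  shows "frechet_derivative (\<lambda>x. frechet_derivative f (at x) v) (at z) w
    = frechet_derivative (\<lambda>x. frechet_derivative f (at x) w) (at z) v"
proof (rule euclidean_eqI)
  fix b :: 'b
  let ?f = "\<lambda>x. frechet_derivative f (at x)"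
  obtain U where U: "open U" "z \<in> U" "smooth_on f U" using f by (rule smooth_atE)
  have "((\<lambda>x. f x \<bullet> b) has_derivative (\<lambda>y. ?f x y \<bullet> b)) (at x)" if "x \<in> U" for x
    using smooth_on_has_derivative[OF U(3) that] by (rule has_derivative_inner_left)
  moreover have "((\<lambda>x. ?f x y \<bullet> b) has_derivative
      (\<lambda>w. frechet_derivative (\<lambda>x. ?f x y) (at z) w \<bullet> b)) (at z)" for y
    by (intro has_derivative_inner_left smooth_at_has_derivative smooth_at_frechet f)
  ultimately show "frechet_derivative (\<lambda>x. ?f x v) (at z) w \<bullet> b
      = frechet_derivative (\<lambda>x. ?f x w) (at z) v \<bullet> b"
    by (intro second_derivative_symmetric_real[OF U(1,2), of "\<lambda>x. f x \<bullet> b" "\<lambda>x y. ?f x y \<bullet> b"]) blast+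
qed

section \<open>Holomorphic functions of several variables\<close>

lemma bounded_linear_vec_scale: "bounded_linear (\<lambda>c::complex. c *s (v::complex^'n))"
  unfolding linear_conv_bounded_linear[symmetric]
  by (rule linearI) (simp_all add: vec_eq_iff algebra_simps)

lemma norm_vec_scale: "norm (c *s (v::complex^'n)) = cmod c * norm v"
  by (simp add: norm_vec_def L2_set_right_distrib norm_mult)

lemma holo_fun_on_frechet:
  assumes "holo_fun_on f U" "z \<in> U"
  shows "(f has_derivative frechet_derivative f (at z)) (at z)"
    and "frechet_derivative f (at z) (c *s v) = c * frechet_derivative f (at z) v"
proof -
  obtain f' where f': "(f has_derivative f') (at z)" "\<forall>c v. f' (c *s v) = c * f' v"
    using assms unfolding holo_fun_on_def by blast
  then have "frechet_derivative f (at z) = f'" by (intro frechet_derivative_eq)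
  then show "(f has_derivative frechet_derivative f (at z)) (at z)"
    "frechet_derivative f (at z) (c *s v) = c * frechet_derivative f (at z) v"
    using f' by auto
qed

lemma holo_fun_on_continuous: "holo_fun_on f U \<Longrightarrow> continuous_on U f"
  by (intro continuous_at_imp_continuous_on ballI has_derivative_continuous[OF holo_fun_on_frechet(1)])

lemma holo_fun_on_line:
  assumes f: "holo_fun_on f U" and x: "x + \<zeta> *s v \<in> U"
  shows "((\<lambda>\<zeta>. f (x + \<zeta> *s v)) has_field_derivative frechet_derivative f (at (x + \<zeta> *s v)) v) (at \<zeta>)"
proof -
  have "((\<lambda>\<zeta>. x + \<zeta> *s v) has_derivative (\<lambda>h. h *s v)) (at \<zeta>)"
    by (auto intro!: derivative_eq_intros bounded_linear_imp_has_derivative bounded_linear_vec_scale)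
  from has_derivative_compose[OF this holo_fun_on_frechet(1)[OF f x]]
  have "((\<lambda>\<zeta>. f (x + \<zeta> *s v)) has_derivative (\<lambda>h. frechet_derivative f (at (x + \<zeta> *s v)) (h *s v))) (at \<zeta>)" .
  then show ?thesis
    unfolding has_field_derivative_def
    by (simp add: holo_fun_on_frechet(2)[OF f x] mult.commute[of _ "frechet_derivative f _ v"])
qed

text \<open>Cauchy's formula on the complex line through x in direction v. It expresses the
  derivative through f alone, so regularity of the derivative can be gained from mere
  differentiability. The circle is parametrized over [0,1] to fit the theorems on parameter
  integrals.\<close>

lemma frechet_Cauchy_integral:
  fixes f :: "complex^'n \<Rightarrow> complex"
  assumes f: "holo_fun_on f U" and U: "\<And>\<zeta>. cmod \<zeta> \<le> r \<Longrightarrow> x + \<zeta> *s v \<in> U" and "open U" and r: "r > 0"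
  defines "c \<equiv> \<lambda>t. of_real r * exp (2 * of_real pi * \<i> * of_real t)"
  shows "frechet_derivative f (at x) v = integral {0..1} (\<lambda>t. f (x + c t *s v) / c t)"
proof -
  let ?g = "\<lambda>\<zeta>. f (x + \<zeta> *s v)"
  have der: "(?g has_field_derivative frechet_derivative f (at (x + \<zeta> *s v)) v) (at \<zeta>)" if "cmod \<zeta> \<le> r" for \<zeta>
    by (rule holo_fun_on_line[OF f U[OF that]])
  have "continuous_on (cball 0 r) ?g"
    using der by (intro continuous_at_imp_continuous_on ballI) (auto intro: DERIV_isCont)
  moreover have "?g holomorphic_on ball 0 r"
    unfolding holomorphic_on_open[OF open_ball]
  proof
    fix \<zeta> :: complex assume "\<zeta> \<in> ball 0 r"
    then have "cmod \<zeta> \<le> r" by simp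
    from der[OF this] show "\<exists>f'. (?g has_field_derivative f') (at \<zeta>)" by blast
  qed
  ultimately have "((\<lambda>u. ?g u / (u - 0) ^ Suc 1) has_contour_integral
      (2 * pi * \<i>) / fact 1 * (deriv ^^ 1) ?g 0) (circlepath 0 r)"
    using r by (intro Cauchy_has_contour_integral_higher_derivative_circlepath) auto
  moreover have "deriv ?g 0 = frechet_derivative f (at x) v"
    using der[of 0] r by (intro DERIV_imp_deriv) simp
  ultimately have "((\<lambda>u. ?g u / u\<^sup>2) has_contour_integral 2 * pi * \<i> * frechet_derivative f (at x) v) (circlepath 0 r)"
    by (simp add: power2_eq_square)
  then have "((\<lambda>t. ?g (circlepath 0 r t) / (circlepath 0 r t)\<^sup>2 * vector_derivative (circlepath 0 r) (at t within {0..1}))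
      has_integral 2 * pi * \<i> * frechet_derivative f (at x) v) {0..1}"
    by (simp add: has_contour_integral_def)
  \<comment> \<open>On the circle dz = 2 pi i c dt, which cancels one of the two factors
    \<open>c t\<close> in the denominator.\<close>
  then have "((\<lambda>t. 2 * pi * \<i> * (?g (c t) / c t)) has_integral 2 * pi * \<i> * frechet_derivative f (at x) v) {0..1}"
  proof (rule has_integral_eq[rotated])
    fix t :: real assume t: "t \<in> {0..1}"
    have c: "circlepath 0 r t = c t" by (simp add: c_def circlepath mult_ac)
    have c0: "c t \<noteq> 0" using r by (simp add: c_def)
    have "vector_derivative (circlepath 0 r) (at t within {0..1}) = 2 * pi * \<i> * c t"
      using t by (simp add: vector_derivative_circlepath01 c_def mult_ac)
    then show "?g (circlepath 0 r t) / (circlepath 0 r t)\<^sup>2 * vector_derivative (circlepath 0 r) (at t within {0..1})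
        = 2 * pi * \<i> * (?g (c t) / c t)"
      unfolding c using c0 by (simp add: field_simps power2_eq_square)
  qed
  from has_integral_mult_right[OF this, of "inverse (2 * pi * \<i>)"]
  have "((\<lambda>t. ?g (c t) / c t) has_integral frechet_derivative f (at x) v) {0..1}"
    by (simp add: field_simps)
  then show ?thesis by (rule integral_unique[symmetric])
qed

lemma continuous_on_circle: "continuous_on A (\<lambda>t. of_real r * exp (2 * of_real pi * \<i> * of_real t))"
  by (intro continuous_intros)

lemma circle_shift_in:
  assumes "ball z0 (e + r * norm v) \<subseteq> U" "x \<in> ball z0 e" "cmod \<zeta> \<le> r"
  shows "x + \<zeta> *s (v::complex^'n) \<in> U"
proof -
  have "dist z0 (x + \<zeta> *s v) \<le> dist z0 x + norm (\<zeta> *s v)"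
    by (metis add_diff_cancel_left' dist_norm dist_triangle norm_minus_commute)
  also have "norm (\<zeta> *s v) \<le> r * norm v"
    unfolding norm_vec_scale using assms(3) by (intro mult_right_mono) auto
  finally show ?thesis using assms by auto
qed

lemma ball_room:
  assumes "open U" "z0 \<in> U"
  obtains e r where "e > 0" "r > 0" "ball z0 (e + r * norm (v::complex^'n)) \<subseteq> U"
proof -
  obtain d where d: "d > 0" "ball z0 d \<subseteq> U" using assms openE by blast
  define r where "r = d / (2 * (norm v + 1))"
  have "norm v / (norm v + 1) \<le> 1" by (simp add: divide_le_eq_1 add_nonneg_pos)
  then have "d / 2 * (norm v / (norm v + 1)) \<le> d / 2 * 1" using d by (intro mult_left_mono) auto
  then have "r * norm v \<le> d / 2" by (simp add: r_def field_simps)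
  moreover have "r > 0" using d by (simp add: r_def add_nonneg_pos)
  ultimately show ?thesis using d by (intro that[of "d / 2" r]) (auto intro!: order_trans[OF subset_ball d(2)])
qed

text \<open>Proved ahead of differentiability because differentiating under the integral asks for a
  continuous derivative of the integrand, and \<open>holo_fun_on\<close> demands only that it
  exists.\<close>

lemma continuous_on_frechet:
  fixes f :: "complex^'n \<Rightarrow> complex"
  assumes f: "holo_fun_on f U" and U: "open U"
  shows "continuous_on U (\<lambda>z. frechet_derivative f (at z) v)"
proof (intro continuous_at_imp_continuous_on ballI)
  fix z0 assume z0: "z0 \<in> U"
  obtain e r where er: "e > 0" "r > 0" "ball z0 (e + r * norm v) \<subseteq> U" using ball_room[OF U z0] .
  note in_U = circle_shift_in[OF er(3)]
  define c where "c = (\<lambda>t. of_real r * exp (2 * of_real pi * \<i> * of_real t))"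
  have c: "c t \<noteq> 0" "cmod (c t) = r" for t using er by (simp_all add: c_def norm_mult)
  have cc: "continuous_on A c" for A unfolding c_def by (rule continuous_on_circle)
  have "continuous_on (ball z0 e \<times> cbox 0 1) (\<lambda>(x, t). f (x + c t *s v) / c t)"
    unfolding case_prod_beta
    by (intro continuous_on_divide continuous_on_compose2[OF holo_fun_on_continuous[OF f]]
        continuous_on_compose2[OF cc[of UNIV]] continuous_on_add
        bounded_linear.continuous_on[OF bounded_linear_vec_scale] continuous_intros)
      (use c in_U in auto)
  then have "continuous_on (ball z0 e) (\<lambda>x. integral (cbox 0 1) (\<lambda>t. f (x + c t *s v) / c t))"
    by (rule integral_continuous_on_param)
  moreover have "frechet_derivative f (at x) v = integral (cbox 0 1) (\<lambda>t. f (x + c t *s v) / c t)"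
    if "x \<in> ball z0 e" for x
    using frechet_Cauchy_integral[OF f in_U[OF that] U er(2)] unfolding c_def by simp
  ultimately have "continuous_on (ball z0 e) (\<lambda>z. frechet_derivative f (at z) v)"
    using continuous_on_cong by (metis (no_types, lifting))
  then show "isCont (\<lambda>z. frechet_derivative f (at z) v) z0"
    using er(1) by (simp add: continuous_on_eq_continuous_at)
qed

text \<open>Cauchy's formula is differentiated in the base point under the integral, and complex
  homogeneity passes through the integral. Iteration gives smoothness.\<close>

lemma holo_fun_on_frechet_derivative:
  fixes f :: "complex^'n \<Rightarrow> complex"
  assumes f: "holo_fun_on f U" and U: "open U"
  shows "holo_fun_on (\<lambda>z. frechet_derivative f (at z) v) U"
  unfolding holo_fun_on_def
proof
  fix z0 assume z0: "z0 \<in> U"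
  obtain e r where er: "e > 0" "r > 0" "ball z0 (e + r * norm v) \<subseteq> U" using ball_room[OF U z0] .
  note in_U = circle_shift_in[OF er(3)]
  define c where "c = (\<lambda>t. of_real r * exp (2 * of_real pi * \<i> * of_real t))"
  have c: "c t \<noteq> 0" "cmod (c t) = r" for t using er by (simp_all add: c_def norm_mult)
  have cc: "continuous_on A c" for A unfolding c_def by (rule continuous_on_circle)
  let ?F = "\<lambda>x t. f (x + c t *s v) / c t"
  \<comment> \<open>\<open>leibniz_rule\<close> takes the derivative as a \<open>blinfun\<close>;
    its continuity is checked vector by vector, where \<open>continuous_on_frechet\<close>
    applies.\<close>
  define G where "G = (\<lambda>x t. Blinfun (\<lambda>h. frechet_derivative f (at (x + c t *s v)) h / c t))"
  have dF: "((\<lambda>x. ?F x t) has_derivative (\<lambda>h. frechet_derivative f (at (x + c t *s v)) h / c t)) (at x)"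
    if "x \<in> ball z0 e" for x t
  proof -
    have "x + c t *s v \<in> U" using in_U[OF that] c by simp
    note holo_fun_on_frechet(1)[OF f this]
    moreover have "((\<lambda>x. x + c t *s v) has_derivative (\<lambda>h. h)) (at x)"
      by (auto intro!: derivative_eq_intros)
    ultimately have "((\<lambda>x. f (x + c t *s v)) has_derivative frechet_derivative f (at (x + c t *s v))) (at x)"
      using has_derivative_compose[of "\<lambda>x. x + c t *s v" "\<lambda>h. h" x UNIV f] by simp
    then show ?thesis
      using bounded_linear.has_derivative[OF bounded_linear_divide[of "c t"]] by blast
  qed
  have G: "blinfun_apply (G x t) = (\<lambda>h. frechet_derivative f (at (x + c t *s v)) h / c t)"
    if "x \<in> ball z0 e" for x t
    unfolding G_def using has_derivative_bounded_linear[OF dF[OF that]]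
    by (rule bounded_linear_Blinfun_apply)
  have contF: "continuous_on (ball z0 e \<times> cbox 0 1) (\<lambda>(x, t). ?F x t)"
    unfolding case_prod_beta
    by (intro continuous_on_divide continuous_on_compose2[OF holo_fun_on_continuous[OF f]]
        continuous_on_compose2[OF cc[of UNIV]] continuous_on_add
        bounded_linear.continuous_on[OF bounded_linear_vec_scale] continuous_intros)
      (use c in_U in auto)
  have contG': "continuous_on (ball z0 e \<times> cbox 0 1)
      (\<lambda>y. frechet_derivative f (at (fst y + c (snd y) *s v)) h / c (snd y))" for h
    by (intro continuous_on_divide continuous_on_compose2[OF continuous_on_frechet[OF f U, of h]]
        continuous_on_compose2[OF cc[of UNIV]] continuous_on_add
        bounded_linear.continuous_on[OF bounded_linear_vec_scale] continuous_intros)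
      (use c in_U in auto)
  have contG: "continuous_on (ball z0 e \<times> cbox 0 1) (\<lambda>(x, t). G x t)"
    unfolding case_prod_beta
  proof (rule continuous_on_blinfun_componentwise)
    fix h :: "complex^'n"
    show "continuous_on (ball z0 e \<times> cbox 0 1) (\<lambda>y. blinfun_apply (G (fst y) (snd y)) h)"
      by (rule continuous_on_eq[OF contG'[of h]]) (auto simp: G)
  qed
  have slice: "continuous_on (cbox 0 1) (G z0)"
  proof -
    have "continuous_on (cbox 0 1) (\<lambda>t. (\<lambda>(x, t). G x t) (z0, t))"
      by (rule continuous_on_compose2[OF contG]) (use er in \<open>auto intro!: continuous_intros\<close>)
    then show ?thesis by simp
  qed
  have z0e: "z0 \<in> ball z0 e" using er by simp
  have "((\<lambda>x. integral (cbox 0 1) (?F x)) has_derivative blinfun_apply (integral (cbox 0 1) (G z0)))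
      (at z0 within ball z0 e)"
  proof (rule leibniz_rule[OF _ _ contG z0e convex_ball])
    show "((\<lambda>x. ?F x t) has_derivative blinfun_apply (G x t)) (at x within ball z0 e)"
      if "x \<in> ball z0 e" "t \<in> cbox 0 1" for x t
      using dF[OF that(1)] unfolding G[OF that(1)] by (rule has_derivative_at_withinI)
    show "?F x integrable_on cbox 0 1" if "x \<in> ball z0 e" for x
    proof -
      have "continuous_on (cbox 0 1) (\<lambda>t. (\<lambda>(x, t). ?F x t) (x, t))"
        by (rule continuous_on_compose2[OF contF]) (use that in \<open>auto intro!: continuous_intros\<close>)
      then show ?thesis by (intro integrable_continuous) simp
    qed
  qed
  then have "((\<lambda>x. integral (cbox 0 1) (?F x)) has_derivative blinfun_apply (integral (cbox 0 1) (G z0))) (at z0)"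
    using at_within_open[OF z0e open_ball] by simp
  moreover have "integral (cbox 0 1) (?F x) = frechet_derivative f (at x) v" if "x \<in> ball z0 e" for x
    using frechet_Cauchy_integral[OF f in_U[OF that] U er(2)] unfolding c_def by simp
  ultimately have der: "((\<lambda>x. frechet_derivative f (at x) v) has_derivative
      blinfun_apply (integral (cbox 0 1) (G z0))) (at z0)"
    by (rule has_derivative_transform_within_open[OF _ open_ball z0e])
  have app: "blinfun_apply (integral (cbox 0 1) (G z0)) h
      = integral (cbox 0 1) (\<lambda>t. frechet_derivative f (at (z0 + c t *s v)) h / c t)" for h
  proof -
    have "integral (cbox 0 1) ((\<lambda>b. blinfun_apply b h) \<circ> G z0) = blinfun_apply (integral (cbox 0 1) (G z0)) h"
      by (rule integral_linear[OF integrable_continuous[OF slice]])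
        (rule bounded_bilinear.bounded_linear_left[OF bounded_bilinear_blinfun_apply])
    then show ?thesis by (simp add: o_def G[OF z0e])
  qed
  have "blinfun_apply (integral (cbox 0 1) (G z0)) (a *s h) = a * blinfun_apply (integral (cbox 0 1) (G z0)) h" for a h
  proof -
    have "frechet_derivative f (at (z0 + c t *s v)) (a *s h) / c t
        = a * (frechet_derivative f (at (z0 + c t *s v)) h / c t)" for t
      using holo_fun_on_frechet(2)[OF f in_U[OF z0e]] c by simp
    then show ?thesis unfolding app by (simp only: integral_mult_right)
  qed
  then show "\<exists>f'. ((\<lambda>z. frechet_derivative f (at z) v) has_derivative f') (at z0)
      \<and> (\<forall>c v. f' (c *s v) = c * f' v)"
    using der by blast
qed

lemma holo_fun_on_smooth: 
  assumes "holo_fun_on f U" "open U" shows "smooth_on f U"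
proof -
  have "Ck_on k f U" for k
    using assms(1)
  proof (induction k arbitrary: f)
    case 0
    then show ?case by (simp add: holo_fun_on_continuous)
  next
    case (Suc k)
    show ?case
      by (rule Ck_on_SucI[OF assms(2) holo_fun_on_frechet(1)[OF Suc.prems]])
        (auto intro: Suc.IH holo_fun_on_frechet_derivative[OF Suc.prems assms(2)])
  qed
  then show ?thesis by (simp add: smooth_on_def)
qed

lemma axis_scale: "c *s axis k (a::complex) = axis k (c * a)"
  by (simp add: vec_eq_iff axis_def)

lemma holo_fun_on_dZ:
  assumes "holo_fun_on f U" "z \<in> U"
  shows "dZ f z k = frechet_derivative f (at z) (axis k 1)" "dZbar f z k = 0"
proof -
  have "frechet_derivative f (at z) (axis k \<i>) = \<i> * frechet_derivative f (at z) (axis k 1)"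
    using holo_fun_on_frechet(2)[OF assms, of \<i> "axis k 1"] by (simp add: axis_scale)
  then show "dZ f z k = frechet_derivative f (at z) (axis k 1)" "dZbar f z k = 0"
    by (simp_all add: dZ_def dZbar_def flip: mult.assoc)
qed

lemma holo_fun_on_cong:
  assumes "open U" "\<And>z. z \<in> U \<Longrightarrow> f z = g z" "holo_fun_on f U" shows "holo_fun_on g U"
  unfolding holo_fun_on_def
proof
  fix z assume z: "z \<in> U"
  obtain f' where f': "(f has_derivative f') (at z)" "\<forall>c v. f' (c *s v) = c * f' v"
    using assms(3) z unfolding holo_fun_on_def by blast
  have "(g has_derivative f') (at z)"
    by (rule has_derivative_transform_within_open[OF f'(1) assms(1) z]) (simp add: assms(2))
  then show "\<exists>f'. (g has_derivative f') (at z) \<and> (\<forall>c v. f' (c *s v) = c * f' v)" using f'(2) by blast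
qed

lemma holo_fun_on_dZ_holo:
  assumes "holo_fun_on f U" "open U" shows "holo_fun_on (\<lambda>z. dZ f z k) U"
  by (rule holo_fun_on_cong[OF assms(2) _ holo_fun_on_frechet_derivative[OF assms, of "axis k 1"]])
    (simp add: holo_fun_on_dZ[OF assms(1)])

lemma holo_fun_on_const: "holo_fun_on (\<lambda>_. c) U"
  unfolding holo_fun_on_def by (intro ballI exI[of _ "\<lambda>_. 0"]) auto

lemma holo_fun_on_add:
  assumes "holo_fun_on f U" "holo_fun_on g U" shows "holo_fun_on (\<lambda>z. f z + g z) U"
  unfolding holo_fun_on_def
proof
  fix z assume "z \<in> U"
  then obtain f' g' where "(f has_derivative f') (at z)" "\<forall>c v. f' (c *s v) = c * f' v"
    "(g has_derivative g') (at z)" "\<forall>c v. g' (c *s v) = c * g' v"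
    using assms unfolding holo_fun_on_def by metis
  then show "\<exists>f'. ((\<lambda>z. f z + g z) has_derivative f') (at z) \<and> (\<forall>c v. f' (c *s v) = c * f' v)"
    by (intro exI[of _ "\<lambda>v. f' v + g' v"]) (auto intro: has_derivative_add simp: algebra_simps)
qed

lemma holo_fun_on_mult:
  assumes "holo_fun_on f U" "holo_fun_on g U" shows "holo_fun_on (\<lambda>z. f z * g z) U"
  unfolding holo_fun_on_def
proof
  fix z assume "z \<in> U"
  then obtain f' g' where "(f has_derivative f') (at z)" "\<forall>c v. f' (c *s v) = c * f' v"
    "(g has_derivative g') (at z)" "\<forall>c v. g' (c *s v) = c * g' v"
    using assms unfolding holo_fun_on_def by metis
  then show "\<exists>f'. ((\<lambda>z. f z * g z) has_derivative f') (at z) \<and> (\<forall>c v. f' (c *s v) = c * f' v)"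
    by (intro exI[of _ "\<lambda>v. f z * g' v + f' v * g z"])
      (auto intro: has_derivative_mult simp: algebra_simps)
qed

lemma holo_fun_on_sum:
  "finite A \<Longrightarrow> (\<And>i. i \<in> A \<Longrightarrow> holo_fun_on (f i) U) \<Longrightarrow> holo_fun_on (\<lambda>z. \<Sum>i\<in>A. f i z) U"
  by (induction A rule: finite_induct) (auto intro: holo_fun_on_const holo_fun_on_add)

lemma holo_fun_on_prod:
  "finite A \<Longrightarrow> (\<And>i. i \<in> A \<Longrightarrow> holo_fun_on (f i) U) \<Longrightarrow> holo_fun_on (\<lambda>z. \<Prod>i\<in>A. f i z) U"
  by (induction A rule: finite_induct) (auto intro: holo_fun_on_const holo_fun_on_mult)

lemma holo_fun_on_det:
  assumes "\<And>i j. holo_fun_on (\<lambda>z. A z $ i $ j) U"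
  shows "holo_fun_on (\<lambda>z. det (A z :: complex^'m^'m)) U"
  unfolding det_def
  by (intro holo_fun_on_sum holo_fun_on_mult holo_fun_on_const holo_fun_on_prod assms)
    (auto simp: finite_permutations)

section \<open>Iterated holomorphic derivatives and the identity theorem\<close>

fun dZs :: "'n list \<Rightarrow> (complex^'n::finite \<Rightarrow> complex) \<Rightarrow> complex^'n \<Rightarrow> complex" where
  "dZs [] f = f"
| "dZs (k # ks) f = (\<lambda>z. dZ (dZs ks f) z k)"

lemma holo_fun_on_dZs: "holo_fun_on f U \<Longrightarrow> open U \<Longrightarrow> holo_fun_on (dZs ks f) U"
  by (induction ks) (auto intro: holo_fun_on_dZ_holo)

lemma vec_eq_sum_axis: "(v::complex^'n) = (\<Sum>k\<in>UNIV. v $ k *s axis k 1)"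
  by (simp add: vec_eq_iff axis_def if_distrib [of "\<lambda>x. _ * x"] cong: if_cong)

lemma holo_fun_on_frechet_sum:
  fixes f :: "complex^'n \<Rightarrow> complex"
  assumes "holo_fun_on f U" "z \<in> U"
  shows "frechet_derivative f (at z) v = (\<Sum>k\<in>UNIV. v $ k * dZ f z k)"
proof -
  have lin: "linear (frechet_derivative f (at z))"
    using holo_fun_on_frechet(1)[OF assms] has_derivative_linear by blast
  have "frechet_derivative f (at z) v = frechet_derivative f (at z) (\<Sum>k\<in>UNIV. v $ k *s axis k 1)"
    using vec_eq_sum_axis[of v] by simp
  also have "\<dots> = (\<Sum>k\<in>UNIV. v $ k * frechet_derivative f (at z) (axis k 1))"
    by (simp only: linear_sum[OF lin] holo_fun_on_frechet(2)[OF assms])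
  finally show ?thesis by (simp add: holo_fun_on_dZ[OF assms])
qed

text \<open>Along the complex line from p through z, the derivatives at 0 are combinations of
  iterated derivatives of f at p; the one-variable identity theorem then gives f z = 0.\<close>

lemma holo_fun_eventually_0:
  fixes f :: "complex^'n \<Rightarrow> complex"
  assumes f: "holo_fun_on f U" and U: "open U" "p \<in> U" and flat: "\<And>ks. dZs ks f p = 0"
  shows "\<forall>\<^sub>F z in nhds p. f z = 0"
proof -
  obtain r where r: "r > 0" "ball p r \<subseteq> U" using U openE by blast
  have "f z = 0" if z: "z \<in> ball p r" for z
  proof (cases "z = p")
    case True
    then show ?thesis using flat[of "[]"] by simp
  next
    case False
    define h where "h = z - p"
    \<comment> \<open>The line p + t h stays in the ball for |t| < R, and R > 1 brings z, at t = 1,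
      into reach.\<close>
    define R where "R = r / norm h"
    have h: "norm h > 0" "norm h < r" using False z by (auto simp: h_def dist_norm norm_minus_commute)
    have R: "R > 1" using h by (simp add: R_def)
    have inU: "p + t *s h \<in> U" if "t \<in> ball 0 R" for t
    proof -
      have "norm (t *s h) < r" using that h by (simp add: norm_vec_scale R_def pos_less_divide_eq)
      then show ?thesis using r by (auto simp: dist_norm)
    qed
    let ?g = "\<lambda>f t. f (p + t *s h)"
    have der: "(?g F has_field_derivative (\<Sum>k\<in>UNIV. h $ k * dZ F (p + t *s h) k)) (at t)"
      if "holo_fun_on F U" "t \<in> ball 0 R" for F t
      using holo_fun_on_line[OF that(1) inU[OF that(2)]]
      by (simp add: holo_fun_on_frechet_sum[OF that(1) inU[OF that(2)]])
    have hol: "?g F holomorphic_on ball 0 R" if "holo_fun_on F U" for F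
      unfolding holomorphic_on_open[OF open_ball] using der[OF that] by blast
    \<comment> \<open>All words \<open>ks\<close> at once, since each derivative in t adds a
      letter.\<close>
    have "(deriv ^^ n) (?g (dZs ks f)) 0 = 0" for n ks
    proof (induction n arbitrary: ks)
      case 0
      then show ?case using flat by simp
    next
      case (Suc n)
      let ?F = "dZs ks f"
      have hF: "holo_fun_on (dZs ks f) U" for ks by (rule holo_fun_on_dZs[OF f U(1)])
      have R0: "(0::complex) \<in> ball 0 R" using R by simp
      have "(deriv ^^ Suc n) (?g ?F) 0 = (deriv ^^ n) (deriv (?g ?F)) 0"
        by (simp only: funpow_Suc_right o_apply)
      also have "\<dots> = (deriv ^^ n) (\<lambda>t. \<Sum>k\<in>UNIV. h $ k * ?g (dZs (k # ks) f) t) 0"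
      proof (rule higher_deriv_transform_within_open[OF _ _ open_ball R0])
        show "deriv (?g ?F) holomorphic_on ball 0 R" by (intro holomorphic_deriv hol hF) simp
        show "(\<lambda>t. \<Sum>k\<in>UNIV. h $ k * ?g (dZs (k # ks) f) t) holomorphic_on ball 0 R"
          by (intro holomorphic_intros hol hF)
        show "deriv (?g ?F) t = (\<Sum>k\<in>UNIV. h $ k * ?g (dZs (k # ks) f) t)" if "t \<in> ball 0 R" for t
          using DERIV_imp_deriv[OF der[OF hF that]] by simp
      qed
      also have "\<dots> = (\<Sum>k\<in>UNIV. h $ k * (deriv ^^ n) (?g (dZs (k # ks) f)) 0)"
      proof -
        have "(deriv ^^ n) (\<lambda>t. \<Sum>k\<in>A. h $ k * ?g (dZs (k # ks) f) t) 0
            = (\<Sum>k\<in>A. h $ k * (deriv ^^ n) (?g (dZs (k # ks) f)) 0)" if "finite A" for A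
          using that
        proof (induction A rule: finite_induct)
          case empty
          then show ?case by simp
        next
          case (insert a A)
          have "(deriv ^^ n) (\<lambda>t. h $ a * ?g (dZs (a # ks) f) t + (\<Sum>k\<in>A. h $ k * ?g (dZs (k # ks) f) t)) 0
              = (deriv ^^ n) (\<lambda>t. h $ a * ?g (dZs (a # ks) f) t) 0
                + (deriv ^^ n) (\<lambda>t. \<Sum>k\<in>A. h $ k * ?g (dZs (k # ks) f) t) 0"
            by (rule higher_deriv_add[OF _ _ open_ball R0])
              (intro holomorphic_on_sum holomorphic_on_mult holomorphic_on_const hol[OF hF])+
          also have "(deriv ^^ n) (\<lambda>t. h $ a * ?g (dZs (a # ks) f) t) 0
              = h $ a * (deriv ^^ n) (?g (dZs (a # ks) f)) 0"
            by (rule higher_deriv_cmult[OF hol[OF hF] R0 open_ball])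
          finally show ?case using insert by simp
        qed
        then show ?thesis by simp
      qed
      finally show ?case using Suc.IH by (simp del: dZs.simps)
    qed
    from this[of _ "[]"] have "(deriv ^^ n) (?g f) 0 = 0" for n by simp
    moreover have "(1::complex) \<in> ball 0 R" using R by simp
    ultimately have "?g f 1 = 0" using holomorphic_fun_eq_0_on_ball[OF hol[OF f]] by blast
    then show ?thesis by (simp add: h_def)
  qed
  moreover have "\<forall>\<^sub>F z in nhds p. z \<in> ball p r" using r by (intro eventually_nhds_in_open) auto
  ultimately show ?thesis by (auto elim: eventually_mono)
qed

section \<open>Wedge products and determinants\<close>

text \<open>The codimension d is a number and not a type, so d-by-d determinants use matrices whose
  size is a term, while the Jacobian keeps the type-indexed determinant.\<close>

lemma wedge_eq_det:
  "wedge d \<alpha> v = Determinant.det (Matrix.mat d d (\<lambda>(j, i). \<alpha> j (v i)))"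
proof -
  have less: "\<sigma> j < d" if "\<sigma> permutes {0..<d}" "j < d" for \<sigma> j
    using permutes_in_image[OF that(1), of j] that(2) by simp
  have "Determinant.det (Matrix.mat d d (\<lambda>(j, i). \<alpha> j (v i)))
      = (\<Sum>\<sigma> | \<sigma> permutes {0..<d}. signof \<sigma> * (\<Prod>j = 0..<d. \<alpha> j (v (\<sigma> j))))"
    unfolding Determinant.det_def by (auto intro!: sum.cong prod.cong simp: less)
  then show ?thesis unfolding wedge_def by (simp add: atLeast0LessThan)
qed

text \<open>\<open>wedge d A (\<lambda>l. l)\<close> is det A, the rows of A being read as forms on
  the index set; the claim is multiplicativity of the determinant.\<close>

lemma wedge_mult:
  assumes "\<And>j i. j < d \<Longrightarrow> i < d \<Longrightarrow> \<beta> j (v i) = (\<Sum>l<d. A j l * \<alpha> l (v i))"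
  shows "wedge d \<beta> v = wedge d A (\<lambda>l. l) * wedge d \<alpha> v"
proof -
  let ?A = "Matrix.mat d d (\<lambda>(j, l). A j l)" and ?B = "Matrix.mat d d (\<lambda>(j, i). \<alpha> j (v i))"
  have "Matrix.mat d d (\<lambda>(j, i). \<beta> j (v i)) = ?A * ?B"
    by (rule eq_matI) (auto simp: assms scalar_prod_def atLeast0LessThan)
  then show ?thesis unfolding wedge_eq_det by (simp add: det_mult[of _ d])
qed

text \<open>The inverse is the adjugate over the determinant, written entrywise so that no matrix
  type is left in the statement.\<close>

lemma wedge_inverse:
  assumes "wedge d \<alpha> v \<noteq> 0"
  obtains B where "\<And>j k. j < d \<Longrightarrow> k < d \<Longrightarrow> (\<Sum>i<d. \<alpha> j (v i) * B i k) = (if j = k then 1 else 0)"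
    and "\<And>j k. j < d \<Longrightarrow> k < d \<Longrightarrow> (\<Sum>i<d. B j i * \<alpha> i (v k)) = (if j = k then 1 else 0)"
proof -
  let ?A = "Matrix.mat d d (\<lambda>(j, i). \<alpha> j (v i))"
  let ?D = "Determinant.det ?A"
  have A: "?A \<in> carrier_mat d d" by simp
  have D: "?D \<noteq> 0" using assms by (simp add: wedge_eq_det)
  define B where "B i k = adj_mat ?A $$ (i, k) / ?D" for i k
  note adj = adj_mat[OF A]
  show ?thesis
  proof
    fix j k assume jk: "j < d" "k < d"
    have "(?A * adj_mat ?A) $$ (j, k) = (\<Sum>i<d. \<alpha> j (v i) * adj_mat ?A $$ (i, k))"
      using jk adj(1) by (auto simp: scalar_prod_def atLeast0LessThan)
    then have "(\<Sum>i<d. \<alpha> j (v i) * adj_mat ?A $$ (i, k)) = ?D * (if j = k then 1 else 0)"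
      unfolding adj(2) using jk by simp
    then show "(\<Sum>i<d. \<alpha> j (v i) * B i k) = (if j = k then 1 else 0)"
      using D by (simp add: B_def sum_divide_distrib[symmetric])
    have "(adj_mat ?A * ?A) $$ (j, k) = (\<Sum>i<d. adj_mat ?A $$ (j, i) * \<alpha> i (v k))"
      using jk adj(1) by (auto simp: scalar_prod_def atLeast0LessThan)
    then have "(\<Sum>i<d. adj_mat ?A $$ (j, i) * \<alpha> i (v k)) = ?D * (if j = k then 1 else 0)"
      unfolding adj(3) using jk by simp
    then show "(\<Sum>i<d. B j i * \<alpha> i (v k)) = (if j = k then 1 else 0)"
      using D by (simp add: B_def sum_divide_distrib[symmetric])
  qed
qed

lemma wedge_solve:
  assumes "wedge d \<alpha> v \<noteq> 0"
  obtains c where "\<And>j. j < d \<Longrightarrow> (\<Sum>i<d. c i * \<alpha> j (v i)) = b j"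
proof -
  obtain B where B: "\<And>j k. j < d \<Longrightarrow> k < d \<Longrightarrow> (\<Sum>i<d. \<alpha> j (v i) * B i k) = (if j = k then 1 else 0)"
    using wedge_inverse[OF assms] by metis
  show ?thesis
  proof (rule that[of "\<lambda>i. \<Sum>k<d. B i k * b k"])
    fix j assume j: "j < d"
    have "(\<Sum>i<d. (\<Sum>k<d. B i k * b k) * \<alpha> j (v i)) = (\<Sum>k<d. (\<Sum>i<d. \<alpha> j (v i) * B i k) * b k)"
      by (simp add: sum_distrib_right sum_distrib_left mult_ac) (rule sum.swap)
    also have "\<dots> = (\<Sum>k<d. (if j = k then 1 else 0) * b k)"
      by (intro sum.cong refl) (simp add: B j)
    also have "\<dots> = b j" using j by (simp add: if_distrib[of "\<lambda>x. x * _"] cong: if_cong)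
    finally show "(\<Sum>i<d. (\<Sum>k<d. B i k * b k) * \<alpha> j (v i)) = b j" .
  qed
qed

lemma wedge_kernel:
  assumes "wedge d A (\<lambda>l. l) \<noteq> 0" and x: "\<And>j. j < d \<Longrightarrow> (\<Sum>l<d. A j l * x l) = 0" and "l < d"
  shows "x l = 0"
proof -
  obtain B where B: "\<And>j k. j < d \<Longrightarrow> k < d \<Longrightarrow> (\<Sum>i<d. B j i * A i k) = (if j = k then 1 else 0)"
    using wedge_inverse[OF assms(1)] by metis
  have "x l = (\<Sum>k<d. (if l = k then 1 else 0) * x k)"
    using \<open>l < d\<close> by (simp add: if_distrib[of "\<lambda>x. x * _"] cong: if_cong)
  also have "\<dots> = (\<Sum>k<d. (\<Sum>i<d. B l i * A i k) * x k)"
    by (intro sum.cong refl) (simp add: B \<open>l < d\<close>)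
  also have "\<dots> = (\<Sum>i<d. B l i * (\<Sum>k<d. A i k * x k))"
    by (simp add: sum_distrib_right sum_distrib_left mult_ac) (rule sum.swap)
  also have "\<dots> = 0" by (simp add: x)
  finally show ?thesis .
qed

lemma wedge_scale_right:
  assumes "\<And>j i. j < d \<Longrightarrow> i < d \<Longrightarrow> \<alpha> j (w i) = c * \<beta> j (v i)"
  shows "wedge d \<alpha> w = c ^ d * wedge d \<beta> v"
  unfolding wedge_def sum_distrib_left
proof (intro sum.cong refl)
  fix \<sigma> assume \<sigma>: "\<sigma> \<in> {\<sigma>. \<sigma> permutes {..<d}}"
  have "(\<Prod>j<d. \<alpha> j (w (\<sigma> j))) = (\<Prod>j<d. c * \<beta> j (v (\<sigma> j)))"
    using \<sigma> permutes_in_image[of \<sigma> "{..<d}"] by (intro prod.cong refl assms) auto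
  then show "of_int (sign \<sigma>) * (\<Prod>j<d. \<alpha> j (w (\<sigma> j))) = c ^ d * (of_int (sign \<sigma>) * (\<Prod>j<d. \<beta> j (v (\<sigma> j))))"
    by (simp add: prod.distrib)
qed

lemma wedge_cong:
  assumes "\<And>j i. j < d \<Longrightarrow> i < d \<Longrightarrow> \<alpha> j (w i) = \<beta> j (v i)"
  shows "wedge d \<alpha> w = wedge d \<beta> v"
  using wedge_scale_right[of d \<alpha> w 1 \<beta> v] assms by simp

text \<open>Source of the reality of \<delta> on M.\<close>

lemma wedge_of_real_Reals: "wedge d (\<lambda>j l. of_real (A j l)) (\<lambda>l. l) \<in> \<real>"
  unfolding wedge_def by (intro sum_in_Reals Reals_mult) (auto intro!: prod_in_Reals)

section \<open>Tangent vectors\<close>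

lemma linear_axis_sum:
  fixes F :: "complex^'n \<Rightarrow> 'b::real_vector"
  assumes "linear F"
  shows "F v = (\<Sum>k\<in>UNIV. Re (v $ k) *\<^sub>R F (axis k 1) + Im (v $ k) *\<^sub>R F (axis k \<i>))"
proof -
  have "v = (\<Sum>k\<in>UNIV. Re (v $ k) *\<^sub>R axis k 1 + Im (v $ k) *\<^sub>R axis k \<i>)"
  proof (rule vec_eq_iff[THEN iffD2], intro allI)
    fix i
    have "(\<Sum>k\<in>UNIV. Re (v $ k) *\<^sub>R axis k 1 + Im (v $ k) *\<^sub>R axis k \<i>) $ i
        = (\<Sum>k\<in>UNIV. if k = i then v $ k else 0)"
      unfolding sum_component
      by (intro sum.cong refl) (auto simp: axis_def complex_eq_iff)
    then show "v $ i = (\<Sum>k\<in>UNIV. Re (v $ k) *\<^sub>R axis k 1 + Im (v $ k) *\<^sub>R axis k \<i>) $ i" by simp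
  qed
  then have "F v = F (\<Sum>k\<in>UNIV. Re (v $ k) *\<^sub>R axis k 1 + Im (v $ k) *\<^sub>R axis k \<i>)" by simp
  then show ?thesis by (simp add: linear_sum[OF assms] linear_add[OF assms] linear_cmul[OF assms])
qed

text \<open>Since a \<partial>/\<partial>Z + b \<partial>/\<partial>conj Z equals (a+b)/2
  \<partial>/\<partial>x + i(b-a)/2 \<partial>/\<partial>y, \<open>ctv_re\<close> and
  \<open>ctv_im\<close> are the real and imaginary parts as real tangent vectors. They reduce the
  action on functions to Frechet derivatives.\<close>

definition ctv_re :: "'n::finite ctv \<Rightarrow> complex^'n" where
  "ctv_re X = (\<chi> k. Complex (Re ((fst X $ k + snd X $ k) / 2)) (Re (\<i> * (snd X $ k - fst X $ k) / 2)))"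

definition ctv_im :: "'n::finite ctv \<Rightarrow> complex^'n" where
  "ctv_im X = (\<chi> k. Complex (Im ((fst X $ k + snd X $ k) / 2)) (Im (\<i> * (snd X $ k - fst X $ k) / 2)))"

lemma ctv_apply_frechet:
  fixes f :: "complex^'n \<Rightarrow> complex"
  assumes "(f has_derivative F) (at z)"
  shows "ctv_apply X f z = F (ctv_re X) + \<i> * F (ctv_im X)"
proof -
  have lin: "linear F" using assms has_derivative_linear by blast
  have "F (ctv_re X) + \<i> * F (ctv_im X) = (\<Sum>k\<in>UNIV. fst X $ k * dZ f z k + snd X $ k * dZbar f z k)"
    unfolding linear_axis_sum[OF lin, of "ctv_re X"] linear_axis_sum[OF lin, of "ctv_im X"]
      sum_distrib_left sum.distrib[symmetric]
  proof (intro sum.cong refl)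
    fix k
    let ?a = "fst X $ k" and ?b = "snd X $ k"
    have *: "of_real (Re u) + \<i> * of_real (Im u) = u" for u by (simp add: complex_eq_iff)
    have "Re (ctv_re X $ k) *\<^sub>R F (axis k 1) + Im (ctv_re X $ k) *\<^sub>R F (axis k \<i>)
        + \<i> * (Re (ctv_im X $ k) *\<^sub>R F (axis k 1) + Im (ctv_im X $ k) *\<^sub>R F (axis k \<i>))
      = (of_real (Re ((?a + ?b) / 2)) + \<i> * of_real (Im ((?a + ?b) / 2))) * F (axis k 1)
        + (of_real (Re (\<i> * (?b - ?a) / 2)) + \<i> * of_real (Im (\<i> * (?b - ?a) / 2))) * F (axis k \<i>)"
      by (simp add: ctv_re_def ctv_im_def scaleR_conv_of_real algebra_simps del: Re_divide_numeral Im_divide_numeral)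
    also have "\<dots> = (?a + ?b) / 2 * F (axis k 1) + \<i> * (?b - ?a) / 2 * F (axis k \<i>)"
      by (simp only: *)
    also have "\<dots> = ?a * dZ f z k + ?b * dZbar f z k"
      unfolding dZ_def dZbar_def frechet_derivative_eq[OF assms] by (simp add: field_simps)
    finally show "Re (ctv_re X $ k) *\<^sub>R F (axis k 1) + Im (ctv_re X $ k) *\<^sub>R F (axis k \<i>)
        + \<i> * (Re (ctv_im X $ k) *\<^sub>R F (axis k 1) + Im (ctv_im X $ k) *\<^sub>R F (axis k \<i>))
      = ?a * dZ f z k + ?b * dZbar f z k" .
  qed
  then show ?thesis by (simp add: ctv_apply_def)
qed

lemma of_real_has_derivative:
  "(r has_derivative R) (at z) \<Longrightarrow> ((\<lambda>w. complex_of_real (r w)) has_derivative (\<lambda>h. of_real (R h))) (at z)"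
  by (rule bounded_linear.has_derivative[OF bounded_linear_of_real])

lemma ctv_apply_of_real_eq_0:
  assumes "(r has_derivative R) (at z)"
  shows "ctv_apply X (\<lambda>w. complex_of_real (r w)) z = 0 \<longleftrightarrow> R (ctv_re X) = 0 \<and> R (ctv_im X) = 0"
  unfolding ctv_apply_frechet[OF of_real_has_derivative[OF assms]] by (simp add: complex_eq_iff)

lemma ctv_apply_add:
  assumes "f differentiable (at z)" "g differentiable (at z)"
  shows "ctv_apply X (\<lambda>w. f w + g w) z = ctv_apply X f z + ctv_apply X g z"
proof -
  obtain F G where "(f has_derivative F) (at z)" "(g has_derivative G) (at z)"
    using assms by (auto simp: differentiable_def)
  then show ?thesis
    using ctv_apply_frechet[OF has_derivative_add, of f F z g G X]
    by (simp add: ctv_apply_frechet algebra_simps)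
qed

lemma ctv_apply_mult:
  assumes "f differentiable (at z)" "g differentiable (at z)"
  shows "ctv_apply X (\<lambda>w. f w * g w) z = ctv_apply X f z * g z + f z * ctv_apply X g z"
proof -
  obtain F G where "(f has_derivative F) (at z)" "(g has_derivative G) (at z)"
    using assms by (auto simp: differentiable_def)
  then show ?thesis
    using ctv_apply_frechet[OF has_derivative_mult, of f F z g G X]
    by (simp add: ctv_apply_frechet algebra_simps)
qed

lemma ctv_apply_const: "ctv_apply X (\<lambda>_. c) z = 0"
  by (subst ctv_apply_frechet[OF has_derivative_const]) simp

lemma ctv_apply_diff:
  assumes "f differentiable (at z)" "g differentiable (at z)"
  shows "ctv_apply X (\<lambda>w. f w - g w) z = ctv_apply X f z - ctv_apply X g z"
proof -
  obtain F G where "(f has_derivative F) (at z)" "(g has_derivative G) (at z)"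
    using assms by (auto simp: differentiable_def)
  then show ?thesis
    using ctv_apply_frechet[OF has_derivative_diff, of f F z g G X]
    by (simp add: ctv_apply_frechet algebra_simps)
qed

lemma ctv_apply_vec_add: "ctv_apply (X + Y) f z = ctv_apply X f z + ctv_apply Y f z"
  by (simp add: ctv_apply_def algebra_simps sum.distrib)

lemma ctv_apply_scale: "ctv_apply (ctv_scale c X) f z = c * ctv_apply X f z"
  by (simp add: ctv_apply_def ctv_scale_def algebra_simps sum_distrib_left)

lemma dZ_cnj:
  assumes "f differentiable (at z)"
  shows "dZ (\<lambda>w. cnj (f w)) z k = cnj (dZbar f z k)" "dZbar (\<lambda>w. cnj (f w)) z k = cnj (dZ f z k)"
proof -
  obtain F where F: "(f has_derivative F) (at z)" using assms by (auto simp: differentiable_def)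
  have "((\<lambda>w. cnj (f w)) has_derivative (\<lambda>h. cnj (F h))) (at z)"
    by (rule bounded_linear.has_derivative[OF bounded_linear_cnj F])
  then show "dZ (\<lambda>w. cnj (f w)) z k = cnj (dZbar f z k)" "dZbar (\<lambda>w. cnj (f w)) z k = cnj (dZ f z k)"
    by (simp_all add: dZ_def dZbar_def frechet_derivative_eq[OF F] frechet_derivative_eq)
qed

lemma ctv_apply_cnj:
  assumes "f differentiable (at z)"
  shows "ctv_apply (ctv_cnj X) (\<lambda>w. cnj (f w)) z = cnj (ctv_apply X f z)"
  by (simp add: ctv_apply_def ctv_cnj_def dZ_cnj[OF assms] add.commute)

lemma ctv_cnj_cnj [simp]: "ctv_cnj (ctv_cnj X) = X"
  by (cases X) (simp add: ctv_cnj_def)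

lemma smooth_at_dZ:
  assumes "smooth_at p f"
  shows "smooth_at p (\<lambda>z. dZ f z k)" "smooth_at p (\<lambda>z. dZbar f z k)"
  unfolding dZ_def dZbar_def using smooth_at_frechet[OF assms]
  by (auto intro!: smooth_at_divide smooth_at_diff smooth_at_add smooth_at_mult smooth_at_const)

lemma smooth_at_vec_nth: "smooth_at p f \<Longrightarrow> smooth_at p (\<lambda>z. f z $ k)"
  by (rule smooth_at_linear[OF bounded_linear_vec_nth])

lemma smooth_at_coeff:
  assumes "smooth_at p X"
  shows "smooth_at p (\<lambda>z. fst (X z) $ k)" "smooth_at p (\<lambda>z. snd (X z) $ k)"
  using assms smooth_at_vec_nth smooth_at_linear[OF bounded_linear_fst] smooth_at_linear[OF bounded_linear_snd]
  by blast+

lemma smooth_at_cnj: "smooth_at p f \<Longrightarrow> smooth_at p (\<lambda>z. cnj (f z))"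
  by (rule smooth_at_linear[OF bounded_linear_cnj])

lemma smooth_at_of_real: "smooth_at p f \<Longrightarrow> smooth_at p (\<lambda>z. complex_of_real (f z))"
  by (rule smooth_at_linear[OF bounded_linear_of_real])

lemma smooth_at_ctv_apply:
  assumes "smooth_at p X" "smooth_at p f"
  shows "smooth_at p (\<lambda>z. ctv_apply (X z) f z)"
  unfolding ctv_apply_def using assms
  by (auto intro!: smooth_at_sum smooth_at_add smooth_at_mult smooth_at_dZ smooth_at_coeff)

lemma smooth_at_vec_scale: "smooth_at p f \<Longrightarrow> smooth_at p (\<lambda>z. f z *s (v::complex^'n))"
  by (rule smooth_at_linear[OF bounded_linear_vec_scale])

lemma smooth_at_vecI:
  fixes f :: "'a::euclidean_space \<Rightarrow> complex^'n"
  assumes "\<And>k. smooth_at p (\<lambda>z. f z $ k)" shows "smooth_at p f"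
proof -
  have "smooth_at p (\<lambda>z. \<Sum>k\<in>UNIV. f z $ k *s axis k 1)"
    by (intro smooth_at_sum smooth_at_vec_scale assms) simp
  then show ?thesis by (simp only: vec_eq_sum_axis[symmetric])
qed

lemma smooth_at_PairI:
  assumes "smooth_at p f" "smooth_at p g" shows "smooth_at p (\<lambda>z. (f z, g z))"
proof -
  have "bounded_linear (\<lambda>x::'b. (x, 0::'c))" "bounded_linear (\<lambda>y::'c. (0::'b, y))"
    by (auto intro!: bounded_linear_Pair bounded_linear_zero bounded_linear_ident)
  then have "smooth_at p (\<lambda>z. (f z, 0) + (0, g z))"
    using assms by (intro smooth_at_add) (auto intro: smooth_at_linear[of "\<lambda>x. (x, 0)"] smooth_at_linear[of "\<lambda>y. (0, y)"])
  then show ?thesis by simp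
qed

lemma smooth_at_ctvI:
  fixes X :: "'a::euclidean_space \<Rightarrow> 'n::finite ctv"
  assumes "\<And>k. smooth_at p (\<lambda>z. fst (X z) $ k)" "\<And>k. smooth_at p (\<lambda>z. snd (X z) $ k)"
  shows "smooth_at p X"
proof -
  have "smooth_at p (\<lambda>z. fst (X z))" "smooth_at p (\<lambda>z. snd (X z))" by (intro smooth_at_vecI assms)+
  then have "smooth_at p (\<lambda>z. (fst (X z), snd (X z)))" by (rule smooth_at_PairI)
  then show ?thesis by simp
qed

section \<open>The forms \<partial>\<rho> and functions vanishing on M\<close>

lemma del_form_scale: "del_form r z (c *s v) = c * del_form r z v"
  by (simp add: del_form_def sum_distrib_left mult_ac)

lemma del_form_add: "del_form r z (v + w) = del_form r z v + del_form r z w"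
  by (simp add: del_form_def algebra_simps sum.distrib)

lemma del_form_sum: "del_form r z (\<Sum>i\<in>A. c i *s v i) = (\<Sum>i\<in>A. c i * del_form r z (v i))"
  by (induction A rule: infinite_finite_induct)
    (auto simp: del_form_add del_form_scale, auto simp: del_form_def)

lemma ctv_apply_T10: "ctv_apply (v, 0) (\<lambda>w. complex_of_real (r w)) z = del_form r z v"
  by (simp add: ctv_apply_def del_form_def mult.commute)

lemma ctv_re_T10: "ctv_re (v, 0) = (1/2) *\<^sub>R v" and ctv_im_T10: "ctv_im (v, 0) = - (1/2) *\<^sub>R (\<i> *s v)"
  by (auto simp: ctv_re_def ctv_im_def vec_eq_iff complex_eq_iff)

lemma del_form_frechet:
  assumes "(r has_derivative R) (at z)"
  shows "del_form r z v = (of_real (R v) - \<i> * of_real (R (\<i> *s v))) / 2"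
proof -
  have "linear R" using assms has_derivative_linear by blast
  then show ?thesis
    unfolding ctv_apply_T10[symmetric] ctv_apply_frechet[OF of_real_has_derivative[OF assms]] ctv_re_T10 ctv_im_T10
    by (simp add: linear_cmul linear_neg)
qed

lemma frechet_del_form:
  assumes "(r has_derivative R) (at z)"
  shows "R v = 2 * Re (del_form r z v)"
  unfolding del_form_frechet[OF assms] by simp

lemma defining_has_derivative:
  assumes "local_defining_function d M p U \<rho>" "j < d" "z \<in> U"
  shows "(\<rho> j has_derivative frechet_derivative (\<rho> j) (at z)) (at z)"
  using assms by (intro smooth_on_has_derivative[of _ U]) (auto simp: local_defining_function_def)

lemma defining_smooth_at:
  assumes "local_defining_function d M p U \<rho>" "j < d" "z \<in> U"
  shows "smooth_at z (\<rho> j)"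
  using assms by (intro smooth_atI[of U]) (auto simp: local_defining_function_def)

text \<open>Genericity enters here: the forms \<partial>\<rho>_j are independent over the complex
  numbers, so their values on a (1,0)-vector can be prescribed.\<close>

lemma defining_del_solve:
  assumes "local_defining_function d M p U \<rho>" "z \<in> U"
  obtains y where "\<And>j. j < d \<Longrightarrow> del_form (\<rho> j) z y = b j"
proof -
  have "wedge d (\<lambda>j. del_form (\<rho> j) z) \<noteq> (\<lambda>v. 0)"
    using assms by (auto simp: local_defining_function_def)
  then obtain v where "wedge d (\<lambda>j. del_form (\<rho> j) z) v \<noteq> 0" by fast
  from wedge_solve[OF this, where b = b]
  obtain c where c: "\<And>j. j < d \<Longrightarrow> (\<Sum>i<d. c i * del_form (\<rho> j) z (v i)) = b j" by blast
  show ?thesis by (rule that[of "\<Sum>i<d. c i *s v i"]) (simp add: del_form_sum c)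
qed

lemma defining_dual_basis:
  assumes ldf: "local_defining_function d M p U \<rho>" and z: "z \<in> U"
  obtains e where "\<And>j l. j < d \<Longrightarrow> l < d \<Longrightarrow> frechet_derivative (\<rho> j) (at z) (e l) = (if j = l then 1 else 0)"
proof -
  \<comment> \<open>The value 1/2 compensates the factor in D\<rho> = 2 Re \<partial>\<rho>.\<close>
  have "\<exists>y. \<forall>j<d. del_form (\<rho> j) z y = (if j = l then 1 / 2 else 0)" for l
    using defining_del_solve[OF ldf z, of "\<lambda>j. if j = l then 1 / 2 else 0"] by metis
  then obtain e where e: "\<And>l j. j < d \<Longrightarrow> del_form (\<rho> j) z (e l) = (if j = l then 1 / 2 else 0)"
    by metis
  show ?thesis
    by (rule that[of e]) (simp add: frechet_del_form[OF defining_has_derivative[OF ldf _ z]] e)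
qed

text \<open>If \<open>D g v \<noteq> 0\<close>, then \<open>w \<mapsto> (\<rho> w, g w)\<close> is open at \<open>z\<close>, so it takes a value \<open>(0, t)\<close> with
  \<open>t \<noteq> 0\<close>. To stay in one space, the map is completed to \<open>\<Psi>\<close> with derivative the identity.\<close>

lemma tangent_kills_vanishing_real:
  fixes g :: "complex^'n \<Rightarrow> real"
  assumes ldf: "local_defining_function d M p U \<rho>" and z: "z \<in> M" "z \<in> U"
    and g: "smooth_at z g" and g0: "\<forall>\<^sub>F w in nhds z. w \<in> M \<longrightarrow> g w = 0"
    and v: "\<And>j. j < d \<Longrightarrow> frechet_derivative (\<rho> j) (at z) v = 0"
  shows "frechet_derivative g (at z) v = 0"
proof (rule ccontr)
  assume nz: "frechet_derivative g (at z) v \<noteq> 0"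
  let ?R = "\<lambda>j. frechet_derivative (\<rho> j) (at z)" and ?G = "frechet_derivative g (at z)"
  have dR: "(\<rho> j has_derivative ?R j) (at z)" if "j < d" for j
    by (rule defining_has_derivative[OF ldf that z(2)])
  have dG: "(g has_derivative ?G) (at z)" by (rule smooth_at_has_derivative[OF g])
  have linR: "linear (?R j)" if "j < d" for j using dR[OF that] has_derivative_linear by blast
  have linG: "linear ?G" using dG has_derivative_linear by blast
  \<comment> \<open>\<open>v'\<close> and the vectors \<open>e l\<close> below are dual to the
    differentials of g and of the \<rho>_l.\<close>
  define v' where "v' = (1 / ?G v) *\<^sub>R v"
  have v': "?G v' = 1" "\<And>j. j < d \<Longrightarrow> ?R j v' = 0"
    using nz v by (simp_all add: v'_def linear_cmul[OF linG] linear_cmul[OF linR])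
  obtain e0 where e0: "\<And>j l. j < d \<Longrightarrow> l < d \<Longrightarrow> ?R j (e0 l) = (if j = l then 1 else 0)"
    using defining_dual_basis[OF ldf z(2)] by metis
  define e where "e l = e0 l - ?G (e0 l) *\<^sub>R v'" for l
  have eR: "?R j (e l) = (if j = l then 1 else 0)" if "j < d" "l < d" for j l
    using that by (simp add: e_def linear_diff[OF linR] linear_cmul[OF linR] e0 v')
  have eG: "?G (e l) = 0" for l
    by (simp add: e_def linear_diff[OF linG] linear_cmul[OF linG] v')
  \<comment> \<open>The linear parts of \<rho>_l and g are exchanged for the functions themselves:
    D\<rho>_j and Dg at z, applied to \<Psi> w - z, return \<rho>_j w and g w.\<close>
  define \<Psi> where "\<Psi> w = w + (\<Sum>l<d. (\<rho> l w - ?R l (w - z)) *\<^sub>R e l) + (g w - ?G (w - z)) *\<^sub>R v'" for w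
  have d\<Psi>: "(\<Psi> has_derivative (\<lambda>h. h)) (at z)"
  proof -
    have s: "((\<lambda>w. w - z) has_derivative (\<lambda>h. h)) (at z)" by (auto intro!: derivative_eq_intros)
    have 1: "((\<lambda>w. ?R l (w - z)) has_derivative ?R l) (at z)" if "l < d" for l
      using bounded_linear.has_derivative[OF has_derivative_bounded_linear[OF dR[OF that]] s] .
    have 2: "((\<lambda>w. ?G (w - z)) has_derivative ?G) (at z)"
      using bounded_linear.has_derivative[OF has_derivative_bounded_linear[OF dG] s] .
    have "(\<Psi> has_derivative (\<lambda>h. h + (\<Sum>l<d. (?R l h - ?R l h) *\<^sub>R e l) + (?G h - ?G h) *\<^sub>R v')) (at z)"
      unfolding \<Psi>_def
      by (intro has_derivative_add has_derivative_sum has_derivative_scaleR_left has_derivative_diff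
          has_derivative_ident dR dG 1 2) auto
    then show ?thesis by simp
  qed
  obtain V where V: "open V" "z \<in> V" "smooth_on g V" using g by (rule smooth_atE)
  obtain W where W: "open W" "z \<in> W" "\<forall>w\<in>W. w \<in> M \<longrightarrow> g w = 0" using g0 by (auto simp: eventually_nhds)
  have U: "open U" "M \<inter> U = {z \<in> U. \<forall>j<d. \<rho> j z = 0}" "\<And>j. j < d \<Longrightarrow> smooth_on (\<rho> j) U"
    using ldf by (auto simp: local_defining_function_def)
  have \<rho>0: "\<rho> j z = 0" if "j < d" for j using U(2) z that by blast
  have g00: "g z = 0" using W z by blast
  let ?S = "U \<inter> V \<inter> W"
  have S: "open ?S" "z \<in> ?S" using U V W z by auto
  have c\<rho>: "continuous_on ?S (\<rho> j)" if "j < d" for j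
    using U(3)[OF that] Ck_on_imp_continuous_on[of 0 "\<rho> j" U] by (auto simp: smooth_on_def intro: continuous_on_subset)
  have cg: "continuous_on ?S g"
    using V(3) Ck_on_imp_continuous_on[of 0 g V] by (auto simp: smooth_on_def intro: continuous_on_subset)
  have "continuous_on ?S \<Psi>"
    unfolding \<Psi>_def
    by (intro continuous_on_add continuous_on_sum continuous_on_scaleR continuous_on_diff c\<rho> cg
        continuous_on_id continuous_on_const
        bounded_linear.continuous_on[OF has_derivative_bounded_linear[OF dR]]
        bounded_linear.continuous_on[OF has_derivative_bounded_linear[OF dG]]) auto
  moreover have "z \<in> interior ?S" using S interior_open by blast
  ultimately have "\<Psi> z \<in> interior (\<Psi> ` ?S)"
    using S d\<Psi> sussmann_open_mapping[of ?S \<Psi> z "\<lambda>h. h" "\<lambda>h. h" ?S] bounded_linear_ident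
    by (auto simp: o_def id_def)
  moreover have "\<Psi> z = z"
    by (simp add: \<Psi>_def \<rho>0 g00 linear_0[OF linR] linear_0[OF linG])
  ultimately obtain r where r: "r > 0" "ball z r \<subseteq> \<Psi> ` ?S" by (auto simp: mem_interior)
  \<comment> \<open>Small enough for z + t v' to lie in the ball. The point w over it then satisfies
    \<rho>_j w = 0 for all j but g w = t.\<close>
  define t where "t = r / (2 * (norm v' + 1))"
  have t: "t > 0" using r by (simp add: t_def add_nonneg_pos)
  have "norm v' / (norm v' + 1) \<le> 1" by (simp add: divide_le_eq_1 add_nonneg_pos)
  then have half: "r / 2 * (norm v' / (norm v' + 1)) \<le> r / 2 * 1" using r by (intro mult_left_mono) auto
  have "norm (t *\<^sub>R v') = r / 2 * (norm v' / (norm v' + 1))"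
    using r t by (simp add: t_def)
  also note half
  also have "r / 2 * 1 < r" using r by simp
  finally have "norm (t *\<^sub>R v') < r" .
  then have "z + t *\<^sub>R v' \<in> ball z r" by (simp add: dist_norm)
  then obtain w where w: "w \<in> ?S" "\<Psi> w = z + t *\<^sub>R v'" using r(2) by (metis (no_types, lifting) imageE subsetD)
  then have eq: "(w - z) + (\<Sum>l<d. (\<rho> l w - ?R l (w - z)) *\<^sub>R e l) + (g w - ?G (w - z)) *\<^sub>R v' = t *\<^sub>R v'"
    unfolding \<Psi>_def by (simp add: algebra_simps)
  have "\<rho> j w = 0" if j: "j < d" for j
  proof -
    have "?R j (w - z) + (\<Sum>l<d. (\<rho> l w - ?R l (w - z)) * ?R j (e l)) + (g w - ?G (w - z)) * ?R j v' = t * ?R j v'"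
      using arg_cong[OF eq, of "?R j"]
      by (simp only: linear_add[OF linR[OF j]] linear_sum[OF linR[OF j]] linear_cmul[OF linR[OF j]] real_scaleR_def)
    moreover have "(\<Sum>l<d. (\<rho> l w - ?R l (w - z)) * ?R j (e l)) = (\<Sum>l<d. if j = l then \<rho> l w - ?R l (w - z) else 0)"
      by (intro sum.cong refl) (simp add: eR j)
    ultimately show ?thesis using j v'(2) by simp
  qed
  then have "w \<in> M" using U(2) w(1) by blast
  then have "g w = 0" using W(3) w(1) by blast
  moreover have "?G (w - z) + (\<Sum>l<d. (\<rho> l w - ?R l (w - z)) * ?G (e l)) + (g w - ?G (w - z)) * ?G v' = t * ?G v'"
    using arg_cong[OF eq, of ?G]
    by (simp only: linear_add[OF linG] linear_sum[OF linG] linear_cmul[OF linG] real_scaleR_def)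
  ultimately show False using t by (simp add: eG v')
qed

text \<open>Both X and f are split into real and imaginary parts. A consequence is that a tangent
  vector annihilates the components of every defining function, so the choice in
  \<open>ctangent_space\<close> is immaterial.\<close>

lemma ctangent_kills_vanishing:
  fixes f :: "complex^'n \<Rightarrow> complex"
  assumes X: "X \<in> ctangent_space d M z" and z: "z \<in> M"
    and f: "smooth_at z f" and f0: "\<forall>\<^sub>F w in nhds z. w \<in> M \<longrightarrow> f w = 0"
  shows "ctv_apply X f z = 0"
proof -
  obtain U \<rho> where ldf: "local_defining_function d M z U \<rho>"
    and X\<rho>: "\<And>j. j < d \<Longrightarrow> ctv_apply X (\<lambda>w. complex_of_real (\<rho> j w)) z = 0"
    using X by (auto simp: ctangent_space_def)
  have zU: "z \<in> U" using ldf by (simp add: local_defining_function_def)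
  let ?F = "frechet_derivative f (at z)"
  have F: "(f has_derivative ?F) (at z)" by (rule smooth_at_has_derivative[OF f])
  have "?F v = 0" if v: "v \<in> {ctv_re X, ctv_im X}" for v
  proof -
    have v0: "frechet_derivative (\<rho> j) (at z) v = 0" if "j < d" for j
      using X\<rho>[OF that] v ctv_apply_of_real_eq_0[OF defining_has_derivative[OF ldf that zU]] by auto
    have "h (?F v) = 0" if h: "bounded_linear h" for h :: "complex \<Rightarrow> real"
    proof -
      have "frechet_derivative (\<lambda>w. h (f w)) (at z) v = 0"
        using f0 h linear_0[OF bounded_linear.linear[OF h]]
        by (intro tangent_kills_vanishing_real[OF ldf z zU smooth_at_linear[OF h f] _ v0])
          (auto elim: eventually_mono)
      then show ?thesis
        using frechet_derivative_eq[OF bounded_linear.has_derivative[OF h F]] by simp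
    qed
    from this[OF bounded_linear_Re] this[OF bounded_linear_Im] show ?thesis by (simp add: complex_eq_iff)
  qed
  then show ?thesis by (simp add: ctv_apply_frechet[OF F])
qed

text \<open>A differential that annihilates the tangent space is a combination of the D\<rho>_l with
  the real coefficients Dg (e l), for a dual basis e; the (1,0)-part keeps these coefficients. As
  \<open>a\<close> takes g as an argument, one instance yields a whole matrix.\<close>

lemma vanishing_del_form_combination:
  fixes M :: "(complex^'n::finite) set"
  assumes ldf: "local_defining_function d M p U \<rho>" and z: "z \<in> M" "z \<in> U"
  shows "\<exists>a. \<forall>g. smooth_at z g \<and> (\<forall>\<^sub>F w in nhds z. w \<in> M \<longrightarrow> g w = 0) \<longrightarrow>
    (\<forall>v. del_form g z v = (\<Sum>l<d. complex_of_real (a g l) * del_form (\<rho> l) z v))"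
proof -
  let ?R = "\<lambda>j. frechet_derivative (\<rho> j) (at z)"
  have dR: "(\<rho> j has_derivative ?R j) (at z)" if "j < d" for j
    by (rule defining_has_derivative[OF ldf that z(2)])
  have linR: "linear (?R j)" if "j < d" for j using dR[OF that] has_derivative_linear by blast
  obtain e where e: "\<And>j l. j < d \<Longrightarrow> l < d \<Longrightarrow> ?R j (e l) = (if j = l then 1 else 0)"
    using defining_dual_basis[OF ldf z(2)] by metis
  show ?thesis
  proof (intro exI[of _ "\<lambda>g l. frechet_derivative g (at z) (e l)"] allI impI; elim conjE)
    fix g :: "complex^'n \<Rightarrow> real" and v
    assume g: "smooth_at z g" and g0: "\<forall>\<^sub>F w in nhds z. w \<in> M \<longrightarrow> g w = 0"
    let ?G = "frechet_derivative g (at z)"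
    have dG: "(g has_derivative ?G) (at z)" by (rule smooth_at_has_derivative[OF g])
    have linG: "linear ?G" using dG has_derivative_linear by blast
    have G: "?G h = (\<Sum>l<d. ?G (e l) * ?R l h)" for h
    proof -
      have "?G (h - (\<Sum>l<d. ?R l h *\<^sub>R e l)) = 0"
      proof (rule tangent_kills_vanishing_real[OF ldf z g g0])
        fix j assume j: "j < d"
        have "(\<Sum>l<d. ?R l h * ?R j (e l)) = (\<Sum>l<d. if j = l then ?R l h else 0)"
          by (intro sum.cong refl) (simp add: e j)
        then show "?R j (h - (\<Sum>l<d. ?R l h *\<^sub>R e l)) = 0"
          using j by (simp add: linear_diff[OF linR] linear_sum[OF linR] linear_cmul[OF linR])
      qed
      then show ?thesis by (simp add: linear_diff[OF linG] linear_sum[OF linG] linear_cmul[OF linG] mult.commute)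
    qed
    have "del_form g z v = (\<Sum>l<d. of_real (?G (e l)) * ((of_real (?R l v) - \<i> * of_real (?R l (\<i> *s v))) / 2))"
      unfolding del_form_frechet[OF dG] G[of v] G[of "\<i> *s v"]
      by (simp add: sum_distrib_left sum_subtractf[symmetric] sum_divide_distrib algebra_simps)
    also have "\<dots> = (\<Sum>l<d. of_real (?G (e l)) * del_form (\<rho> l) z v)"
      by (intro sum.cong refl) (simp add: del_form_frechet[OF dR])
    finally show "del_form g z v = (\<Sum>l<d. complex_of_real (?G (e l)) * del_form (\<rho> l) z v)" .
  qed
qed

section \<open>Pullback by holomorphic mappings\<close>

definition holo_jacobian :: "(complex^'n::finite \<Rightarrow> complex^'m) \<Rightarrow> complex^'n \<Rightarrow> complex^'n^'m" where
  "holo_jacobian H z = (\<chi> i k. dZ (\<lambda>w. H w $ i) z k)"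

lemma Jac_eq: "Jac H z = det (holo_jacobian H z)"
  by (simp add: Jac_def holo_jacobian_def)

lemma holo_map_has_derivative:
  fixes H :: "complex^'n \<Rightarrow> complex^'m"
  assumes "holo_map_on H U" "z \<in> U"
  shows "(H has_derivative (\<lambda>v. holo_jacobian H z *v v)) (at z)"
proof -
  have *: "((\<lambda>w. H w $ i) has_derivative (\<lambda>v. (holo_jacobian H z *v v) $ i)) (at z)" for i
  proof -
    have hi: "holo_fun_on (\<lambda>w. H w $ i) U" using assms by (simp add: holo_map_on_def)
    have "frechet_derivative (\<lambda>w. H w $ i) (at z) = (\<lambda>v. (holo_jacobian H z *v v) $ i)"
      by (rule ext) (simp add: holo_fun_on_frechet_sum[OF hi assms(2)] holo_jacobian_def
          matrix_vector_mult_def mult.commute)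
    then show ?thesis using holo_fun_on_frechet(1)[OF hi assms(2)] by simp
  qed
  have "((\<lambda>w. \<Sum>i\<in>UNIV. H w $ i *s axis i 1) has_derivative
      (\<lambda>v. \<Sum>i\<in>UNIV. (holo_jacobian H z *v v) $ i *s axis i 1)) (at z)"
    by (intro has_derivative_sum bounded_linear.has_derivative[OF bounded_linear_vec_scale] *)
  then show ?thesis by (simp only: vec_eq_sum_axis[symmetric])
qed

text \<open>The chain rule has this form for \<partial> because the differential of a holomorphic
  map commutes with multiplication by i.\<close>

lemma del_form_compose:
  assumes "holo_map_on H U" "z \<in> U" and r: "smooth_at (H z) r"
  shows "del_form (\<lambda>w. r (H w)) z v = del_form r (H z) (holo_jacobian H z *v v)"
proof -
  let ?R = "frechet_derivative r (at (H z))"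
  have "((\<lambda>w. r (H w)) has_derivative (\<lambda>v. ?R (holo_jacobian H z *v v))) (at z)"
    by (rule has_derivative_compose[OF holo_map_has_derivative[OF assms(1,2)] smooth_at_has_derivative[OF r]])
  moreover have "holo_jacobian H z *v (\<i> *s v) = \<i> *s (holo_jacobian H z *v v)"
    by (simp add: matrix_vector_mult_def vec_eq_iff sum_distrib_left mult_ac)
  ultimately show ?thesis
    by (simp add: del_form_frechet[of "\<lambda>w. r (H w)"] del_form_frechet[OF smooth_at_has_derivative[OF r]])
qed

lemma ctv_push_T10:
  assumes "holo_map_on H U" "z \<in> U"
  shows "ctv_push H z (v, 0) = (holo_jacobian H z *v v, 0)"
proof -
  have "dZ (\<lambda>w. cnj (H w $ i)) z k = 0" for i k
  proof -
    have hi: "holo_fun_on (\<lambda>w. H w $ i) U" using assms by (simp add: holo_map_on_def)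
    then have "(\<lambda>w. H w $ i) differentiable (at z)"
      using holo_fun_on_frechet(1)[OF hi assms(2)] by (auto simp: differentiable_def)
    then show ?thesis using holo_fun_on_dZ(2)[OF hi assms(2)] by (simp add: dZ_cnj)
  qed
  then show ?thesis
    by (simp add: ctv_push_def ctv_apply_def holo_jacobian_def matrix_vector_mult_def vec_eq_iff mult.commute)
qed

section \<open>Vector fields\<close>

definition fieldop :: "(complex^'n::finite \<Rightarrow> 'n ctv) \<Rightarrow> (complex^'n \<Rightarrow> complex) \<Rightarrow> complex^'n \<Rightarrow> complex" where
  "fieldop X f = (\<lambda>z. ctv_apply (X z) f z)"

lemma ctv_apply_sum:
  "finite A \<Longrightarrow> (\<And>i. i \<in> A \<Longrightarrow> f i differentiable (at z)) \<Longrightarrow>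
    ctv_apply X (\<lambda>w. \<Sum>i\<in>A. f i w) z = (\<Sum>i\<in>A. ctv_apply X (f i) z)"
  by (induction A rule: finite_induct) (auto simp: ctv_apply_const ctv_apply_add differentiable_sum)

lemma ctv_apply_cmult:
  "f differentiable (at z) \<Longrightarrow> ctv_apply X (\<lambda>w. c * f w) z = c * ctv_apply X f z"
  by (simp add: ctv_apply_mult ctv_apply_const)

lemma ctv_apply_cong:
  assumes "\<forall>\<^sub>F w in nhds z. f w = g w" "f differentiable (at z)"
  shows "ctv_apply X f z = ctv_apply X g z"
proof -
  obtain F where F: "(f has_derivative F) (at z)" using assms by (auto simp: differentiable_def)
  obtain V where "open V" "z \<in> V" "\<forall>w\<in>V. f w = g w" using assms(1) by (auto simp: eventually_nhds)
  then have "(g has_derivative F) (at z)" using has_derivative_transform_within_open[OF F] by blast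
  then show ?thesis using ctv_apply_frechet F by metis
qed

lemma ctv_apply_commute:
  fixes f :: "complex^'n \<Rightarrow> complex"
  assumes f: "smooth_at z f"
  shows "ctv_apply X (\<lambda>w. ctv_apply Y f w) z = ctv_apply Y (\<lambda>w. ctv_apply X f w) z"
proof -
  let ?F = "\<lambda>w. frechet_derivative f (at w)"
  define L where "L v = frechet_derivative (\<lambda>w. ?F w v) (at z)" for v
  have L: "((\<lambda>w. ?F w v) has_derivative L v) (at z)" for v
    unfolding L_def by (intro smooth_at_has_derivative smooth_at_frechet f)
  have sym: "L v w = L w v" for v w
    unfolding L_def by (rule frechet_derivative_symmetric[OF f])
  have *: "ctv_apply X (\<lambda>w. ctv_apply Y f w) z
      = L (ctv_re Y) (ctv_re X) + \<i> * L (ctv_im Y) (ctv_re X)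
        + \<i> * (L (ctv_re Y) (ctv_im X) + \<i> * L (ctv_im Y) (ctv_im X))" for X Y
  proof -
    have "\<forall>\<^sub>F w in nhds z. ?F w (ctv_re Y) + \<i> * ?F w (ctv_im Y) = ctv_apply Y f w"
      using smooth_at_eventually[OF f]
      by (rule eventually_mono) (simp add: ctv_apply_frechet[OF smooth_at_has_derivative])
    moreover have d: "((\<lambda>w. ?F w (ctv_re Y) + \<i> * ?F w (ctv_im Y)) has_derivative
        (\<lambda>h. L (ctv_re Y) h + \<i> * L (ctv_im Y) h)) (at z)"
      by (intro has_derivative_add has_derivative_mult_right L)
    ultimately have "ctv_apply X (\<lambda>w. ?F w (ctv_re Y) + \<i> * ?F w (ctv_im Y)) z = ctv_apply X (\<lambda>w. ctv_apply Y f w) z"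
      by (intro ctv_apply_cong) (auto simp: differentiable_def)
    then show ?thesis unfolding ctv_apply_frechet[OF d] by simp
  qed
  show ?thesis unfolding * by (simp add: sym[of "ctv_re X"] sym[of "ctv_im X"] algebra_simps)
qed

text \<open>The product rule separates a derivative of the coefficients of Y from a second-order
  term with coefficients frozen at z. The latter is symmetric by \<open>ctv_apply_commute\<close>,
  so it cancels in a commutator and the bracket remains.\<close>

lemma ctv_apply_fieldop:
  assumes Y: "smooth_at z Y" and f: "smooth_at z f"
  shows "ctv_apply X (fieldop Y f) z
    = ctv_apply (\<chi> j. ctv_apply X (\<lambda>w. fst (Y w) $ j) z, \<chi> j. ctv_apply X (\<lambda>w. snd (Y w) $ j) z) f z
      + ctv_apply X (\<lambda>w. ctv_apply (Y z) f w) z"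
proof -
  note d = smooth_at_differentiable
  note sm = smooth_at_coeff[OF Y] smooth_at_dZ[OF f]
  have "ctv_apply X (fieldop Y f) z = (\<Sum>k\<in>UNIV. ctv_apply X (\<lambda>w. fst (Y w) $ k * dZ f w k + snd (Y w) $ k * dZbar f w k) z)"
    unfolding fieldop_def ctv_apply_def[of "Y _"]
    by (intro ctv_apply_sum d smooth_at_add smooth_at_mult sm) simp
  also have "\<dots> = (\<Sum>k\<in>UNIV. (ctv_apply X (\<lambda>w. fst (Y w) $ k) z * dZ f z k + ctv_apply X (\<lambda>w. snd (Y w) $ k) z * dZbar f z k)
      + (fst (Y z) $ k * ctv_apply X (\<lambda>w. dZ f w k) z + snd (Y z) $ k * ctv_apply X (\<lambda>w. dZbar f w k) z))"
    by (intro sum.cong refl)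
      (simp add: ctv_apply_add ctv_apply_mult d smooth_at_mult sm)
  also have "\<dots> = ctv_apply (\<chi> j. ctv_apply X (\<lambda>w. fst (Y w) $ j) z, \<chi> j. ctv_apply X (\<lambda>w. snd (Y w) $ j) z) f z
      + (\<Sum>k\<in>UNIV. fst (Y z) $ k * ctv_apply X (\<lambda>w. dZ f w k) z + snd (Y z) $ k * ctv_apply X (\<lambda>w. dZbar f w k) z)"
    by (simp add: sum.distrib[symmetric] ctv_apply_def[of "(\<chi> j. _ j, \<chi> j. _ j)"])
  also have "(\<Sum>k\<in>UNIV. fst (Y z) $ k * ctv_apply X (\<lambda>w. dZ f w k) z + snd (Y z) $ k * ctv_apply X (\<lambda>w. dZbar f w k) z)
      = ctv_apply X (\<lambda>w. \<Sum>k\<in>UNIV. fst (Y z) $ k * dZ f w k + snd (Y z) $ k * dZbar f w k) z"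
    by (subst ctv_apply_sum)
      (simp_all add: ctv_apply_add ctv_apply_cmult d smooth_at_mult smooth_at_add smooth_at_const sm)
  finally show ?thesis by (simp add: ctv_apply_def[of "Y z"])
qed

lemma ctv_apply_vec_diff: "ctv_apply (X - Y) f z = ctv_apply X f z - ctv_apply Y f z"
  by (simp add: ctv_apply_def algebra_simps sum.distrib sum_subtractf)

lemma lie_bracket_apply:
  assumes "smooth_at z X" "smooth_at z Y" "smooth_at z f"
  shows "ctv_apply (lie_bracket X Y z) f z = ctv_apply (X z) (fieldop Y f) z - ctv_apply (Y z) (fieldop X f) z"
proof -
  have "lie_bracket X Y z
    = (\<chi> j. ctv_apply (X z) (\<lambda>w. fst (Y w) $ j) z, \<chi> j. ctv_apply (X z) (\<lambda>w. snd (Y w) $ j) z)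
      - (\<chi> j. ctv_apply (Y z) (\<lambda>w. fst (X w) $ j) z, \<chi> j. ctv_apply (Y z) (\<lambda>w. snd (X w) $ j) z)"
    by (simp add: lie_bracket_def vec_eq_iff)
  then show ?thesis
    by (simp only: ctv_apply_vec_diff ctv_apply_fieldop[OF assms(2,3)] ctv_apply_fieldop[OF assms(1,3)]
        ctv_apply_commute[OF assms(3), of "X z" "Y z"]) simp
qed

lemma smooth_at_lie_bracket:
  assumes "smooth_at p X" "smooth_at p Y" shows "smooth_at p (lie_bracket X Y)"
  by (rule smooth_at_ctvI) (auto simp: lie_bracket_def intro!: smooth_at_diff smooth_at_ctv_apply smooth_at_coeff assms)

lemma smooth_at_ctv_cnj:
  assumes "smooth_at p X" shows "smooth_at p (\<lambda>z. ctv_cnj (X z))"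
  by (rule smooth_at_ctvI) (auto simp: ctv_cnj_def intro!: smooth_at_cnj smooth_at_coeff assms)

lemma smooth_at_ctv_scale:
  assumes "smooth_at p X" shows "smooth_at p (\<lambda>z. ctv_scale c (X z))"
  by (rule smooth_at_ctvI) (auto simp: ctv_scale_def intro!: smooth_at_mult smooth_at_const smooth_at_coeff assms)

lemma smooth_at_fieldop: "smooth_at p X \<Longrightarrow> smooth_at p f \<Longrightarrow> smooth_at p (fieldop X f)"
  unfolding fieldop_def by (rule smooth_at_ctv_apply)

section \<open>Fields tangent to M\<close>

lemma CR_vector_field_smooth: "CR_vector_field d M p X \<Longrightarrow> smooth_at p X"
  unfolding CR_vector_field_def using smooth_atI by blast

lemma CR_lie_algebra_smooth: "X \<in> CR_lie_algebra d M p \<Longrightarrow> smooth_at p X"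
  by (induction rule: CR_lie_algebra.induct)
    (auto intro: CR_vector_field_smooth smooth_at_ctv_cnj smooth_at_add smooth_at_ctv_scale smooth_at_lie_bracket)

text \<open>Tangency is stated through the germs vanishing on M. In this form it passes to brackets
  by iteration, and it is what makes \<open>fieldop X\<close> well defined on germs along M.\<close>

definition tangential :: "(complex^'n::finite) set \<Rightarrow> complex^'n \<Rightarrow> (complex^'n \<Rightarrow> 'n ctv) \<Rightarrow> bool" where
  "tangential M p X \<longleftrightarrow> smooth_at p X \<and>
     (\<forall>f. smooth_at p f \<longrightarrow> (\<forall>\<^sub>F z in nhds p. z \<in> M \<longrightarrow> f z = 0) \<longrightarrow>
       (\<forall>\<^sub>F z in nhds p. z \<in> M \<longrightarrow> fieldop X f z = 0))"

lemma CR_vector_field_tangential: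
  fixes X :: "complex^'n::finite \<Rightarrow> 'n ctv"
  assumes "CR_vector_field d M p X" shows "tangential M p X"
  unfolding tangential_def
proof (intro conjI allI impI)
  show "smooth_at p X" using assms by (rule CR_vector_field_smooth)
  fix f :: "complex^'n \<Rightarrow> complex"
  assume f: "smooth_at p f" and f0: "\<forall>\<^sub>F z in nhds p. z \<in> M \<longrightarrow> f z = 0"
  obtain U where U: "open U" "p \<in> U" "\<forall>z\<in>M \<inter> U. X z \<in> T01 d M z"
    using assms by (auto simp: CR_vector_field_def)
  \<comment> \<open>Vanishing on M near p is restated as vanishing on M near each z close to p,
    where \<open>ctangent_kills_vanishing\<close> is applied.\<close>
  have "\<forall>\<^sub>F z in nhds p. \<forall>\<^sub>F w in nhds z. w \<in> M \<longrightarrow> f w = 0"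
    using f0 by (simp only: eventually_eventually)
  moreover have "\<forall>\<^sub>F z in nhds p. z \<in> U" using U by (intro eventually_nhds_in_open)
  ultimately show "\<forall>\<^sub>F z in nhds p. z \<in> M \<longrightarrow> fieldop X f z = 0"
    using smooth_at_eventually[OF f]
  proof eventually_elim
    case (elim z)
    then show ?case
      using U(3) ctangent_kills_vanishing[of "X z" d M z f] by (auto simp: fieldop_def T01_def)
  qed
qed

lemma fieldop_cnj:
  assumes "smooth_at z f"
  shows "fieldop (\<lambda>z. ctv_cnj (X z)) (\<lambda>w. cnj (f w)) z = cnj (fieldop X f z)"
  by (simp add: fieldop_def ctv_apply_cnj smooth_at_differentiable[OF assms])

lemma tangential_cnj:
  fixes X :: "complex^'n::finite \<Rightarrow> 'n ctv"
  assumes "tangential M p X" shows "tangential M p (\<lambda>z. ctv_cnj (X z))"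
  unfolding tangential_def
proof (intro conjI allI impI)
  show "smooth_at p (\<lambda>z. ctv_cnj (X z))" using assms smooth_at_ctv_cnj by (auto simp: tangential_def)
  fix f :: "complex^'n \<Rightarrow> complex"
  assume f: "smooth_at p f" and f0: "\<forall>\<^sub>F z in nhds p. z \<in> M \<longrightarrow> f z = 0"
  have "\<forall>\<^sub>F z in nhds p. z \<in> M \<longrightarrow> fieldop X (\<lambda>w. cnj (f w)) z = 0"
    using assms f0 smooth_at_cnj[OF f] by (simp add: tangential_def)
  then show "\<forall>\<^sub>F z in nhds p. z \<in> M \<longrightarrow> fieldop (\<lambda>z. ctv_cnj (X z)) f z = 0"
    using smooth_at_eventually[OF smooth_at_cnj[OF f]]
  proof eventually_elim
    case (elim z)
    then show ?case using fieldop_cnj[of z "\<lambda>w. cnj (f w)" X] by simp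
  qed
qed

lemma tangential_CR_lie_algebra:
  fixes X :: "complex^'n::finite \<Rightarrow> 'n ctv"
  shows "X \<in> CR_lie_algebra d M p \<Longrightarrow> tangential M p X"
proof (induction rule: CR_lie_algebra.induct)
  case (CR X)
  then show ?case by (rule CR_vector_field_tangential)
next
  case (CR_cnj X)
  then show ?case by (intro tangential_cnj CR_vector_field_tangential)
next
  case (add X Y)
  show ?case
    unfolding tangential_def
  proof (intro conjI allI impI)
    show "smooth_at p (\<lambda>z. X z + Y z)" using add by (auto simp: tangential_def intro: smooth_at_add)
    fix f :: "complex^'n \<Rightarrow> complex"
    assume "smooth_at p f" "\<forall>\<^sub>F z in nhds p. z \<in> M \<longrightarrow> f z = 0"
    then have "\<forall>\<^sub>F z in nhds p. z \<in> M \<longrightarrow> fieldop X f z = 0" "\<forall>\<^sub>F z in nhds p. z \<in> M \<longrightarrow> fieldop Y f z = 0"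
      using add.IH by (auto simp: tangential_def)
    then show "\<forall>\<^sub>F z in nhds p. z \<in> M \<longrightarrow> fieldop (\<lambda>z. X z + Y z) f z = 0"
      by eventually_elim (simp add: fieldop_def ctv_apply_vec_add)
  qed
next
  case (scale X c)
  then show ?case
    by (auto simp: tangential_def fieldop_def ctv_apply_scale intro!: smooth_at_ctv_scale elim: eventually_mono)
next
  case (bracket X Y)
  show ?case
    unfolding tangential_def
  proof (intro conjI allI impI)
    have X: "smooth_at p X" and Y: "smooth_at p Y" using bracket by (auto simp: tangential_def)
    then show "smooth_at p (lie_bracket X Y)" by (rule smooth_at_lie_bracket)
    fix f :: "complex^'n \<Rightarrow> complex" assume f: "smooth_at p f" and f0: "\<forall>\<^sub>F z in nhds p. z \<in> M \<longrightarrow> f z = 0"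
    have "\<forall>\<^sub>F z in nhds p. z \<in> M \<longrightarrow> fieldop X (fieldop Y f) z = 0"
      and "\<forall>\<^sub>F z in nhds p. z \<in> M \<longrightarrow> fieldop Y (fieldop X f) z = 0"
      using bracket.IH f f0 X Y smooth_at_fieldop unfolding tangential_def by blast+
    then show "\<forall>\<^sub>F z in nhds p. z \<in> M \<longrightarrow> fieldop (lie_bracket X Y) f z = 0"
      using smooth_at_eventually[OF f] smooth_at_eventually[OF X] smooth_at_eventually[OF Y]
      by eventually_elim (simp add: fieldop_def[of "lie_bracket X Y"] lie_bracket_apply fieldop_def[of X "fieldop Y f"] fieldop_def[of Y "fieldop X f"])
  qed
qed

text \<open>Error terms: combinations of derivatives of \<open>J\<close> that vanish at \<open>p\<close> if all derivatives of
  order less than \<open>n\<close> do.\<close>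

inductive lower_order :: "(complex^'n::finite \<Rightarrow> complex) \<Rightarrow> complex^'n \<Rightarrow> nat \<Rightarrow> (complex^'n \<Rightarrow> complex) \<Rightarrow> bool"
  for J p where
  deriv: "smooth_at p s \<Longrightarrow> length ks < n \<or> s p = 0 \<and> length ks = n \<Longrightarrow> lower_order J p n (\<lambda>z. s z * dZs ks J z)"
| add: "lower_order J p n f \<Longrightarrow> lower_order J p n g \<Longrightarrow> lower_order J p n (\<lambda>z. f z + g z)"
| cong: "lower_order J p n f \<Longrightarrow> \<forall>\<^sub>F z in nhds p. f z = g z \<Longrightarrow> lower_order J p n g"

lemma lower_order_zero: "lower_order J p n (\<lambda>_. 0)"
  using lower_order.deriv[of p "\<lambda>_. 0" "[]" n J] by (cases n) (auto simp: smooth_at_const)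

lemma lower_order_sum:
  "finite A \<Longrightarrow> (\<And>i. i \<in> A \<Longrightarrow> lower_order J p n (f i)) \<Longrightarrow> lower_order J p n (\<lambda>z. \<Sum>i\<in>A. f i z)"
  by (induction A rule: finite_induct) (auto intro: lower_order_zero lower_order.add)

lemma lower_order_at:
  assumes "lower_order J p n f" and "\<And>ks. length ks < n \<Longrightarrow> dZs ks J p = 0"
  shows "f p = 0"
  using assms by (induction rule: lower_order.induct) (auto dest: eventually_nhds_x_imp_x)

context
  fixes J :: "complex^'n::finite \<Rightarrow> complex" and p U
  assumes J: "holo_fun_on J U" and U: "open U" "p \<in> U"
begin

lemma dZs_smooth: "z \<in> U \<Longrightarrow> smooth_at z (dZs ks J)"
  using holo_fun_on_smooth[OF holo_fun_on_dZs[OF J U(1)] U(1)] U smooth_atI by blast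

lemma fieldop_dZs: "z \<in> U \<Longrightarrow> fieldop X (dZs ks J) z = (\<Sum>l\<in>UNIV. fst (X z) $ l * dZs (l # ks) J z)"
  by (simp add: fieldop_def ctv_apply_def holo_fun_on_dZ(2)[OF holo_fun_on_dZs[OF J U(1)]])

lemma lower_order_smooth: "lower_order J p n f \<Longrightarrow> smooth_at p f"
  by (induction rule: lower_order.induct)
    (auto intro: smooth_at_mult smooth_at_add smooth_at_cong dZs_smooth U(2))

text \<open>Differentiating s times a derivative of J gives that same derivative, of order at most
  n, and derivatives of one order more that keep s as a factor; so s p = 0 still covers the top
  order.\<close>

lemma lower_order_fieldop:
  assumes X: "smooth_at p X" and f: "lower_order J p n f"
  shows "lower_order J p (Suc n) (fieldop X f)"
  using f
proof (induction rule: lower_order.induct)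
  case (deriv s ks n)
  have 1: "lower_order J p (Suc n) (\<lambda>z. fieldop X s z * dZs ks J z)"
    using deriv X by (intro lower_order.deriv smooth_at_fieldop) auto
  have "lower_order J p (Suc n) (\<lambda>z. \<Sum>l\<in>UNIV. (s z * fst (X z) $ l) * dZs (l # ks) J z)"
    using deriv by (intro lower_order_sum lower_order.deriv smooth_at_mult smooth_at_coeff X) auto
  from lower_order.add[OF 1 this] show ?case
  proof (rule lower_order.cong)
    show "\<forall>\<^sub>F z in nhds p. fieldop X s z * dZs ks J z + (\<Sum>l\<in>UNIV. (s z * fst (X z) $ l) * dZs (l # ks) J z)
        = fieldop X (\<lambda>z. s z * dZs ks J z) z"
      using smooth_at_eventually[OF deriv(1)] eventually_nhds_in_open[OF U]
    proof eventually_elim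
      case (elim z)
      have "fieldop X (\<lambda>z. s z * dZs ks J z) z = fieldop X s z * dZs ks J z + s z * fieldop X (dZs ks J) z"
        using elim dZs_smooth by (simp add: fieldop_def ctv_apply_mult smooth_at_differentiable)
      then show ?case
        unfolding fieldop_dZs[OF elim(2)] by (simp add: sum_distrib_left mult_ac del: dZs.simps)
    qed
  qed
next
  case (add n f g)
  from lower_order.add[OF add.IH] show ?case
  proof (rule lower_order.cong)
    show "\<forall>\<^sub>F z in nhds p. fieldop X f z + fieldop X g z = fieldop X (\<lambda>z. f z + g z) z"
      using smooth_at_eventually[OF lower_order_smooth[OF add.hyps(1)]]
        smooth_at_eventually[OF lower_order_smooth[OF add.hyps(2)]]
      by eventually_elim (simp add: fieldop_def ctv_apply_add smooth_at_differentiable)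
  qed
next
  case (cong n f g)
  from cong.IH show ?case
  proof (rule lower_order.cong)
    have "\<forall>\<^sub>F z in nhds p. \<forall>\<^sub>F w in nhds z. f w = g w" using cong.hyps by (simp only: eventually_eventually)
    then show "\<forall>\<^sub>F z in nhds p. fieldop X f z = fieldop X g z"
      using smooth_at_eventually[OF lower_order_smooth[OF cong.hyps(1)]]
      by eventually_elim (simp add: fieldop_def ctv_apply_cong smooth_at_differentiable)
  qed
qed

text \<open>On holomorphic functions only the (1,0)-part of a field acts, and that of
  \<open>X k\<close> at p is \<partial>/\<partial>Z_k. Away from p it deviates by coefficients that
  vanish at p, and these go into the error term.\<close>

lemma word_lower_order:
  assumes X: "\<And>k. smooth_at p (X k)" "\<And>k. fst (X k p) = axis k 1"
  shows "\<exists>e. lower_order J p (length ks) e \<and>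
    (\<forall>\<^sub>F z in nhds p. foldr (\<lambda>k. fieldop (X k)) ks J z = dZs ks J z + e z)"
proof (induction ks)
  case Nil
  then show ?case by (intro exI[of _ "\<lambda>_. 0"]) (simp add: lower_order_zero)
next
  case (Cons k ks)
  then obtain e where e: "lower_order J p (length ks) e"
    and eq: "\<forall>\<^sub>F z in nhds p. foldr (\<lambda>k. fieldop (X k)) ks J z = dZs ks J z + e z" by blast
  define e1 where "e1 z = (\<Sum>l\<in>UNIV. (fst (X k z) $ l - (if l = k then 1 else 0)) * dZs (l # ks) J z)" for z
  have "lower_order J p (Suc (length ks)) e1"
    unfolding e1_def using X
    by (intro lower_order_sum lower_order.deriv smooth_at_diff smooth_at_coeff smooth_at_const)
      (auto simp: axis_def)
  moreover have "lower_order J p (Suc (length ks)) (fieldop (X k) e)"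
    using X e by (intro lower_order_fieldop)
  ultimately have "lower_order J p (Suc (length ks)) (\<lambda>z. e1 z + fieldop (X k) e z)"
    by (rule lower_order.add)
  moreover have "\<forall>\<^sub>F z in nhds p. foldr (\<lambda>k. fieldop (X k)) (k # ks) J z
      = dZs (k # ks) J z + (e1 z + fieldop (X k) e z)"
  proof -
    have "\<forall>\<^sub>F z in nhds p. \<forall>\<^sub>F w in nhds z. dZs ks J w + e w = foldr (\<lambda>k. fieldop (X k)) ks J w"
      using eq by (simp only: eventually_eventually eq_commute)
    then show ?thesis
      using eventually_nhds_in_open[OF U] smooth_at_eventually[OF lower_order_smooth[OF e]]
    proof eventually_elim
      case (elim z)
      have d: "dZs ks J differentiable (at z)" "e differentiable (at z)"
        using elim dZs_smooth smooth_at_differentiable by blast+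
      have "foldr (\<lambda>k. fieldop (X k)) (k # ks) J z = ctv_apply (X k z) (\<lambda>w. dZs ks J w + e w) z"
        using ctv_apply_cong[OF elim(1), of "X k z"] d by (simp add: fieldop_def differentiable_add)
      also have "\<dots> = fieldop (X k) (dZs ks J) z + fieldop (X k) e z"
        using d by (simp add: fieldop_def ctv_apply_add)
      also have "fieldop (X k) (dZs ks J) z = dZs (k # ks) J z + e1 z"
        unfolding fieldop_dZs[OF elim(2)] e1_def
        by (simp add: left_diff_distrib sum_subtractf if_distrib[of "\<lambda>x. x * _"] del: dZs.simps cong: if_cong)
      finally show ?case by simp
    qed
  qed
  ultimately show ?case by auto
qed

text \<open>At the least order where a derivative of J survives at p, the error term of the
  corresponding word vanishes there.\<close>

lemma word_nonzero:
  assumes X: "\<And>k. smooth_at p (X k)" "\<And>k. fst (X k p) = axis k 1"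
    and nz: "\<not> (\<forall>\<^sub>F z in nhds p. J z = 0)"
  obtains ks where "foldr (\<lambda>k. fieldop (X k)) ks J p \<noteq> 0"
proof -
  have "\<exists>n ks. length ks = n \<and> dZs ks J p \<noteq> 0"
    using holo_fun_eventually_0[OF J U] nz by blast
  then obtain n where n: "\<exists>ks. length ks = n \<and> dZs ks J p \<noteq> 0"
    "\<And>m. m < n \<Longrightarrow> \<not> (\<exists>ks. length ks = m \<and> dZs ks J p \<noteq> 0)"
    using exists_least_iff[of "\<lambda>n. \<exists>ks. length ks = n \<and> dZs ks J p \<noteq> 0"] by blast
  then obtain ks where ks: "length ks = n" "dZs ks J p \<noteq> 0" by blast
  obtain e where e: "lower_order J p n e"
    "\<forall>\<^sub>F z in nhds p. foldr (\<lambda>k. fieldop (X k)) ks J z = dZs ks J z + e z"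
    using word_lower_order[OF X, of ks] ks by blast
  have "e p = 0" using lower_order_at[OF e(1)] n(2) by blast
  then show ?thesis using eventually_nhds_x_imp_x[OF e(2)] ks by (intro that[of ks]) simp
qed

end

section \<open>Transversality\<close>

text \<open>Replace as few columns of \<open>A\<close> as possible by constants so that the determinant \<open>D\<close> does not
  vanish identically, and apply Cramer's rule to one of the replaced columns of \<open>A\<close>: by minimality
  its coordinates along the replaced columns vanish. The extra factor \<open>D\<close> covers the zeros of \<open>D\<close>.\<close>

lemma holomorphic_kernel_field:
  fixes A :: "complex^'n::finite \<Rightarrow> complex^'n^'n"
  assumes A: "\<And>i j. holo_fun_on (\<lambda>z. A z $ i $ j) U"
    and det0: "\<forall>\<^sub>F z in nhds p. det (A z) = 0"
  obtains \<phi> where "holo_map_on \<phi> U" "\<forall>\<^sub>F z in nhds p. A z *v \<phi> z = 0" "\<not> (\<forall>\<^sub>F z in nhds p. \<phi> z = 0)"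
proof -
  define R where "R S b z = (\<chi> i k. if k \<in> S then b k $ i else A z $ i $ k)" for S and b :: "'n \<Rightarrow> complex^'n" and z
  define P where "P S \<longleftrightarrow> (\<exists>b. \<not> (\<forall>\<^sub>F z in nhds p. det (R S b z) = 0))" for S
  have "R UNIV (\<lambda>k. axis k 1) z = mat 1" for z
    by (simp add: R_def mat_def axis_def vec_eq_iff)
  \<comment> \<open>Replacing all columns by unit vectors gives determinant 1, so a minimal
    \<open>S\<close> exists.\<close>
  then have "P UNIV" unfolding P_def by (intro exI[of _ "\<lambda>k. axis k 1"]) simp
  then have "\<exists>n S. card S = n \<and> P S" by blast
  then obtain S where S: "P S" "\<And>T. card T < card S \<Longrightarrow> \<not> P T"
    using exists_least_iff[of "\<lambda>n. \<exists>S. card S = n \<and> P S"] by blast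
  then obtain b where b: "\<not> (\<forall>\<^sub>F z in nhds p. det (R S b z) = 0)" unfolding P_def by blast
  have "R {} b z = A z" for z by (simp add: R_def vec_eq_iff)
  then have "S \<noteq> {}" using b det0 by auto
  then obtain s where s: "s \<in> S" by blast
  have min: "\<forall>\<^sub>F z in nhds p. det (R (S - {s}) b z) = 0" for b
    using S(2)[OF card_Diff1_less[OF finite s]] by (auto simp: P_def)
  define D where "D z = det (R S b z)" for z
  define num where "num k z = det (\<chi> i j. if j = k then A z $ i $ s else R S b z $ i $ j)" for k z
  have num0: "\<forall>\<^sub>F z in nhds p. num k z = 0" if k: "k \<in> S" for k
  proof (cases "k = s")
    case True
    have "(\<chi> i j. if j = k then A z $ i $ s else R S b z $ i $ j) = R (S - {s}) b z" for z
      by (auto simp: R_def vec_eq_iff True)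
    then show ?thesis unfolding num_def using min by simp
  next
    case False
    \<comment> \<open>Column k now holds column s of A, and column s holds \<open>b s\<close>.
      Exchanging them puts A's own column back at s, so one replaced column fewer remains and
      minimality applies.\<close>
    let ?\<tau> = "Transposition.transpose k s"
    let ?N = "\<lambda>z. \<chi> i j. if j = k then A z $ i $ s else R S b z $ i $ j"
    have "(\<chi> i j. ?N z $ i $ ?\<tau> j) = R (S - {s}) (b(k := b s)) z" for z
      using s k False by (auto simp: R_def vec_eq_iff Transposition.transpose_def)
    moreover have "det (\<chi> i j. ?N z $ i $ ?\<tau> j) = of_int (sign ?\<tau>) * det (?N z)" for z
      by (rule det_permute_columns) (simp add: permutes_swap_id)
    ultimately have "of_int (sign ?\<tau>) * num k z = det (R (S - {s}) (b(k := b s)) z)" for z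
      unfolding num_def by simp
    then have "\<forall>\<^sub>F z in nhds p. of_int (sign ?\<tau>) * num k z = (0::complex)" using min by simp
    then show ?thesis by (rule eventually_mono) (simp add: sign_def split: if_splits)
  qed
  \<comment> \<open>The entry at s is -D^2, which makes the field nontrivial.\<close>
  define \<phi> where "\<phi> z = (\<chi> k. D z * ((if k \<in> S then 0 else num k z) - (if k = s then D z else 0)))" for z
  have holoR: "holo_fun_on (\<lambda>z. R S b z $ i $ j) U" for i j
    by (cases "j \<in> S") (simp_all add: R_def holo_fun_on_const A)
  have holoD: "holo_fun_on D U" unfolding D_def by (rule holo_fun_on_det[OF holoR])
  have holonum: "holo_fun_on (num k) U" for k
    unfolding num_def
  proof (rule holo_fun_on_det)
    show "holo_fun_on (\<lambda>z. (\<chi> i j. if j = k then A z $ i $ s else R S b z $ i $ j) $ i $ j) U" for i j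
      by (cases "j = k") (simp_all add: A holoR)
  qed
  show ?thesis
  proof (rule that)
    show "holo_map_on \<phi> U"
      unfolding holo_map_on_def
    proof
      fix k
      have "holo_fun_on (\<lambda>z. D z * ((if k \<in> S then 0 else 1) * num k z + (if k = s then -1 else 0) * D z)) U"
        by (intro holo_fun_on_mult holo_fun_on_add holo_fun_on_const holoD holonum)
      then show "holo_fun_on (\<lambda>z. \<phi> z $ k) U" by (rule back_subst[of "\<lambda>f. holo_fun_on f U"]) (auto simp: \<phi>_def)
    qed
    show "\<not> (\<forall>\<^sub>F z in nhds p. \<phi> z = 0)"
    proof
      assume "\<forall>\<^sub>F z in nhds p. \<phi> z = 0"
      then have "\<forall>\<^sub>F z in nhds p. det (R S b z) = 0"
      proof (rule eventually_mono)
        fix z assume "\<phi> z = 0"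
        then have "\<phi> z $ s = 0" by simp
        then show "det (R S b z) = 0" using s by (simp add: \<phi>_def D_def)
      qed
      then show False using b by contradiction
    qed
    have "\<forall>\<^sub>F z in nhds p. \<forall>k\<in>S. num k z = 0" using num0 by (simp add: eventually_ball_finite)
    then show "\<forall>\<^sub>F z in nhds p. A z *v \<phi> z = 0"
    proof (rule eventually_mono)
      fix z assume num0: "\<forall>k\<in>S. num k z = 0"
      show "A z *v \<phi> z = 0"
      proof (cases "D z = 0")
        case True
        then show ?thesis by (simp add: \<phi>_def matrix_vector_mult_def vec_eq_iff)
      next
        case False
        let ?x = "\<chi> k. num k z / D z" and ?h = "\<chi> i. A z $ i $ s"
        have "?x = (\<chi> k. det (\<chi> i j. if j = k then ?h $ i else R S b z $ i $ j) / det (R S b z))"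
          unfolding num_def D_def by (simp cong: if_cong)
        then have Rx: "R S b z *v ?x = ?h"
          using cramer[of "R S b z" ?x ?h] False by (simp add: D_def)
        have row: "(\<Sum>k\<in>UNIV. A z $ i $ k * (if k \<in> S then 0 else num k z)) = D z * A z $ i $ s" for i
        proof -
          have "(\<Sum>k\<in>UNIV. R S b z $ i $ k * (num k z / D z)) = A z $ i $ s"
            using arg_cong[OF Rx, of "\<lambda>v. v $ i"] by (simp add: matrix_vector_mult_def)
          moreover have "D z * (\<Sum>k\<in>UNIV. R S b z $ i $ k * (num k z / D z))
              = (\<Sum>k\<in>UNIV. A z $ i $ k * (if k \<in> S then 0 else num k z))"
            unfolding sum_distrib_left using num0 False
            by (intro sum.cong refl) (auto simp: R_def)
          ultimately show ?thesis by simp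
        qed
        have "(A z *v \<phi> z) $ i = 0" for i
        proof -
          have "(A z *v \<phi> z) $ i = D z * ((\<Sum>k\<in>UNIV. A z $ i $ k * (if k \<in> S then 0 else num k z))
              - (\<Sum>k\<in>UNIV. if k = s then A z $ i $ k * D z else 0))"
            unfolding matrix_vector_mult_def \<phi>_def sum_subtractf[symmetric] sum_distrib_left
            by (simp, intro sum.cong refl) (auto simp: algebra_simps)
          then show ?thesis unfolding row by simp
        qed
        then show ?thesis by (simp add: vec_eq_iff)
      qed
    qed
  qed
qed

section \<open>Finite type and the divisor\<close>

lemma ctv_apply_of_real:
  assumes "(r has_derivative R) (at z)"
  shows "ctv_apply X (\<lambda>w. complex_of_real (r w)) z = del_form r z (fst X) + cnj (del_form r z (\<chi> k. cnj (snd X $ k)))"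
proof -
  have "(\<lambda>w. complex_of_real (r w)) differentiable (at z)"
    using of_real_has_derivative[OF assms] by (auto simp: differentiable_def)
  from dZ_cnj(2)[OF this] show ?thesis
    by (simp add: ctv_apply_def del_form_def sum.distrib mult.commute)
qed

lemma ctv_apply_cnj_of_real:
  assumes "(r has_derivative R) (at z)"
  shows "ctv_apply (ctv_cnj X) (\<lambda>w. complex_of_real (r w)) z = cnj (ctv_apply X (\<lambda>w. complex_of_real (r w)) z)"
  using ctv_apply_cnj[of "\<lambda>w. complex_of_real (r w)" z X] of_real_has_derivative[OF assms]
  by (auto simp: differentiable_def)

text \<open>By genericity every (1,0)-vector is the (1,0)-part of a tangent vector, and conjugation
  gives the (0,1) case; finite type realizes these vectors by fields of the Lie algebra. At p,
  \<open>X k\<close> acts on holomorphic functions as \<partial>/\<partial>Z_k and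
  \<open>Y k\<close> on antiholomorphic ones as \<partial>/\<partial>conj Z_k.\<close>

lemma finite_type_frame:
  assumes ldf: "local_defining_function d M p U \<rho>" and ft: "finite_type d M p"
  obtains X Y where "\<And>k. X k \<in> CR_lie_algebra d M p" "\<And>k. fst (X k p) = axis k 1"
    "\<And>k. Y k \<in> CR_lie_algebra d M p" "\<And>k. snd (Y k p) = axis k 1"
proof -
  have p: "p \<in> U" using ldf by (simp add: local_defining_function_def)
  note dR = defining_has_derivative[OF ldf _ p]
  have tangent: "\<exists>x \<in> ctangent_space d M p. fst x = axis k 1 \<and> ctv_cnj x \<in> ctangent_space d M p" for k
  proof -
    \<comment> \<open>Chosen so that the (0,1)-part with coefficients conj y cancels the
      contribution of the (1,0)-part to each \<rho>_j.\<close>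
    obtain y where y: "\<And>j. j < d \<Longrightarrow> del_form (\<rho> j) p y = - cnj (del_form (\<rho> j) p (axis k 1))"
      using defining_del_solve[OF ldf p, of "\<lambda>j. - cnj (del_form (\<rho> j) p (axis k 1))"] by blast
    let ?x = "(axis k 1, \<chi> k. cnj (y $ k))"
    have x: "ctv_apply ?x (\<lambda>w. complex_of_real (\<rho> j w)) p = 0" if "j < d" for j
      unfolding ctv_apply_of_real[OF dR[OF that]] by (simp add: y[OF that] vec_lambda_eta)
    then have "?x \<in> ctangent_space d M p" using ldf by (auto simp: ctangent_space_def)
    moreover have "ctv_apply (ctv_cnj ?x) (\<lambda>w. complex_of_real (\<rho> j w)) p = 0" if "j < d" for j
      unfolding ctv_apply_cnj_of_real[OF dR[OF that]] x[OF that] by simp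
    then have "ctv_cnj ?x \<in> ctangent_space d M p" using ldf by (auto simp: ctangent_space_def)
    ultimately show ?thesis by (intro bexI[of _ ?x]) auto
  qed
  have lift: "\<exists>X \<in> CR_lie_algebra d M p. X p = x" if "x \<in> ctangent_space d M p" for x
  proof -
    have "x \<in> (\<lambda>X. X p) ` CR_lie_algebra d M p" using that ft by (simp add: finite_type_def)
    then show ?thesis by blast
  qed
  have "\<exists>X \<in> CR_lie_algebra d M p. fst (X p) = axis k 1" for k
    using tangent[of k] lift by metis
  moreover have "\<exists>Y \<in> CR_lie_algebra d M p. snd (Y p) = axis k 1" for k
  proof -
    obtain x where x: "fst x = axis k 1" "ctv_cnj x \<in> ctangent_space d M p" using tangent[of k] by blast
    have "snd (ctv_cnj x) = axis k 1" by (simp add: ctv_cnj_def x vec_eq_iff axis_def)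
    then show ?thesis using lift[OF x(2)] by metis
  qed
  ultimately show ?thesis using that by metis
qed

lemma smooth_at_del_form:
  assumes "smooth_at p r" "smooth_at p x"
  shows "smooth_at p (\<lambda>z. del_form r z (x z))"
  unfolding del_form_def
  by (intro smooth_at_sum smooth_at_mult smooth_at_dZ smooth_at_of_real smooth_at_vec_nth assms) simp

lemma smooth_at_wedge:
  assumes "\<And>i j. i < d \<Longrightarrow> j < d \<Longrightarrow> smooth_at p (\<lambda>z. \<alpha> z j (x z i))"
  shows "smooth_at p (\<lambda>z. wedge d (\<alpha> z) (x z))"
  unfolding wedge_def
proof (intro smooth_at_sum smooth_at_mult smooth_at_const smooth_at_prod)
  fix \<sigma> j assume "\<sigma> \<in> {\<sigma>. \<sigma> permutes {..<d}}" "j \<in> {..<d}"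
  then show "smooth_at p (\<lambda>z. \<alpha> z j (x z (\<sigma> j)))"
    using permutes_in_image[of \<sigma> "{..<d}" j] by (intro assms) auto
qed (auto simp: finite_permutations)

lemma CR_field_kills_holomorphic:
  assumes X: "CR_vector_field d M p X" and f: "holo_fun_on f U" and U: "open U" "p \<in> U"
  shows "\<forall>\<^sub>F z in nhds p. z \<in> M \<longrightarrow> fieldop X f z = 0"
proof -
  obtain V where V: "open V" "p \<in> V" "\<forall>z\<in>M \<inter> V. X z \<in> T01 d M z"
    using X by (auto simp: CR_vector_field_def)
  show ?thesis
    using eventually_nhds_in_open[OF U] eventually_nhds_in_open[OF V(1,2)]
  proof eventually_elim
    case (elim z)
    then show ?case
      using V(3) by (auto simp: T01_def T01_space_def fieldop_def ctv_apply_def holo_fun_on_dZ(2)[OF f])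
  qed
qed

lemma holo_fun_on_power: "holo_fun_on f U \<Longrightarrow> holo_fun_on (\<lambda>z. f z ^ n) U"
  by (induction n) (auto intro: holo_fun_on_const holo_fun_on_mult)

lemma eventually_near:
  "eventually P (inf (nhds p) (principal M)) \<longleftrightarrow> (\<forall>\<^sub>F z in nhds p. z \<in> M \<longrightarrow> P z)"
  by (simp add: eventually_inf_principal)

text \<open>The valuation argument for ambient smooth germs modulo equality on M. Domination spreads
  from CR fields and their conjugates to the whole Lie algebra, and finite type supplies enough
  fields there for words that are nonzero on J and on conj J. The two factorizations encode the
  reality of \<delta>.\<close>

theorem finite_type_divisor_nonzero:
  fixes M :: "(complex^'n::finite) set"
  assumes ldf: "local_defining_function d M p W \<rho>" and pM: "p \<in> M" and ft: "finite_type d M p"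
    and J: "holo_fun_on J U" and U: "open U" "p \<in> U" and nz: "\<not> (\<forall>\<^sub>F z in nhds p. J z = 0)"
    and sm: "smooth_at p \<delta>" "smooth_at p b" "smooth_at p b'"
    and eq: "\<forall>\<^sub>F z in nhds p. z \<in> M \<longrightarrow> J z ^ m = \<delta> z * b z"
    and eq': "\<forall>\<^sub>F z in nhds p. z \<in> M \<longrightarrow> cnj (J z) ^ m = \<delta> z * b' z"
  shows "\<delta> p \<noteq> 0"
proof -
  interpret G: pointed_germ_algebra "inf (nhds p) (principal M)" "{f. smooth_at p f}" p
    by unfold_locales
      (use pM in \<open>auto simp: eventually_near smooth_at_const smooth_at_add smooth_at_mult dest: eventually_nhds_x_imp_x\<close>)
  have der: "G.derivation (fieldop X)" if X: "tangential M p X" for X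
    unfolding G.derivation_def G.eqg_def eventually_near mem_Collect_eq
  proof (intro conjI ballI allI impI; (unfold mem_Collect_eq)?)
    have sX: "smooth_at p X" using X by (simp add: tangential_def)
    fix f g :: "complex^'n \<Rightarrow> complex" assume f: "smooth_at p f"
    show "smooth_at p (fieldop X f)" by (rule smooth_at_fieldop[OF sX f])
    assume g: "smooth_at p g"
    note ev = smooth_at_eventually[OF f] smooth_at_eventually[OF g]
    show "\<forall>\<^sub>F z in nhds p. z \<in> M \<longrightarrow> fieldop X (\<lambda>z. f z + g z) z = fieldop X f z + fieldop X g z"
      using ev by eventually_elim (simp add: fieldop_def ctv_apply_add smooth_at_differentiable)
    show "\<forall>\<^sub>F z in nhds p. z \<in> M \<longrightarrow> fieldop X (\<lambda>z. f z * g z) z = fieldop X f z * g z + f z * fieldop X g z"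
      using ev by eventually_elim (simp add: fieldop_def ctv_apply_mult smooth_at_differentiable)
    assume "\<forall>\<^sub>F z in nhds p. z \<in> M \<longrightarrow> f z = g z"
    then have "\<forall>\<^sub>F z in nhds p. z \<in> M \<longrightarrow> f z - g z = 0" by simp
    then have "\<forall>\<^sub>F z in nhds p. z \<in> M \<longrightarrow> fieldop X (\<lambda>z. f z - g z) z = 0"
      using X smooth_at_diff[OF f g] by (simp add: tangential_def)
    then show "\<forall>\<^sub>F z in nhds p. z \<in> M \<longrightarrow> fieldop X f z = fieldop X g z"
      using ev by eventually_elim (simp add: fieldop_def ctv_apply_diff smooth_at_differentiable)
  next
    fix c show "\<forall>\<^sub>F z in nhds p. z \<in> M \<longrightarrow> fieldop X (\<lambda>_. c) z = 0"
      by (simp add: fieldop_def ctv_apply_const)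
  qed
  let ?J = "\<lambda>z. J z ^ m" and ?K = "\<lambda>z. cnj (J z) ^ m"
  \<comment> \<open>Both powers are included because CR fields have the first as a constant and
    their conjugates the second.\<close>
  let ?C = "{?J, ?K}"
  have sJ: "smooth_at p J" using holo_fun_on_smooth[OF J U(1)] U smooth_atI by blast
  have C: "?C \<subseteq> {f. smooth_at p f}" by (auto intro!: smooth_at_power sJ smooth_at_cnj)
  have eqJ: "G.eqg ?J (\<lambda>z. \<delta> z * b z)" and eqK: "G.eqg ?K (\<lambda>z. \<delta> z * b' z)"
    using eq eq' by (simp_all add: G.eqg_def eventually_near)
  have kill: "G.eqg (fieldop X ?J) (\<lambda>_. 0)" if "CR_vector_field d M p X" for X
    using CR_field_kills_holomorphic[OF that holo_fun_on_power[OF J] U]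
    by (simp add: G.eqg_def eventually_near)
  have kill': "G.eqg (fieldop (\<lambda>z. ctv_cnj (X z)) ?K) (\<lambda>_. 0)" if "CR_vector_field d M p X" for X
    unfolding G.eqg_def eventually_near
    using CR_field_kills_holomorphic[OF that holo_fun_on_power[OF J] U, of m]
      smooth_at_eventually[OF smooth_at_power[OF sJ, of m]]
  proof eventually_elim
    case (elim z)
    then show ?case using fieldop_cnj[of z ?J X] by simp
  qed
  have dom: "G.dominated ?C \<delta> (fieldop X h)"
    if "X \<in> CR_lie_algebra d M p" "G.dominated ?C \<delta> h" for X h
    using that
  proof (induction arbitrary: h rule: CR_lie_algebra.induct)
    case (CR X)
    show ?case
      by (rule G.dominated_derivation[OF der[OF CR_vector_field_tangential[OF CR(1)]] CR(2) C, of ?J b])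
        (use sm eqJ kill[OF CR(1)] in auto)
  next
    case (CR_cnj X)
    show ?case
      by (rule G.dominated_derivation[OF der[OF tangential_cnj[OF CR_vector_field_tangential[OF CR_cnj(1)]]]
            CR_cnj(2) C, of ?K b'])
        (use sm eqK kill'[OF CR_cnj(1)] in auto)
  next
    case (add X Y)
    have "G.dominated ?C \<delta> (\<lambda>z. fieldop X h z + fieldop Y h z)"
      using add by (intro G.dominated_add) auto
    then show ?case by (simp add: fieldop_def ctv_apply_vec_add)
  next
    case (scale X c)
    have "G.dominated ?C \<delta> (\<lambda>z. c * fieldop X h z)"
      using scale by (intro G.dominated_cmult) auto
    then show ?case by (simp add: fieldop_def ctv_apply_scale)
  next
    case (bracket X Y)
    have h: "smooth_at p h" using bracket.prems by (simp add: G.dominated_def)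
    have X: "smooth_at p X" and Y: "smooth_at p Y"
      using bracket.hyps CR_lie_algebra_smooth by blast+
    have "G.dominated ?C \<delta> (\<lambda>z. fieldop X (fieldop Y h) z + (-1) * fieldop Y (fieldop X h) z)"
      using bracket by (intro G.dominated_add G.dominated_cmult) auto
    then show ?case
    proof (rule G.dominated_cong)
      show "G.eqg (\<lambda>z. fieldop X (fieldop Y h) z + (-1) * fieldop Y (fieldop X h) z) (fieldop (lie_bracket X Y) h)"
        unfolding G.eqg_def eventually_near
        using smooth_at_eventually[OF h] smooth_at_eventually[OF X] smooth_at_eventually[OF Y]
        by eventually_elim (simp add: fieldop_def[of "lie_bracket X Y"] lie_bracket_apply
            fieldop_def[of X "fieldop Y h"] fieldop_def[of Y "fieldop X h"])
      show "fieldop (lie_bracket X Y) h \<in> {f. smooth_at p f}"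
        using smooth_at_fieldop[OF smooth_at_lie_bracket[OF X Y] h] by simp
    qed
  qed
  obtain X Y where X: "\<And>k. X k \<in> CR_lie_algebra d M p" "\<And>k. fst (X k p) = axis k 1"
    and Y: "\<And>k. Y k \<in> CR_lie_algebra d M p" "\<And>k. snd (Y k p) = axis k 1"
    using finite_type_frame[OF ldf ft] by metis
  have sX: "smooth_at p (X k)" and sY: "smooth_at p (Y k)" for k
    using X Y CR_lie_algebra_smooth by blast+
  obtain ks where ks: "foldr (\<lambda>k. fieldop (X k)) ks J p \<noteq> 0"
    using word_nonzero[OF J U sX X(2) nz] by blast
  \<comment> \<open>\<open>word_nonzero\<close> is about holomorphic functions, so the word for conj
    J is the conjugate of a word in the conjugate fields applied to J.\<close>
  have Y': "fst (ctv_cnj (Y k p)) = axis k 1" for k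
    by (simp add: ctv_cnj_def Y vec_eq_iff axis_def)
  obtain ls where ls: "foldr (\<lambda>k. fieldop (\<lambda>z. ctv_cnj (Y k z))) ls J p \<noteq> 0"
    using word_nonzero[OF J U smooth_at_ctv_cnj[OF sY] Y' nz] by blast
  have cnj_word: "smooth_at p (foldr (\<lambda>k. fieldop (\<lambda>z. ctv_cnj (Y k z))) ls J) \<and>
      (\<forall>\<^sub>F z in nhds p. foldr (\<lambda>k. fieldop (Y k)) ls (\<lambda>z. cnj (J z)) z
        = cnj (foldr (\<lambda>k. fieldop (\<lambda>z. ctv_cnj (Y k z))) ls J z))" for ls
  proof (induction ls)
    case Nil
    then show ?case by (simp add: sJ)
  next
    case (Cons l ls)
    let ?f = "foldr (\<lambda>k. fieldop (\<lambda>z. ctv_cnj (Y k z))) ls J"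
    let ?g = "foldr (\<lambda>k. fieldop (Y k)) ls (\<lambda>z. cnj (J z))"
    have "\<forall>\<^sub>F z in nhds p. \<forall>\<^sub>F w in nhds z. cnj (?f w) = ?g w"
      using Cons by (simp only: eventually_eventually eq_commute)
    then have "\<forall>\<^sub>F z in nhds p. fieldop (Y l) ?g z = cnj (fieldop (\<lambda>z. ctv_cnj (Y l z)) ?f z)"
      using smooth_at_eventually[OF conjunct1[OF Cons]]
    proof eventually_elim
      case (elim z)
      have "fieldop (Y l) ?g z = fieldop (\<lambda>z. ctv_cnj (ctv_cnj (Y l z))) (\<lambda>w. cnj (?f w)) z"
        using ctv_apply_cong[OF elim(1) smooth_at_differentiable[OF smooth_at_cnj[OF elim(2)]], of "Y l z"]
        by (simp add: fieldop_def[of "Y l"] fieldop_def[of "\<lambda>z. ctv_cnj (ctv_cnj (Y l z))"])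
      then show ?case using fieldop_cnj[OF elim(2), of "\<lambda>z. ctv_cnj (Y l z)"] by simp
    qed
    then show ?case using Cons smooth_at_fieldop[OF smooth_at_ctv_cnj[OF sY]] by simp
  qed
  have ls': "foldr (\<lambda>k. fieldop (Y k)) ls (\<lambda>z. cnj (J z)) p \<noteq> 0"
    using ls eventually_nhds_x_imp_x[OF conjunct2[OF cnj_word[of ls]]] by simp
  \<comment> \<open>Reversed because \<open>foldr\<close> applies its last letter first and
    \<open>wordval\<close> its first. The front half makes the value of J finite, the back half that
    of conj J.\<close>
  define Ds where "Ds = map (\<lambda>k. fieldop (X k)) (rev ks) @ map (\<lambda>k. fieldop (Y k)) (rev ls)"
  have Ds: "\<exists>Z \<in> CR_lie_algebra d M p. D = fieldop Z" if "D \<in> set Ds" for D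
    using that X Y by (auto simp: Ds_def)
  then have derDs: "G.derivation D" if "D \<in> set Ds" for D
    using that der tangential_CR_lie_algebra by blast
  have v: "G.valuation (G.wordval Ds)" by (rule G.wordval_valuation[OF derDs])
  have "G.wordval Ds J \<noteq> \<infinity>"
    unfolding Ds_def using ks
    by (intro G.wordval_finiteI) (simp add: foldr_conv_fold fold_map o_def)
  moreover have "G.wordval Ds (\<lambda>z. cnj (J z)) \<noteq> \<infinity>"
  proof -
    have "G.wordval (map (\<lambda>k. fieldop (Y k)) (rev ls) @ []) (\<lambda>z. cnj (J z)) \<noteq> \<infinity>"
      using ls' by (intro G.wordval_finiteI) (simp add: foldr_conv_fold fold_map o_def)
    then show ?thesis unfolding Ds_def by (intro G.wordval_append_finite) simp
  qed
  ultimately have fin: "G.wordval Ds c \<noteq> \<infinity>" if "c \<in> ?C" for c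
    using that G.val_power[OF v, of J m] G.val_power[OF v, of "\<lambda>z. cnj (J z)" m] sJ smooth_at_cnj[OF sJ] by auto
  show ?thesis
  proof (rule G.divisor_nonzero[OF derDs _ fin])
    show "G.dominated ?C \<delta> (D h)" if "D \<in> set Ds" "G.dominated ?C \<delta> h" for D h
      using Ds[OF that(1)] dom that(2) by blast
  qed (use sm C eqJ in auto)
qed

text \<open>Exchanges the existentially chosen defining function for the given one, using that
  tangent vectors annihilate everything that vanishes on M.\<close>

lemma T10_eq:
  assumes ldf: "local_defining_function d M z U \<rho>" and z: "z \<in> M"
  shows "T10 d M z = {(x, 0) | x. \<forall>j<d. del_form (\<rho> j) z x = 0}"
proof -
  have zU: "z \<in> U" using ldf by (simp add: local_defining_function_def)
  note dR = defining_has_derivative[OF ldf _ zU]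
  have MU: "M \<inter> U = {z \<in> U. \<forall>j<d. \<rho> j z = 0}" using ldf by (simp add: local_defining_function_def)
  have U: "open U" using ldf by (simp add: local_defining_function_def)
  have kill: "ctv_apply Y (\<lambda>w. complex_of_real (\<rho> j w)) z = 0" if "Y \<in> ctangent_space d M z" "j < d" for Y j
  proof (rule ctangent_kills_vanishing[OF that(1) z])
    show "smooth_at z (\<lambda>w. complex_of_real (\<rho> j w))"
      by (rule smooth_at_of_real[OF defining_smooth_at[OF ldf that(2) zU]])
    show "\<forall>\<^sub>F w in nhds z. w \<in> M \<longrightarrow> complex_of_real (\<rho> j w) = 0"
      using eventually_nhds_in_open[OF U zU] MU that(2) by (auto elim!: eventually_mono)
  qed
  have "X \<in> T10 d M z \<longleftrightarrow> snd X = 0 \<and> (\<forall>j<d. del_form (\<rho> j) z (fst X) = 0)" for X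
  proof
    assume "X \<in> T10 d M z"
    then obtain Y where Y: "X = ctv_cnj Y" "Y \<in> ctangent_space d M z" "fst Y = 0"
      by (auto simp: T10_def T01_def T01_space_def)
    have X: "X = (fst X, 0)" using Y by (simp add: ctv_cnj_def vec_eq_iff)
    have "del_form (\<rho> j) z (fst X) = 0" if "j < d" for j
    proof -
      have "ctv_apply X (\<lambda>w. complex_of_real (\<rho> j w)) z = 0"
        using kill[OF Y(2) that] ctv_apply_cnj_of_real[OF dR[OF that], of Y] Y(1) by simp
      then show ?thesis using ctv_apply_T10[of "fst X" "\<rho> j" z] X by simp
    qed
    then show "snd X = 0 \<and> (\<forall>j<d. del_form (\<rho> j) z (fst X) = 0)" using X by (metis snd_conv)
  next
    assume X: "snd X = 0 \<and> (\<forall>j<d. del_form (\<rho> j) z (fst X) = 0)"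
    have X': "X = (fst X, 0)" using X by (simp add: prod_eq_iff)
    have "ctv_apply (ctv_cnj X) (\<lambda>w. complex_of_real (\<rho> j w)) z = 0" if "j < d" for j
      unfolding ctv_apply_cnj_of_real[OF dR[OF that]]
      using X that ctv_apply_T10[of "fst X" "\<rho> j" z] X' by simp
    then have "ctv_cnj X \<in> ctangent_space d M z" using ldf by (auto simp: ctangent_space_def)
    moreover have "fst (ctv_cnj X) = 0" using X by (simp add: ctv_cnj_def vec_eq_iff)
    ultimately have "ctv_cnj X \<in> T01 d M z" by (simp add: T01_def T01_space_def)
    then have "ctv_cnj (ctv_cnj X) \<in> T10 d M z" unfolding T10_def by (rule imageI)
    then show "X \<in> T10 d M z" by simp
  qed
  then show ?thesis by (auto simp: prod_eq_iff)
qed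

text \<open>The space \<open>T10 d M' (H p)\<close> is the common kernel of d independent forms, so
  together with the image of the Jacobian it spans everything exactly when these forms stay
  independent on that image, that is, after pullback by H.\<close>

lemma CR_transversal_iff:
  assumes ldf: "local_defining_function d M' (H p) U \<rho>" and Hp: "H p \<in> M'"
    and H: "holo_map_on H V" "p \<in> V"
  shows "CR_transversal d M' H p \<longleftrightarrow> (\<exists>v. wedge d (\<lambda>j. del_form (\<lambda>w. \<rho> j (H w)) p) v \<noteq> 0)"
proof -
  have pU: "H p \<in> U" using ldf by (simp add: local_defining_function_def)
  let ?A = "holo_jacobian H p"
  let ?a = "\<lambda>j. del_form (\<rho> j) (H p)" and ?b = "\<lambda>j. del_form (\<lambda>w. \<rho> j (H w)) p"
  have b: "?b j v = ?a j (?A *v v)" if "j < d" for j v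
    by (rule del_form_compose[OF H defining_smooth_at[OF ldf that pU]])
  have push: "ctv_push H p ` T10_space = {(?A *v y, 0) | y. True}"
  proof -
    have T10: "T10_space = range (\<lambda>y. (y, 0))" by (auto simp: T10_space_def prod_eq_iff image_iff)
    show ?thesis unfolding T10 image_image ctv_push_T10[OF H] by auto
  qed
  have trans: "CR_transversal d M' H p \<longleftrightarrow> (\<forall>w. \<exists>x y. (\<forall>j<d. ?a j x = 0) \<and> w = x + ?A *v y)"
  proof -
    let ?L = "{X + Y | X Y. X \<in> T10 d M' (H p) \<and> Y \<in> ctv_push H p ` T10_space}"
    have mem: "(w, u) \<in> ?L \<longleftrightarrow> u = 0 \<and> (\<exists>x y. (\<forall>j<d. ?a j x = 0) \<and> w = x + ?A *v y)" for w u
    proof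
      assume "(w, u) \<in> ?L"
      then show "u = 0 \<and> (\<exists>x y. (\<forall>j<d. ?a j x = 0) \<and> w = x + ?A *v y)"
        unfolding push T10_eq[OF ldf Hp] by auto
    next
      assume "u = 0 \<and> (\<exists>x y. (\<forall>j<d. ?a j x = 0) \<and> w = x + ?A *v y)"
      then obtain x y where xy: "\<forall>j<d. ?a j x = 0" "(w, u) = (x, 0) + (?A *v y, 0)" by auto
      then show "(w, u) \<in> ?L" unfolding push T10_eq[OF ldf Hp] by blast
    qed
    have "CR_transversal d M' H p \<longleftrightarrow> (\<forall>w u. (w, u) \<in> ?L \<longleftrightarrow> u = 0)"
      unfolding CR_transversal_def T10_space_def set_eq_iff split_paired_All by simp
    then show ?thesis unfolding mem by blast
  qed
  show ?thesis
  proof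
    assume "CR_transversal d M' H p"
    then have *: "\<forall>w. \<exists>x y. (\<forall>j<d. ?a j x = 0) \<and> w = x + ?A *v y" by (simp add: trans)
    obtain w where w: "wedge d ?a w \<noteq> 0"
      using ldf pU by (fastforce simp: local_defining_function_def)
    \<comment> \<open>The part \<open>x i\<close> is killed by the forms, so the image of
      \<open>y i\<close> can replace \<open>w i\<close> in the wedge product.\<close>
    obtain x y where xy: "\<And>i. (\<forall>j<d. ?a j (x i) = 0) \<and> w i = x i + ?A *v y i"
      using *[THEN spec, of "w _"] by metis
    have "wedge d ?b y = wedge d ?a w"
      by (rule wedge_cong) (use xy in \<open>simp add: b del_form_add\<close>)
    then show "\<exists>v. wedge d ?b v \<noteq> 0" using w by metis
  next
    assume "\<exists>v. wedge d ?b v \<noteq> 0"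
    then obtain v where v: "wedge d ?b v \<noteq> 0" by blast
    show "CR_transversal d M' H p"
      unfolding trans
    proof
      fix w
      obtain c where c: "\<And>j. j < d \<Longrightarrow> (\<Sum>i<d. c i * ?b j (v i)) = ?a j w"
        using wedge_solve[OF v, where b = "\<lambda>j. ?a j w"] by blast
      define y where "y = (\<Sum>i<d. c i *s v i)"
      have "?a j (w - ?A *v y) = 0" if "j < d" for j
      proof -
        have "?a j (?A *v y) = ?a j w"
          using c[OF that] b[OF that, of y] by (simp add: y_def del_form_sum)
        moreover have "?a j w = ?a j (w - ?A *v y) + ?a j (?A *v y)"
          unfolding del_form_add[symmetric] by simp
        ultimately show ?thesis by simp
      qed
      then show "\<exists>x y. (\<forall>j<d. ?a j x = 0) \<and> w = x + ?A *v y"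
        by (intro exI[of _ "w - ?A *v y"] exI[of _ y]) simp
    qed
  qed
qed

theorem theorem1p3:
  fixes M M' :: "(complex^'n::finite) set"
    and H :: "complex^'n \<Rightarrow> complex^'n"
    and p p' :: "complex^'n"
    and d :: nat
  assumes "generic_submanifold d M" and "generic_submanifold d M'"
    and "p \<in> M" and "p' \<in> M'"
    and "\<exists>U. open U \<and> p \<in> U \<and> holo_map_on H U"
    and "H p = p'"
    and "\<forall>\<^sub>F z in nhds p. z \<in> M \<longrightarrow> H z \<in> M'"
    and "holo_nondegenerate d M p"
    and "finite_type d M p"
  shows "CR_transversal d M' H p \<longleftrightarrow> \<not> (\<forall>\<^sub>F z in nhds p. Jac H z = 0)"
proof -
  obtain U \<rho> where ldf: "local_defining_function d M p U \<rho>"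
    using assms(1,3) by (auto simp: generic_submanifold_def)
  obtain U' \<rho>' where ldf': "local_defining_function d M' (H p) U' \<rho>'"
    using assms(2,4,6) by (auto simp: generic_submanifold_def)
  obtain V where V: "open V" "p \<in> V" and H: "holo_map_on H V" using assms(5) by blast
  have U: "open U" "p \<in> U" and U': "open U'" "H p \<in> U'"
    and MU': "M' \<inter> U' = {z \<in> U'. \<forall>j<d. \<rho>' j z = 0}"
    using ldf ldf' by (auto simp: local_defining_function_def)
  have holo: "holo_fun_on (\<lambda>z. H z $ i) V" for i using H by (simp add: holo_map_on_def)
  have holoJ: "holo_fun_on (\<lambda>z. holo_jacobian H z $ i $ k) V" for i k
    using holo_fun_on_dZ_holo[OF holo V(1)] by (simp add: holo_jacobian_def)
  have holo_smooth: "smooth_at z f" if "holo_fun_on f V" "z \<in> V" for f :: "complex^'n \<Rightarrow> complex" and z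
    using holo_fun_on_smooth[OF that(1) V(1)] V(1) that(2) smooth_atI by blast
  have sH: "smooth_at p H" by (rule smooth_at_vecI) (rule holo_smooth[OF holo V(2)])
  have inU': "\<forall>\<^sub>F z in nhds p. H z \<in> U'"
  proof -
    have "(H \<longlongrightarrow> H p) (nhds p)"
      using smooth_at_isCont[OF sH] by (simp add: isCont_def tendsto_at_iff_tendsto_nhds)
    then show ?thesis using U' by (rule topological_tendstoD)
  qed
  define \<alpha> where "\<alpha> z j = del_form (\<rho> j) z" for z j
  define \<alpha>' where "\<alpha>' z j = del_form (\<rho>' j) z" for z j
  define g where "g j z = \<rho>' j (H z)" for j z
  define \<beta> where "\<beta> z j = del_form (g j) z" for z j
  have \<beta>_eq: "\<forall>\<^sub>F z in nhds p. \<forall>j<d. \<forall>v. \<beta> z j v = \<alpha>' (H z) j (holo_jacobian H z *v v)"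
    using inU' eventually_nhds_in_open[OF V]
  proof eventually_elim
    case (elim z)
    then show ?case
      unfolding \<beta>_def \<alpha>'_def g_def using del_form_compose[OF H elim(2)] defining_smooth_at[OF ldf'] by blast
  qed
  have sg: "smooth_at p (g j)" if "j < d" for j
    unfolding g_def by (rule smooth_at_compose[OF defining_smooth_at[OF ldf' that U'(2)] sH])
  have g0: "\<forall>\<^sub>F z in nhds p. z \<in> M \<longrightarrow> (\<forall>j<d. g j z = 0)"
    using assms(7) inU'
  proof eventually_elim
    case (elim z)
    then show ?case using MU' by (auto simp: g_def)
  qed
  \<comment> \<open>The matrix is obtained pointwise on M, without any regularity in z; a smooth
    version of its determinant is the quotient \<delta> below.\<close>
  have comb: "\<forall>\<^sub>F z in nhds p. z \<in> M \<longrightarrow>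
      (\<exists>A :: nat \<Rightarrow> nat \<Rightarrow> real. \<forall>j<d. \<forall>v. \<beta> z j v = (\<Sum>l<d. of_real (A j l) * \<alpha> z l v))"
  proof -
    have "\<forall>\<^sub>F z in nhds p. \<forall>j\<in>{..<d}. smooth_at z (g j)"
      using sg smooth_at_eventually by (intro eventually_ball_finite) blast+
    moreover have "\<forall>\<^sub>F z in nhds p. \<forall>\<^sub>F w in nhds z. w \<in> M \<longrightarrow> (\<forall>j<d. g j w = 0)"
      using g0 by (simp only: eventually_eventually)
    ultimately show ?thesis
      using eventually_nhds_in_open[OF U]
    proof eventually_elim
      case (elim z)
      show ?case
      proof
        assume z: "z \<in> M"
        obtain a where a: "\<forall>r. smooth_at z r \<and> (\<forall>\<^sub>F w in nhds z. w \<in> M \<longrightarrow> r w = 0) \<longrightarrow>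
            (\<forall>v. del_form r z v = (\<Sum>l<d. complex_of_real (a r l) * del_form (\<rho> l) z v))"
          using vanishing_del_form_combination[OF ldf z elim(3)] by (elim exE)
        have "\<beta> z j v = (\<Sum>l<d. of_real (a (g j) l) * \<alpha> z l v)" if j: "j < d" for j v
        proof -
          have "\<forall>\<^sub>F w in nhds z. w \<in> M \<longrightarrow> g j w = 0" using elim(2) by (rule eventually_mono) (use j in blast)
          then show ?thesis
            unfolding \<beta>_def \<alpha>_def using a[THEN spec, of "g j"] elim(1) j by simp
        qed
        then show "\<exists>A :: nat \<Rightarrow> nat \<Rightarrow> real. \<forall>j<d. \<forall>v. \<beta> z j v = (\<Sum>l<d. of_real (A j l) * \<alpha> z l v)"
          by (intro exI[of _ "\<lambda>j. a (g j)"]) blast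
      qed
    qed
  qed
  have transversal: "CR_transversal d M' H p \<longleftrightarrow> (\<exists>v. wedge d (\<beta> p) v \<noteq> 0)"
    unfolding \<beta>_def g_def using CR_transversal_iff[OF ldf' _ H V(2)] assms(4,6) by simp
  have s\<beta>: "smooth_at p (\<lambda>z. wedge d (\<beta> z) (x z))" if "\<And>i. i < d \<Longrightarrow> smooth_at p (\<lambda>z. x z i)" for x
    unfolding \<beta>_def by (intro smooth_at_wedge smooth_at_del_form sg that)
  have s\<alpha>: "smooth_at p (\<lambda>z. wedge d (\<alpha> z) (x z))" if "\<And>i. i < d \<Longrightarrow> smooth_at p (\<lambda>z. x z i)" for x
    unfolding \<alpha>_def by (intro smooth_at_wedge smooth_at_del_form defining_smooth_at[OF ldf _ U(2)] that)
  have s\<alpha>': "smooth_at p (\<lambda>z. wedge d (\<alpha>' (H z)) w)" for w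
  proof -
    have "smooth_at (H p) (\<lambda>z. wedge d (\<alpha>' z) w)"
      unfolding \<alpha>'_def
      by (intro smooth_at_wedge smooth_at_del_form defining_smooth_at[OF ldf' _ U'(2)] smooth_at_const)
    then show ?thesis by (rule smooth_at_compose[OF _ sH])
  qed
  show ?thesis
  proof
    assume "CR_transversal d M' H p"
    then obtain v where v: "wedge d (\<beta> p) v \<noteq> 0" using transversal by blast
    show "\<not> (\<forall>\<^sub>F z in nhds p. Jac H z = 0)"
    proof
      assume "\<forall>\<^sub>F z in nhds p. Jac H z = 0"
      then have "\<forall>\<^sub>F z in nhds p. det (holo_jacobian H z) = 0" by (simp add: Jac_eq)
      from holomorphic_kernel_field[OF holoJ this]
      obtain \<phi> where \<phi>: "holo_map_on \<phi> V" "\<forall>\<^sub>F z in nhds p. holo_jacobian H z *v \<phi> z = 0"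
        "\<not> (\<forall>\<^sub>F z in nhds p. \<phi> z = 0)" by blast
      \<comment> \<open>Transversality persists near p, so det A is nonzero on M there and \<alpha>
        vanishes wherever A \<alpha> does.\<close>
      have nz: "\<forall>\<^sub>F z in nhds p. wedge d (\<beta> z) v \<noteq> 0"
        by (rule smooth_at_nonzero_eventually[OF s\<beta> v]) (rule smooth_at_const)
      have "\<forall>\<^sub>F z in nhds p. z \<in> M \<longrightarrow>
          (\<forall>j<d. ctv_apply (\<phi> z, 0) (\<lambda>w. complex_of_real (\<rho> j w)) z = 0)"
        using comb nz \<beta>_eq \<phi>(2)
      proof eventually_elim
        case (elim z)
        show ?case
        proof (intro impI allI)
          fix l assume "z \<in> M" and l: "l < d"
          then obtain A :: "nat \<Rightarrow> nat \<Rightarrow> real"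
            where A: "\<And>j v. j < d \<Longrightarrow> \<beta> z j v = (\<Sum>l<d. of_real (A j l) * \<alpha> z l v)" using elim(1) by blast
          have "wedge d (\<beta> z) v = wedge d (\<lambda>j l. complex_of_real (A j l)) (\<lambda>l. l) * wedge d (\<alpha> z) v"
            by (rule wedge_mult) (rule A)
          then have "wedge d (\<lambda>j l. complex_of_real (A j l)) (\<lambda>l. l) \<noteq> 0" using elim(2) by auto
          moreover have "(\<Sum>l<d. complex_of_real (A j l) * \<alpha> z l (\<phi> z)) = 0" if "j < d" for j
            unfolding A[OF that, symmetric] using elim(3,4) that by (simp add: \<alpha>'_def del_form_def)
          ultimately have "\<alpha> z l (\<phi> z) = 0" using l by (rule wedge_kernel)
          then show "ctv_apply (\<phi> z, 0) (\<lambda>w. complex_of_real (\<rho> l w)) z = 0"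
            by (simp add: ctv_apply_T10 \<alpha>_def)
        qed
      qed
      then have "tangent_holo_field d M p \<phi>"
        unfolding tangent_holo_field_def using V \<phi>(1) ldf by blast
      then show False using assms(8) \<phi>(3) unfolding holo_nondegenerate_def by blast
    qed
  next
    assume nz: "\<not> (\<forall>\<^sub>F z in nhds p. Jac H z = 0)"
    \<comment> \<open>The fixed vectors \<open>v\<close> and \<open>w\<close> make the denominators
      of \<delta> and \<open>b\<close> nonzero near p.\<close>
    obtain v where v: "wedge d (\<alpha> p) v \<noteq> 0"
      using ldf U(2) unfolding local_defining_function_def \<alpha>_def by fastforce
    obtain w where w: "wedge d (\<alpha>' (H p)) w \<noteq> 0"
      using ldf' U'(2) unfolding local_defining_function_def \<alpha>'_def by fastforce
    define J where "J z = det (holo_jacobian H z)" for z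
    have J: "holo_fun_on J V" unfolding J_def by (rule holo_fun_on_det[OF holoJ])
    have nzJ: "\<not> (\<forall>\<^sub>F z in nhds p. J z = 0)" using nz by (simp add: J_def Jac_eq)
    \<comment> \<open>Cramer's numerators times one more factor J: the identity H_Z y = J^2 w then
      also holds at the zeros of J, where Cramer's rule says nothing.\<close>
    define y where "y z i = (\<chi> k. J z * det (\<chi> i' k'. if k' = k then w i $ i' else holo_jacobian H z $ i' $ k'))" for z i
    have y: "holo_jacobian H z *v y z i = (J z)\<^sup>2 *s w i" for z i
    proof (cases "J z = 0")
      case True
      then show ?thesis by (simp add: y_def matrix_vector_mult_def vec_eq_iff)
    next
      case False
      let ?A = "holo_jacobian H z"
      let ?x = "\<chi> k. det (\<chi> i' k'. if k' = k then w i $ i' else ?A $ i' $ k') / det ?A"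
      have "?A *v ?x = w i" using cramer[of ?A ?x "w i"] False by (simp add: J_def)
      moreover have "y z i = (J z)\<^sup>2 *s ?x"
        using False by (simp add: y_def J_def vec_eq_iff power2_eq_square)
      moreover have "?A *v (c *s x) = c *s (?A *v x)" for c x
        by (simp add: matrix_vector_mult_def vec_eq_iff sum_distrib_left mult_ac)
      ultimately show ?thesis by simp
    qed
    have sy: "smooth_at p (\<lambda>z. y z i)" for i
    proof (rule smooth_at_vecI)
      fix k
      have "holo_fun_on (\<lambda>z. (\<chi> i' k'. if k' = k then w i $ i' else holo_jacobian H z $ i' $ k') $ a $ b) V" for a b
        by (cases "b = k") (simp_all add: holo_fun_on_const holoJ)
      then have "holo_fun_on (\<lambda>z. y z i $ k) V"
        unfolding y_def by (simp add: holo_fun_on_mult[OF J] holo_fun_on_det)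
      then show "smooth_at p (\<lambda>z. y z i $ k)" using V(2) by (rule holo_smooth)
    qed
    \<comment> \<open>On M this is det A; as a quotient it is smooth in a full neighbourhood of
      p.\<close>
    define \<delta> where "\<delta> z = wedge d (\<beta> z) v / wedge d (\<alpha> z) v" for z
    define b where "b z = wedge d (\<alpha> z) (y z) / wedge d (\<alpha>' (H z)) w" for z
    have s: "smooth_at p \<delta>" "smooth_at p b"
      unfolding \<delta>_def b_def using v w
      by (auto intro!: smooth_at_divide s\<beta> s\<alpha> s\<alpha>' sy smooth_at_const)
    \<comment> \<open>The wedge of \<beta> on the d vectors \<open>y z i\<close> is computed in two
      ways, through H_Z and through A. Each vector contributes (J z)^2, whence the exponent 2
      d.\<close>
    have key: "\<forall>\<^sub>F z in nhds p. z \<in> M \<longrightarrow> \<delta> z \<in> \<real> \<and> J z ^ (2 * d) = \<delta> z * b z"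
      using comb \<beta>_eq smooth_at_nonzero_eventually[OF s\<alpha>, of "\<lambda>_. v", OF smooth_at_const v]
        smooth_at_nonzero_eventually[OF s\<alpha>' w]
    proof eventually_elim
      case (elim z)
      show ?case
      proof
        assume "z \<in> M"
        then obtain A :: "nat \<Rightarrow> nat \<Rightarrow> real"
          where A: "\<And>j v. j < d \<Longrightarrow> \<beta> z j v = (\<Sum>l<d. of_real (A j l) * \<alpha> z l v)" using elim(1) by blast
        have det: "wedge d (\<beta> z) x = wedge d (\<lambda>j l. complex_of_real (A j l)) (\<lambda>l. l) * wedge d (\<alpha> z) x" for x
          by (rule wedge_mult) (rule A)
        then have \<delta>: "\<delta> z = wedge d (\<lambda>j l. complex_of_real (A j l)) (\<lambda>l. l)"
          using elim(3) by (simp add: \<delta>_def)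
        have "wedge d (\<beta> z) (y z) = ((J z)\<^sup>2) ^ d * wedge d (\<alpha>' (H z)) w"
          by (rule wedge_scale_right) (use elim(2) y in \<open>simp add: \<alpha>'_def del_form_scale\<close>)
        moreover have "wedge d (\<beta> z) (y z) = \<delta> z * wedge d (\<alpha> z) (y z)"
          unfolding \<delta> by (rule det)
        ultimately have "((J z)\<^sup>2) ^ d * wedge d (\<alpha>' (H z)) w = \<delta> z * wedge d (\<alpha> z) (y z)"
          by metis
        then have "J z ^ (2 * d) = \<delta> z * b z"
          unfolding power_mult b_def times_divide_eq_right using elim(4) by (subst eq_divide_eq) simp
        then show "\<delta> z \<in> \<real> \<and> J z ^ (2 * d) = \<delta> z * b z"
          using wedge_of_real_Reals[of d A] \<delta> by simp
      qed
    qed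
    have "\<delta> p \<noteq> 0"
    \<comment> \<open>As \<delta> is real on M, conjugation turns the first factorization into the
      second, with the conjugate of \<open>b\<close> as cofactor.\<close>
    proof (rule finite_type_divisor_nonzero[OF ldf assms(3,9) J V nzJ s smooth_at_cnj[OF s(2)], of "2 * d"])
      show "\<forall>\<^sub>F z in nhds p. z \<in> M \<longrightarrow> J z ^ (2 * d) = \<delta> z * b z"
        using key by (rule eventually_mono) blast
      show "\<forall>\<^sub>F z in nhds p. z \<in> M \<longrightarrow> cnj (J z) ^ (2 * d) = \<delta> z * cnj (b z)"
        using key
      proof (rule eventually_mono, intro impI)
        fix z assume "z \<in> M \<longrightarrow> \<delta> z \<in> \<real> \<and> J z ^ (2 * d) = \<delta> z * b z" "z \<in> M"
        then have "cnj (J z ^ (2 * d)) = cnj (\<delta> z * b z)" "cnj (\<delta> z) = \<delta> z"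
          by (auto simp: Reals_cnj_iff)
        then show "cnj (J z) ^ (2 * d) = \<delta> z * cnj (b z)" by simp
      qed
    qed
    then have "wedge d (\<beta> p) v \<noteq> 0" by (auto simp: \<delta>_def)
    then show "CR_transversal d M' H p" using transversal by blast
  qed
qed

end
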